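(* Let $B$ be an interpolating Blaschke product with zeros $\{a_j\}_{j\in\mathbb N}$, and let $\{w_j\}_{j\in\mathbb N}\in\ell^\infty$ be a bounded sequence of complex numbers. Then $$\{w_j\}\in K^\infty_B\big|_{\{a_j\}}$$ (that is, there exists $f\in K^\infty_B$ with $f(a_j)=w_j$ for all $j\in\mathbb N$) if and only if $$\sup_{k\in\mathbb N}\left|\sum_{j}\frac{w_j}{B'(a_j)\cdot(1-a_j\overline{a_k})}\right|<\infty.$$
   Context: $\mathbb D$ is the open unit disk in $\mathbb C$, $\mathbb T$ its boundary, and $m$ normalized arclength measure on $\mathbb T$. $H^\infty$ is the space of bounded holomorphic functions on $\mathbb D$, identified with their boundary functions (defined a.e. on $\mathbb T$), and $H^\infty_0=\{f\in H^\infty: f(0)=0\}$. Given a sequence $\{a_j\}_{j\in\mathbb N}$ in $\mathbb D$ with $\sum_j(1-|a_j|)<\infty$, the associated Blaschke product is $$B(z)=\prod_j b_j(z),\qquad b_j(z)=\frac{|a_j|}{a_j}\,\frac{a_j-z}{1-\overline{a_j}z},$$ with the convention $|a_j|/a_j=-1$ if $a_j=0$. $B$ is called an interpolating Blaschke product (with zeros $\{a_j\}$) if $\inf_j|B'(a_j)|\,(1-|a_j|)>0$. The star-invariant subspace $K^\infty_B$ is $K^\infty_B:=H^\infty\cap B\,\overline{H^\infty_0}$, i.e. the set of $f\in H^\infty$ for which there is $g\in H^\infty_0$ with $f=B\overline g$ a.e. on $\mathbb T$. For a function space $\mathcal X$ on $\mathbb D$, $\mathcal X\big|_{\{a_j\}}$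 denotes the set of complex sequences $\{w_j\}$ for which there is $f\in\mathcal X$ with $f(a_j)=w_j$ for all $j\in\mathbb N$. *)

theory Defs
  imports "HOL-Complex_Analysis.Complex_Analysis"
begin

definition arclength :: "complex measure" where
  "arclength = distr (uniform_measure lborel {0..2 * pi}) borel cis"

definition Hinf :: "(complex \<Rightarrow> complex) set" where
  "Hinf = {f. f holomorphic_on ball 0 1 \<and> bounded (f ` ball 0 1)}"

definition Hinf0 :: "(complex \<Rightarrow> complex) set" where
  "Hinf0 = {f \<in> Hinf. f 0 = 0}"

text \<open>Boundary functions are radial limits. For functions in \<open>Hinf\<close> these exist almost
  everywhere on the circle (Fatou) and agree with the non-tangential limits.\<close>

definition has_boundary_value :: "(complex \<Rightarrow> complex) \<Rightarrow> complex \<Rightarrow> complex \<Rightarrow> bool" where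
  "has_boundary_value f \<zeta> l \<longleftrightarrow> ((\<lambda>r::real. f (of_real r * \<zeta>)) \<longlongrightarrow> l) (at_left 1)"

definition blaschke_factor :: "complex \<Rightarrow> complex \<Rightarrow> complex" where
  "blaschke_factor a z =
     (if a = 0 then -1 else of_real (cmod a) / a) * ((a - z) / (1 - cnj a * z))"

definition blaschke_product :: "(nat \<Rightarrow> complex) \<Rightarrow> complex \<Rightarrow> complex" where
  "blaschke_product a z = (\<Prod>j. blaschke_factor (a j) z)"

definition blaschke_sequence :: "(nat \<Rightarrow> complex) \<Rightarrow> bool" where
  "blaschke_sequence a \<longleftrightarrow> (\<forall>j. a j \<in> ball 0 1) \<and> summable (\<lambda>j. 1 - cmod (a j))"

definition interpolating_blaschke :: "(nat \<Rightarrow> complex) \<Rightarrow> bool" where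
  "interpolating_blaschke a \<longleftrightarrow> blaschke_sequence a \<and>
     (INF j. cmod (deriv (blaschke_product a) (a j)) * (1 - cmod (a j))) > 0"

text \<open>The space \<open>Hinf \<inter> B * cnj Hinf0\<close>: the identity \<open>f = B * cnj g\<close> is required almost
  everywhere on the circle, between boundary values.\<close>

definition Kinf :: "(complex \<Rightarrow> complex) \<Rightarrow> (complex \<Rightarrow> complex) set" where
  "Kinf B = {f \<in> Hinf. \<exists>g\<in>Hinf0. AE \<zeta> in arclength. \<exists>u b v.
     has_boundary_value f \<zeta> u \<and> has_boundary_value B \<zeta> b \<and> has_boundary_value g \<zeta> v \<and>
     u = b * cnj v}"

definition trace_on :: "(complex \<Rightarrow> complex) set \<Rightarrow> (nat \<Rightarrow> complex) \<Rightarrow> (nat \<Rightarrow> complex) set" where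
  "trace_on X a = {w. \<exists>f\<in>X. \<forall>j. f (a j) = w j}"

end

theory Submission
  imports Defs
begin

text \<open>
  Put \<open>\<gamma>\<^sub>j = w\<^sub>j / B'(a\<^sub>j)\<close>. If \<open>f = B cnj g\<close> on the circle with \<open>g = z h\<close>, the residue theorem
  for \<open>f / B\<close> (first for finite partial products) identifies the sum with index \<open>k\<close> as
  \<open>cnj (h a\<^sub>k)\<close>, so it is bounded when \<open>h\<close> is.

  Conversely let \<open>h = \<Sum> cnj \<gamma>\<^sub>j / (1 - cnj a\<^sub>j z)\<close>, \<open>v = z h\<close> and \<open>u = \<Sum> \<gamma>\<^sub>j / (z - a\<^sub>j)\<close>; then
  \<open>f = B u\<close> interpolates and
  \<open>u - cnj v = \<Sum> \<gamma>\<^sub>j (1 - |z|\<^sup>2) / ((z - a\<^sub>j) (1 - a\<^sub>j cnj z))\<close>.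
  Off small pseudohyperbolic discs around the zeros this is at most a multiple of \<open>log (1 / |B|)\<close>,
  which is bounded there and vanishes on the circle; this also gives \<open>f = B cnj v\<close> almost everywhere.
  On the boundaries of the discs \<open>h\<close> is bounded, being close to \<open>h a\<^sub>k\<close>.
  Hence \<open>p = u + v\<close> and \<open>p = \<i> (u - v)\<close> are bounded on the circles bounding the discs and real on
  the unit circle. Applying the maximum principle to the imaginary part of Gaussians of \<open>p\<close> shows
  that \<open>p\<close> is real wherever its real part is large, hence constant there, which is absurd. So \<open>u\<close> and
  \<open>v\<close> are bounded off the discs, and \<open>f\<close> and \<open>v\<close> everywhere.
\<close>

text \<open>Two obstacles shape the argument. The zeros may accumulate at every point of the circle,
  so neither \<open>log (1 / |B|)\<close> nor the tail of the product need reach its boundary value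
  uniformly. The maximum principle is therefore used on discs of radius \<open>R < 1\<close>, with a
  compensating power of the tail \<open>P {n..}\<close>, and in the residue computation the tail is
  controlled in L1 of the circle only. Moreover \<open>p\<close> is not known to be bounded in
  advance, and a bounded imaginary part does not bound the real part. A Gaussian of \<open>p\<close>
  is bounded as soon as \<open>Im p\<close> is, and its imaginary part is still dominated by a
  multiple of \<open>|Im p|\<close>; its centre and width are adapted to one point at which
  \<open>p\<close> is supposed to be large and not real. Membership in \<open>Kinf\<close> is
  phrased with radial limits, so Fatou's theorem is needed. It is derived from the primitive of the
  given function, which is Lipschitz up to the circle; this is the purpose of the opening
  section.\<close>

section \<open>Almost everywhere differentiability of Lipschitz functions\<close>

text \<open>An interval is the closed ball about its midpoint with half its length as radius, so the
  Vitali covering theorem for balls applies.\<close>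

lemma Vitali_covering_intervals:
  fixes S :: "real set" and P :: "real \<Rightarrow> real \<Rightarrow> bool"
  assumes "\<And>x d. x \<in> S \<Longrightarrow> 0 < d \<Longrightarrow> \<exists>u v. u < x \<and> x < v \<and> v - u < d \<and> P u v"
  obtains C :: "(real \<times> real) set" where "countable C"
    "\<And>u v. (u, v) \<in> C \<Longrightarrow> u < v \<and> P u v"
    "disjoint_family_on (\<lambda>c. {fst c..snd c}) C"
    "negligible (S - (\<Union>c\<in>C. {fst c..snd c}))"
proof -
  define K where "K = {c :: real \<times> real. fst c < snd c \<and> P (fst c) (snd c)}"
  define m r where "m = (\<lambda>c :: real \<times> real. (fst c + snd c) / 2)"
    and "r = (\<lambda>c :: real \<times> real. (snd c - fst c) / 2)"
  have cb: "cball (m c) (r c) = {fst c..snd c}" for c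
    by (auto simp: m_def r_def dist_real_def abs_le_iff field_simps)
  have "0 < r c" if "c \<in> K" for c
    using that by (auto simp: K_def r_def)
  moreover have "\<exists>c. c \<in> K \<and> x \<in> cball (m c) (r c) \<and> r c < d" if x: "x \<in> S" "0 < d" for x d
  proof -
    obtain u v where "u < x" "x < v" "v - u < d" "P u v" using assms[OF x] by blast
    then show ?thesis by (intro exI[of _ "(u, v)"]) (auto simp: cb, auto simp: K_def r_def)
  qed
  ultimately obtain C where C: "countable C" "C \<subseteq> K"
    "pairwise (\<lambda>i j. disjnt (cball (m i) (r i)) (cball (m j) (r j))) C"
    "negligible (S - (\<Union>i\<in>C. cball (m i) (r i)))"
    by (rule Vitali_covering_theorem_cballs[of K r S m])
  show thesis
    by (rule that[OF C(1)])
       (use C in \<open>auto simp: cb K_def disjoint_family_on_def pairwise_def disjnt_def\<close>)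
qed

text \<open>Every point at which the upper limit of the slopes over shrinking intervals around
  \<open>x\<close> exceeds \<open>q\<close> lies in this set. Keeping \<open>x\<close> strictly
  inside the intervals makes the set Borel for every \<open>\<phi>\<close>.\<close>

definition steep :: "(real \<Rightarrow> real) \<Rightarrow> real \<Rightarrow> real set" where
  "steep \<phi> q = {x. \<forall>d>0. \<exists>u v. u < x \<and> x < v \<and> v - u < d \<and> q * (v - u) < \<phi> v - \<phi> u}"

definition shallow :: "(real \<Rightarrow> real) \<Rightarrow> real \<Rightarrow> real set" where
  "shallow \<phi> p = {x. \<forall>d>0. \<exists>u v. u < x \<and> x < v \<and> v - u < d \<and> \<phi> v - \<phi> u < p * (v - u)}"

text \<open>At each scale \<open>1 / Suc n\<close> the admissible open intervals have an open union,
  whatever \<open>P\<close> is; the set is a countable intersection of these unions.\<close>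

lemma borel_small_intervals:
  fixes P :: "real \<Rightarrow> real \<Rightarrow> bool"
  shows "{x. \<forall>d>0. \<exists>u v. u < x \<and> x < v \<and> v - u < d \<and> P u v} \<in> sets borel"
proof -
  define U where "U n = (\<Union>c\<in>{c. snd c - fst c < 1 / real (Suc n) \<and> P (fst c) (snd c)}. {fst c<..<snd c})" for n
  have "{x. \<forall>d>0. \<exists>u v. u < x \<and> x < v \<and> v - u < d \<and> P u v} = (\<Inter>n. U n)" (is "?L = ?R")
  proof
    show "?L \<subseteq> ?R"
    proof
      fix x assume x: "x \<in> ?L"
      have "x \<in> U n" for n
      proof -
        obtain u v where "u < x" "x < v" "v - u < 1 / real (Suc n)" "P u v"
          using x by (auto dest!: spec[of _ "1 / real (Suc n)"])
        then show ?thesis unfolding U_def by (intro UN_I[of "(u, v)"]) auto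
      qed
      then show "x \<in> ?R" by blast
    qed
    show "?R \<subseteq> ?L"
    proof safe
      fix x d :: real assume x: "x \<in> ?R" and "d > 0"
      then obtain n where n: "1 / real (Suc n) < d" using nat_approx_posE by blast
      have "x \<in> U n" using x by blast
      then obtain c where "fst c < x" "x < snd c" "snd c - fst c < 1 / real (Suc n)" "P (fst c) (snd c)"
        unfolding U_def by auto
      then show "\<exists>u v. u < x \<and> x < v \<and> v - u < d \<and> P u v" using n by (meson less_trans)
    qed
  qed
  moreover have "open (U n)" for n
    unfolding U_def by (intro open_UN) auto
  ultimately show ?thesis by auto
qed

text \<open>Lebesgue measure is compared with the Stieltjes measure \<open>\<mu>\<close> of
  \<open>\<phi>\<close> through two nested Vitali coverings. Shallow intervals inside an open set
  barely larger than \<open>S\<close> have total \<open>\<mu>\<close> at most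
  \<open>p (|S| + e)\<close>; steep intervals chosen inside them still cover almost all of
  \<open>S\<close> and have total \<open>\<mu>\<close> at least \<open>q |S|\<close>. Since
  \<open>|S|\<close> is finite and \<open>p < q\<close>, it is 0.\<close>

lemma null_steep_shallow:
  fixes \<phi> :: "real \<Rightarrow> real"
  assumes mono: "mono \<phi>" and cont: "continuous_on UNIV \<phi>"
    and pq: "0 \<le> p" "p < q" and S: "S \<in> sets borel" "S \<subseteq> steep \<phi> q \<inter> shallow \<phi> p" "bounded S"
  shows "emeasure lborel S = 0"
proof -
  define \<mu> where "\<mu> = interval_measure \<phi>"
  have \<mu>: "emeasure \<mu> {u..v} = ennreal (\<phi> v - \<phi> u)" if "u \<le> v" for u v
    unfolding \<mu>_def using emeasure_interval_measure_Icc[OF that, of \<phi>] mono cont by (auto simp: mono_def)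
  have sets_\<mu>: "sets \<mu> = sets borel" by (simp add: \<mu>_def)
  have fin: "emeasure lborel S < \<infinity>" using S(3) emeasure_bounded_finite by blast
  have main: "ennreal q * emeasure lborel S \<le> ennreal p * (emeasure lborel S + ennreal e)" if "e > 0" for e
  proof -
    have "S \<in> sets lebesgue" using S(1) by (auto intro: sets_completionI_sets)
    then obtain G where G: "open G" "S \<subseteq> G" "G - S \<in> lmeasurable" "emeasure lebesgue (G - S) < ennreal e"
      using sets_lebesgue_outer_open \<open>e > 0\<close> by blast
    have "\<exists>u v. u < x \<and> x < v \<and> v - u < d \<and> ({u..v} \<subseteq> G \<and> \<phi> v - \<phi> u < p * (v - u))"
      if x: "x \<in> S" "0 < d" for x d
    proof -
      obtain r where r: "r > 0" "ball x r \<subseteq> G" using G x open_contains_ball by blast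
      obtain u v where uv: "u < x" "x < v" "v - u < min d r" "\<phi> v - \<phi> u < p * (v - u)"
      proof -
        have "x \<in> shallow \<phi> p" "min d r > 0" using x r S(2) by auto
        then show ?thesis using that unfolding shallow_def by blast
      qed
      moreover have "{u..v} \<subseteq> ball x r" using uv by (auto simp: dist_real_def)
      ultimately show ?thesis using r by force
    qed
    from Vitali_covering_intervals[of S "\<lambda>u v. {u..v} \<subseteq> G \<and> \<phi> v - \<phi> u < p * (v - u)", OF this]
    obtain C where C: "countable C" "\<And>u v. (u, v) \<in> C \<Longrightarrow> u < v \<and> {u..v} \<subseteq> G \<and> \<phi> v - \<phi> u < p * (v - u)"
      "disjoint_family_on (\<lambda>c. {fst c..snd c}) C" "negligible (S - (\<Union>c\<in>C. {fst c..snd c}))"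
      by blast
    \<comment> \<open>A point that is only an endpoint of intervals in \<open>C\<close> leaves no
      room for a steep interval inside them. There are countably many such points, and
      \<open>S'\<close> drops them.\<close>
    define S' where "S' = S \<inter> (\<Union>c\<in>C. {fst c<..<snd c})"
    have "\<exists>u v. u < x \<and> x < v \<and> v - u < d \<and>
        ((\<exists>c\<in>C. {u..v} \<subseteq> {fst c..snd c}) \<and> q * (v - u) < \<phi> v - \<phi> u)"
      if x: "x \<in> S'" "0 < d" for x d
    proof -
      obtain c where c: "c \<in> C" "fst c < x" "x < snd c" using x by (auto simp: S'_def)
      define r where "r = min d (min (x - fst c) (snd c - x))"
      have "r > 0" using c x by (auto simp: r_def)
      then obtain u v where uv: "u < x" "x < v" "v - u < r" "q * (v - u) < \<phi> v - \<phi> u"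
        using x S(2) unfolding steep_def S'_def by blast
      moreover have "{u..v} \<subseteq> {fst c..snd c}" using uv by (auto simp: r_def)
      ultimately show ?thesis using c by (force simp: r_def)
    qed
    from Vitali_covering_intervals[of S' "\<lambda>u v. (\<exists>c\<in>C. {u..v} \<subseteq> {fst c..snd c}) \<and> q * (v - u) < \<phi> v - \<phi> u", OF this]
    obtain D where D: "countable D"
      "\<And>u v. (u, v) \<in> D \<Longrightarrow> u < v \<and> (\<exists>c\<in>C. {u..v} \<subseteq> {fst c..snd c}) \<and> q * (v - u) < \<phi> v - \<phi> u"
      "disjoint_family_on (\<lambda>c. {fst c..snd c}) D" "negligible (S' - (\<Union>c\<in>D. {fst c..snd c}))"
      by blast
    let ?I = "\<Union>c\<in>C. {fst c..snd c}" and ?J = "\<Union>c\<in>D. {fst c..snd c}"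
    have "negligible (fst ` C \<union> snd ` C)"
      using C(1) by (simp add: negligible_iff_null_sets countable_imp_null_set_lborel null_sets_completionI)
    moreover have "S - ?J \<subseteq> (S - ?I) \<union> (S' - ?J) \<union> (fst ` C \<union> snd ` C)"
    proof
      fix x assume x: "x \<in> S - ?J"
      show "x \<in> (S - ?I) \<union> (S' - ?J) \<union> (fst ` C \<union> snd ` C)"
      proof (rule ccontr)
        assume "\<not> ?thesis"
        then have n: "x \<in> ?I" "x \<notin> S'" "x \<notin> fst ` C" "x \<notin> snd ` C" using x by auto
        then obtain c where c: "c \<in> C" "fst c \<le> x" "x \<le> snd c" by auto
        then have "fst c \<noteq> x" "x \<noteq> snd c" using n by auto
        then have "x \<in> S'" using c x by (force simp: S'_def)
        then show False using n by simp
      qed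
    qed
    ultimately have neg: "negligible (S - ?J)"
      using C(4) D(4) by (meson negligible_Un negligible_subset)
    have [measurable]: "?I \<in> sets borel" "?J \<in> sets borel"
      using C(1) D(1) by auto
    have "S - ?J \<in> null_sets lborel"
      using neg S(1) by (simp add: negligible_iff_null_sets null_sets_def)
    then have "emeasure lborel S \<le> emeasure lborel ?J"
      using S(1) \<open>?J \<in> sets borel\<close> by (intro emeasure_mono_AE) (auto dest!: AE_not_in)
    then have "ennreal q * emeasure lborel S \<le> ennreal q * emeasure lborel ?J"
      by (intro mult_left_mono) auto
    also have "emeasure lborel ?J = (\<integral>\<^sup>+c. emeasure lborel {fst c..snd c} \<partial>count_space D)"
      using D by (intro emeasure_UN_countable) auto
    also have "ennreal q * \<dots> = (\<integral>\<^sup>+c. ennreal q * emeasure lborel {fst c..snd c} \<partial>count_space D)"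
      by (subst nn_integral_cmult) auto
    also have "\<dots> \<le> (\<integral>\<^sup>+c. emeasure \<mu> {fst c..snd c} \<partial>count_space D)"
    proof (intro nn_integral_mono)
      fix c assume "c \<in> space (count_space D)"
      then have "fst c < snd c" "q * (snd c - fst c) < \<phi> (snd c) - \<phi> (fst c)"
        using D(2)[of "fst c" "snd c"] by auto
      then show "ennreal q * emeasure lborel {fst c..snd c} \<le> emeasure \<mu> {fst c..snd c}"
        using pq by (simp add: \<mu> ennreal_mult[symmetric] ennreal_leI)
    qed
    also have "\<dots> = emeasure \<mu> ?J"
      using D by (intro emeasure_UN_countable[symmetric]) (auto simp: sets_\<mu>)
    also have "\<dots> \<le> emeasure \<mu> ?I"
    proof (intro emeasure_mono)
      show "?J \<subseteq> ?I" using D(2) by fastforce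
    qed (use \<open>?I \<in> sets borel\<close> in \<open>simp add: sets_\<mu>\<close>)
    also have "\<dots> = (\<integral>\<^sup>+c. emeasure \<mu> {fst c..snd c} \<partial>count_space C)"
      using C by (intro emeasure_UN_countable) (auto simp: sets_\<mu>)
    also have "\<dots> \<le> (\<integral>\<^sup>+c. ennreal p * emeasure lborel {fst c..snd c} \<partial>count_space C)"
    proof (intro nn_integral_mono)
      fix c assume "c \<in> space (count_space C)"
      then have "fst c < snd c" "\<phi> (snd c) - \<phi> (fst c) < p * (snd c - fst c)"
        using C(2)[of "fst c" "snd c"] by auto
      then show "emeasure \<mu> {fst c..snd c} \<le> ennreal p * emeasure lborel {fst c..snd c}"
        using pq by (simp add: \<mu> ennreal_mult[symmetric] ennreal_leI)
    qed
    also have "\<dots> = ennreal p * (\<integral>\<^sup>+c. emeasure lborel {fst c..snd c} \<partial>count_space C)"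
      by (subst nn_integral_cmult) auto
    also have "(\<integral>\<^sup>+c. emeasure lborel {fst c..snd c} \<partial>count_space C) = emeasure lborel ?I"
      using C by (intro emeasure_UN_countable[symmetric]) auto
    also have "emeasure lborel ?I \<le> emeasure lborel G"
    proof (intro emeasure_mono)
      show "?I \<subseteq> G" using C(2) by fastforce
    qed (use G in auto)
    also have "G = S \<union> (G - S)" using G by auto
    also have "emeasure lborel \<dots> \<le> emeasure lborel S + emeasure lborel (G - S)"
      using S(1) G by (intro emeasure_subadditive) auto
    also have "emeasure lborel (G - S) \<le> ennreal e"
      using G S(1) by (auto intro: less_imp_le)
    finally show ?thesis by (simp add: mult_left_mono add_left_mono)
  qed
  obtain s where s: "s \<ge> 0" "emeasure lborel S = ennreal s"
    using fin by (cases "emeasure lborel S") auto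
  have "q * s \<le> p * (s + e)" if "e > 0" for e
  proof -
    have "ennreal (q * s) \<le> ennreal (p * (s + e))"
      using main[OF that] s pq that by (simp add: ennreal_mult' ennreal_plus[symmetric] del: ennreal_plus)
    then show ?thesis using s pq that by (simp add: ennreal_le_iff)
  qed
  then have "q * s \<le> p * s + e" if "e > 0" for e
  proof -
    \<comment> \<open>Dividing by \<open>p + 1\<close> instead of \<open>p\<close> covers the case
      \<open>p = 0\<close>.\<close>
    have "e / (p + 1) > 0" using that pq by simp
    from \<open>\<And>e. e > 0 \<Longrightarrow> q * s \<le> p * (s + e)\<close>[OF this] have "q * s \<le> p * s + p * (e / (p + 1))"
      by (simp add: algebra_simps)
    also have "p * (e / (p + 1)) \<le> e" using pq that by (simp add: field_simps)
    finally show ?thesis by simp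
  qed
  then have "q * s \<le> p * s" by (rule field_le_epsilon)
  then have "s = 0" using s pq by (smt (verit) mult_less_cancel_right)
  then show ?thesis using s by simp
qed

text \<open>The derivative is the infimum \<open>D\<close> of the slopes \<open>q\<close> for which
  \<open>x\<close> is not steep. For nonnegative rationals \<open>p < q < D\<close> the point is
  steep for \<open>q\<close>, hence by assumption not shallow for \<open>p\<close>, and this bounds
  the slopes over small intervals from below by numbers as close to \<open>D\<close> as
  desired.\<close>

lemma has_real_derivative_if_not_steep_shallow:
  fixes \<phi> :: "real \<Rightarrow> real"
  assumes mono: "mono \<phi>" and lip: "\<And>x y. \<bar>\<phi> x - \<phi> y\<bar> \<le> L * \<bar>x - y\<bar>"
    and x: "\<And>p q :: rat. 0 \<le> p \<Longrightarrow> p < q \<Longrightarrow> x \<notin> steep \<phi> (of_rat q) \<inter> shallow \<phi> (of_rat p)"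
  shows "\<exists>D. (\<phi> has_real_derivative D) (at x)"
proof -
  define A where "A = {q. 0 \<le> q \<and> x \<notin> steep \<phi> q}"
  have "0 \<le> L * \<bar>1 - 0\<bar>" using lip[of 1 0] by (smt (verit))
  then have "0 \<le> L" by simp
  have "L \<in> A"
    unfolding A_def steep_def using lip \<open>0 \<le> L\<close> by (auto intro!: exI[of _ 1]) (smt (verit))
  have bdd: "bdd_below A" by (auto simp: A_def bdd_below_def)
  define D where "D = Inf A"
  have "D \<ge> 0" unfolding D_def using \<open>L \<in> A\<close> by (intro cInf_greatest) (auto simp: A_def)
  have upper: "\<exists>d>0. \<forall>u v. u < x \<and> x < v \<and> v - u < d \<longrightarrow> \<phi> v - \<phi> u \<le> (D + e) * (v - u)" if "e > 0" for e
  proof -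
    obtain q where q: "q \<in> A" "q < D + e"
    proof -
      have "A \<noteq> {}" using \<open>L \<in> A\<close> by blast
      then show ?thesis using cInf_lessD[of A "D + e"] \<open>e > 0\<close> that by (auto simp: D_def)
    qed
    then obtain d where d: "d > 0" "\<And>u v. u < x \<and> x < v \<and> v - u < d \<Longrightarrow> \<phi> v - \<phi> u \<le> q * (v - u)"
      unfolding A_def steep_def mem_Collect_eq by (metis not_less)
    have "\<phi> v - \<phi> u \<le> (D + e) * (v - u)" if "u < x \<and> x < v \<and> v - u < d" for u v
    proof -
      have "q * (v - u) \<le> (D + e) * (v - u)" using q that by (intro mult_right_mono) auto
      then show ?thesis using d(2)[OF that] by linarith
    qed
    then show ?thesis using d(1) by blast
  qed
  have lower: "\<exists>d>0. \<forall>u v. u < x \<and> x < v \<and> v - u < d \<longrightarrow> (D - e) * (v - u) \<le> \<phi> v - \<phi> u" if "e > 0" for e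
  proof (cases "D - e < 0")
    case True
    have "(D - e) * (v - u) \<le> \<phi> v - \<phi> u" if "u < x \<and> x < v" for u v
    proof -
      have "(D - e) * (v - u) \<le> 0" using True that by (simp add: mult_nonpos_nonneg)
      moreover have "\<phi> u \<le> \<phi> v" using mono that by (auto simp: mono_def)
      ultimately show ?thesis by linarith
    qed
    then show ?thesis by (intro exI[of _ 1]) auto
  next
    case False
    obtain p :: rat where p: "D - e < of_rat p" "of_rat p < D" using of_rat_dense[of "D - e" D] \<open>e > 0\<close> by auto
    obtain q :: rat where q: "of_rat p < (of_rat q :: real)" "of_rat q < D" using of_rat_dense[of "of_rat p" D] p by auto
    have pos: "0 \<le> p" "p < q"
      using p q False by (auto simp: of_rat_less) (smt (verit) of_rat_0 of_rat_less_eq zero_le_of_rat_iff)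
    have "x \<in> steep \<phi> (of_rat q)"
    proof (rule ccontr)
      assume "x \<notin> steep \<phi> (of_rat q)"
      then have "of_rat q \<in> A" using pos by (auto simp: A_def)
      then have "D \<le> of_rat q" unfolding D_def using bdd by (intro cInf_lower)
      then show False using q by simp
    qed
    then have "x \<notin> shallow \<phi> (of_rat p)" using x[OF pos] by blast
    then obtain d where d: "d > 0" "\<And>u v. u < x \<and> x < v \<and> v - u < d \<Longrightarrow> of_rat p * (v - u) \<le> \<phi> v - \<phi> u"
      unfolding shallow_def mem_Collect_eq by (metis not_less)
    have "(D - e) * (v - u) \<le> \<phi> v - \<phi> u" if "u < x \<and> x < v \<and> v - u < d" for u v
    proof -
      have "(D - e) * (v - u) \<le> of_rat p * (v - u)" using p that by (intro mult_right_mono) auto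
      then show ?thesis using d(2)[OF that] by linarith
    qed
    then show ?thesis using d(1) by blast
  qed
  have cont: "isCont \<phi> y" for y
  proof -
    have "L-lipschitz_on UNIV \<phi>"
      using lip \<open>0 \<le> L\<close> by (intro lipschitz_onI) (auto simp: dist_real_def)
    then show ?thesis
      using lipschitz_on_continuous_on continuous_on_eq_continuous_at open_UNIV by blast
  qed
  have two_sided: "\<exists>d>0. \<forall>y. \<bar>y - x\<bar> < d \<longrightarrow> \<bar>\<phi> y - \<phi> x - D * (y - x)\<bar> \<le> e * \<bar>y - x\<bar>" if e: "e > 0" for e
  proof -
    obtain d1 d2 where "d1 > 0" "d2 > 0"
      and d1: "\<And>u v. u < x \<and> x < v \<and> v - u < d1 \<Longrightarrow> \<phi> v - \<phi> u \<le> (D + e) * (v - u)"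
      and d2: "\<And>u v. u < x \<and> x < v \<and> v - u < d2 \<Longrightarrow> (D - e) * (v - u) \<le> \<phi> v - \<phi> u"
      using upper[OF e] lower[OF e] by blast
    define d where "d = min d1 d2 / 2"
    have d: "d > 0" "2 * d \<le> d1" "2 * d \<le> d2" using \<open>d1 > 0\<close> \<open>d2 > 0\<close> by (auto simp: d_def)
    have I: "\<bar>\<phi> v - \<phi> u - D * (v - u)\<bar> \<le> e * (v - u)" if "u < x" "x < v" "v - u < 2 * d" for u v
      using d1[of u v] d2[of u v] that d by (auto simp: abs_le_iff algebra_simps)
    have "\<bar>\<phi> y - \<phi> x - D * (y - x)\<bar> \<le> e * \<bar>y - x\<bar>" if y: "\<bar>y - x\<bar> < d" for y
    proof (rule linorder_cases[of x y])
      assume "x < y"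
      \<comment> \<open>The bounds so far concern intervals with \<open>x\<close> inside; by
        continuity the free endpoint can tend to \<open>x\<close>, which yields the one-sided
        difference quotient.\<close>
      have "eventually (\<lambda>u. \<bar>\<phi> y - \<phi> u - D * (y - u)\<bar> \<le> e * (y - u)) (at_left x)"
        unfolding eventually_at_left_field
        by (intro exI[of _ "x - d"]) (use d y \<open>x < y\<close> in \<open>auto intro!: I\<close>)
      then have "\<bar>\<phi> y - \<phi> x - D * (y - x)\<bar> \<le> e * (y - x)"
        by (intro tendsto_le[OF trivial_limit_at_left_real _ _ \<open>eventually _ (at_left x)\<close>] tendsto_intros
            tendsto_within_subset[OF cont[unfolded isCont_def]]) auto
      then show ?thesis using \<open>x < y\<close> by simp
    next
      assume "y < x"
      have "eventually (\<lambda>v. \<bar>\<phi> v - \<phi> y - D * (v - y)\<bar> \<le> e * (v - y)) (at_right x)"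
        unfolding eventually_at_right_field
        by (intro exI[of _ "x + d"]) (use d y \<open>y < x\<close> in \<open>auto intro!: I\<close>)
      then have "\<bar>\<phi> x - \<phi> y - D * (x - y)\<bar> \<le> e * (x - y)"
        by (intro tendsto_le[OF trivial_limit_at_right_real _ _ \<open>eventually _ (at_right x)\<close>] tendsto_intros
            tendsto_within_subset[OF cont[unfolded isCont_def]]) auto
      then show ?thesis using \<open>y < x\<close> by (simp add: abs_le_iff algebra_simps)
    qed auto
    then show ?thesis using d(1) by blast
  qed
  have "(\<phi> has_derivative (\<lambda>h. D * h)) (at x)"
    unfolding has_derivative_at_alt
    by (intro conjI bounded_linear_mult_right) (use two_sided in auto)
  then show ?thesis by (auto simp: has_field_derivative_def)
qed

text \<open>Adding \<open>L * x\<close> makes the function monotone and does not change where it is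
  differentiable. Cutting to \<open>{- real n..real n}\<close> supplies the bounded sets required by
  \<open>null_steep_shallow\<close>.\<close>

lemma AE_lipschitz_differentiable_real:
  fixes \<psi> :: "real \<Rightarrow> real"
  assumes lip: "\<And>x y. \<bar>\<psi> x - \<psi> y\<bar> \<le> L * \<bar>x - y\<bar>"
  shows "AE x in lborel. \<exists>D. (\<psi> has_real_derivative D) (at x)"
proof -
  define \<phi> where "\<phi> x = \<psi> x + L * x" for x
  have "0 \<le> L * \<bar>1 - 0\<bar>" using lip[of 1 0] by (smt (verit))
  then have "0 \<le> L" by simp
  have mono: "mono \<phi>"
  proof (rule monoI)
    fix x y :: real assume "x \<le> y"
    then show "\<phi> x \<le> \<phi> y" using lip[of x y] by (simp add: \<phi>_def abs_le_iff algebra_simps)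
  qed
  have lip2: "\<bar>\<phi> x - \<phi> y\<bar> \<le> (2 * L) * \<bar>x - y\<bar>" for x y
  proof -
    have "\<bar>\<phi> x - \<phi> y\<bar> \<le> \<bar>\<psi> x - \<psi> y\<bar> + \<bar>L * (x - y)\<bar>" by (simp add: \<phi>_def algebra_simps)
    also have "\<bar>L * (x - y)\<bar> = L * \<bar>x - y\<bar>" using \<open>0 \<le> L\<close> by (simp add: abs_mult)
    finally show ?thesis using lip[of x y] by linarith
  qed
  have "(2 * L)-lipschitz_on UNIV \<phi>"
    using lip2 \<open>0 \<le> L\<close> by (intro lipschitz_onI) (auto simp: dist_real_def)
  then have cont: "continuous_on UNIV \<phi>" by (rule lipschitz_on_continuous_on)
  define N where "N p q n = steep \<phi> (of_rat q) \<inter> shallow \<phi> (of_rat p) \<inter> {- real n..real n}" for p q n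
  have "N p q n \<in> null_sets lborel" if "0 \<le> p" "p < q" for p q n
  proof -
    have "N p q n \<in> sets borel"
      unfolding N_def steep_def shallow_def by (intro sets.Int borel_small_intervals) auto
    moreover have "emeasure lborel (N p q n) = 0"
      by (rule null_steep_shallow[OF mono cont, of "of_rat p" "of_rat q"])
         (use that calculation in \<open>auto simp: N_def of_rat_less intro: bounded_subset[OF bounded_closed_interval]\<close>)
    ultimately show ?thesis by (auto simp: null_sets_def)
  qed
  then have "AE x in lborel. 0 \<le> p \<longrightarrow> p < q \<longrightarrow> x \<notin> N p q n" for p q n
    by (cases "0 \<le> p \<and> p < q") (auto intro: AE_not_in)
  then have "AE x in lborel. \<forall>p q n. 0 \<le> p \<longrightarrow> p < q \<longrightarrow> x \<notin> N p q n"
    by (simp add: AE_all_countable)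
  then show ?thesis
  proof (rule AE_mp, intro AE_I2 impI)
    fix x assume *: "\<forall>p q n. 0 \<le> p \<longrightarrow> p < q \<longrightarrow> x \<notin> N p q n"
    obtain n where "\<bar>x\<bar> \<le> real n" using real_arch_simple by blast
    then have "x \<notin> steep \<phi> (of_rat q) \<inter> shallow \<phi> (of_rat p)" if "0 \<le> p" "p < q" for p q
      using * that by (auto simp: N_def abs_le_iff)
    then obtain D where "(\<phi> has_real_derivative D) (at x)"
      using has_real_derivative_if_not_steep_shallow[OF mono lip2] by blast
    then have "((\<lambda>x. \<phi> x - L * x) has_real_derivative D - L) (at x)"
      by (auto intro!: derivative_eq_intros)
    then show "\<exists>D. (\<psi> has_real_derivative D) (at x)" by (auto simp: \<phi>_def)
  qed
qed

lemma AE_lipschitz_differentiable: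
  fixes \<psi> :: "real \<Rightarrow> complex"
  assumes lip: "\<And>x y. cmod (\<psi> x - \<psi> y) \<le> L * \<bar>x - y\<bar>"
  shows "AE x in lborel. \<exists>D. (\<psi> has_vector_derivative D) (at x)"
proof -
  have "AE x in lborel. \<exists>D. ((\<lambda>x. Re (\<psi> x)) has_real_derivative D) (at x)"
    by (intro AE_lipschitz_differentiable_real[of _ L])
       (metis abs_Re_le_cmod lip minus_complex.sel(1) order_trans)
  moreover have "AE x in lborel. \<exists>D. ((\<lambda>x. Im (\<psi> x)) has_real_derivative D) (at x)"
    by (intro AE_lipschitz_differentiable_real[of _ L])
       (metis abs_Im_le_cmod lip minus_complex.sel(2) order_trans)
  ultimately show ?thesis
  proof (rule AE_mp[OF AE_conjI], intro AE_I2 impI, safe)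
    fix x D E
    assume "((\<lambda>x. Re (\<psi> x)) has_real_derivative D) (at x)" "((\<lambda>x. Im (\<psi> x)) has_real_derivative E) (at x)"
    then have "((\<lambda>x. of_real (Re (\<psi> x)) + \<i> * of_real (Im (\<psi> x))) has_vector_derivative (of_real D + \<i> * of_real E)) (at x)"
      by (intro derivative_intros) (simp_all add: has_vector_derivative_of_real has_real_derivative_iff_has_vector_derivative)
    then show "\<exists>D. (\<psi> has_vector_derivative D) (at x)" by (auto simp: complex_eq[symmetric])
  qed
qed

section \<open>Fatou's theorem\<close>

definition angle :: "real measure" where
  "angle = uniform_measure lborel {0..2 * pi}"

lemma arclength_eq: "arclength = distr angle borel cis"
  by (simp add: arclength_def angle_def)

lemma emeasure_angle_UNIV: "emeasure angle UNIV = 1"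
  unfolding angle_def by (subst emeasure_uniform_measure) auto

lemma sets_angle [simp, measurable_cong]: "sets angle = sets borel"
  by (simp add: angle_def)

lemma space_angle [simp]: "space angle = UNIV"
  by (simp add: angle_def)

lemma finite_measure_angle: "finite_measure angle"
  by (intro finite_measureI) (simp add: emeasure_angle_UNIV)

lemma measure_angle_UNIV [simp]: "measure angle UNIV = 1"
  by (simp add: measure_def emeasure_angle_UNIV)

lemma measurable_cis [measurable]: "cis \<in> borel_measurable borel"
  by (intro borel_measurable_continuous_onI continuous_intros)

lemma measurable_circle:
  fixes g :: "complex \<Rightarrow> 'a :: real_normed_vector"
  assumes "continuous_on (sphere 0 1) g"
  shows "(\<lambda>t. g (cis t)) \<in> borel_measurable borel"
  by (intro borel_measurable_continuous_onI continuous_on_compose2[OF assms] continuous_intros) auto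

lemma integrable_circle:
  fixes g :: "complex \<Rightarrow> 'a :: {banach, second_countable_topology}"
  assumes "continuous_on (sphere 0 1) g"
  shows "integrable angle (\<lambda>t. g (cis t))"
proof -
  have "compact (g ` sphere 0 1)" using assms by (intro compact_continuous_image) auto
  then obtain K where K: "\<And>\<zeta>. \<zeta> \<in> sphere 0 1 \<Longrightarrow> norm (g \<zeta>) \<le> K"
    using compact_imp_bounded by (force simp: bounded_iff)
  interpret finite_measure angle by (rule finite_measure_angle)
  show ?thesis
    using measurable_circle[OF assms] K by (intro integrable_const_bound[of _ K]) (auto simp: angle_def)
qed

lemma integral_angle_eq:
  fixes g :: "real \<Rightarrow> complex"
  assumes cont: "continuous_on {0..2 * pi} g" and [measurable]: "g \<in> borel_measurable borel"
    and I: "(g has_integral I) {0..2 * pi}"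
  shows "integral\<^sup>L angle g = I / (2 * pi)"
proof -
  have "integral\<^sup>L angle g = (\<integral>t. (indicator {0..2 * pi} t / (2 * pi)) *\<^sub>R g t \<partial>lborel)"
  proof -
    have eq: "angle = density lborel (\<lambda>t. ennreal (indicator {0..2 * pi} t / (2 * pi)))"
      unfolding angle_def uniform_measure_def
      using divide_ennreal[of 1 "2 * pi"] by (intro density_cong) (auto simp: indicator_def)
    show ?thesis by (subst eq, subst integral_density) auto
  qed
  also have "\<dots> = (1 / (2 * pi)) *\<^sub>R (LINT t:{0..2 * pi}|lborel. g t)"
    unfolding set_lebesgue_integral_def
    by (subst integral_scaleR_right[symmetric], intro Bochner_Integration.integral_cong) auto
  also have "(LINT t:{0..2 * pi}|lborel. g t) = integral {0..2 * pi} g"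
    by (intro set_borel_integral_eq_integral borel_integrable_atLeastAtMost' cont)
  also have "\<dots> = I" using I by (rule integral_unique)
  finally show ?thesis by (simp add: scaleR_conv_of_real)
qed

text \<open>With \<open>dz = \<i> * cis t dt\<close> the factor \<open>1 / (2 * pi * \<i>)\<close>
  becomes the average over \<open>t\<close>, at the cost of a factor \<open>cis t\<close> in the
  integrand.\<close>

lemma Cauchy_integral_angle:
  assumes F: "continuous_on (cball 0 1) F" "F holomorphic_on ball 0 1" and w: "cmod w < 1"
  shows "(\<integral>t. F (cis t) * cis t / (cis t - w) \<partial>angle) = F w"
proof -
  have "((\<lambda>u. F u / (u - w)) has_contour_integral (2 * of_real pi * \<i> * F w)) (part_circlepath 0 1 0 (2 * pi))"
    using Cauchy_integral_circlepath[OF F] w by (simp add: circlepath_def)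
  then have "((\<lambda>t. F (cis t) / (cis t - w) * \<i> * cis t) has_integral (2 * of_real pi * \<i> * F w)) {0..2 * pi}"
    by (subst (asm) has_contour_integral_part_circlepath_iff) auto
  from has_integral_mult_right[OF this, of "- \<i>"]
  have "((\<lambda>t. F (cis t) * cis t / (cis t - w)) has_integral (2 * of_real pi * F w)) {0..2 * pi}"
    by (simp add: mult_ac)
  moreover have c: "continuous_on (sphere 0 1) (\<lambda>\<zeta>. F \<zeta> * \<zeta> / (\<zeta> - w))"
    using w by (intro continuous_intros continuous_on_subset[OF F(1)]) auto
  ultimately show ?thesis
    using w by (subst integral_angle_eq)
      (auto intro!: measurable_circle[OF c] continuous_on_compose2[OF c] continuous_intros)
qed

lemma Cauchy_deriv_integral_angle:
  assumes F: "continuous_on (cball 0 1) F" "F holomorphic_on ball 0 1" and w: "cmod w < 1"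
  shows "(\<integral>t. F (cis t) * cis t / (cis t - w)\<^sup>2 \<partial>angle) = deriv F w"
proof -
  have "w \<in> ball 0 1" using w by simp
  from Cauchy_derivative_integral_circlepath[OF F this]
  have I: "(\<lambda>u. F u / (u - w)\<^sup>2) contour_integrable_on circlepath 0 1"
    and D: "deriv F w = 1 / (2 * of_real pi * \<i>) * contour_integral (circlepath 0 1) (\<lambda>u. F u / (u - w)\<^sup>2)"
    by (auto dest!: DERIV_imp_deriv)
  then have "((\<lambda>u. F u / (u - w)\<^sup>2) has_contour_integral (2 * of_real pi * \<i> * deriv F w)) (part_circlepath 0 1 0 (2 * pi))"
    using has_contour_integral_integral[OF I] by (simp add: circlepath_def)
  then have "((\<lambda>t. F (cis t) / (cis t - w)\<^sup>2 * \<i> * cis t) has_integral (2 * of_real pi * \<i> * deriv F w)) {0..2 * pi}"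
    by (subst (asm) has_contour_integral_part_circlepath_iff) auto
  from has_integral_mult_right[OF this, of "- \<i>"]
  have "((\<lambda>t. F (cis t) * cis t / (cis t - w)\<^sup>2) has_integral (2 * of_real pi * deriv F w)) {0..2 * pi}"
    by (simp add: mult_ac)
  moreover have c: "continuous_on (sphere 0 1) (\<lambda>\<zeta>. F \<zeta> * \<zeta> / (\<zeta> - w)\<^sup>2)"
    using w by (intro continuous_intros continuous_on_subset[OF F(1)]) auto
  ultimately show ?thesis
    using w by (subst integral_angle_eq)
      (auto intro!: measurable_circle[OF c] continuous_on_compose2[OF c] continuous_intros)
qed

section \<open>Radial limits of the derivative at a point of tangential differentiability\<close>

lemma cmod_one_minus_mult_sphere:
  assumes "cmod \<zeta> = 1"
  shows "cmod (1 - cnj w * \<zeta>) = cmod (\<zeta> - w)"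
proof -
  have "\<zeta> * cnj \<zeta> = 1" using assms complex_norm_square[of \<zeta>] by simp
  then have "1 - cnj w * \<zeta> = \<zeta> * cnj (\<zeta> - w)" by (simp add: algebra_simps)
  then show ?thesis using assms by (simp add: norm_mult del: complex_cnj_diff)
qed

text \<open>This is Cauchy's formula at \<open>r\<close> for the function
  \<open>(1 - r\<^sup>2) / (1 - r * z)\<close>, whose value there is 1. On the circle its integrand
  is the Poisson kernel because \<open>1 - r * cis t = cis t * cnj (cis t - r)\<close>.\<close>

lemma Poisson_integral_one:
  assumes "0 \<le> r" "r < 1"
  shows "(\<integral>t. (1 - r\<^sup>2) / (cmod (cis t - of_real r))\<^sup>2 \<partial>angle) = 1"
proof -
  have ne: "1 - of_real r * z \<noteq> 0" if "cmod z \<le> 1" for z :: complex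
  proof -
    have "cmod (of_real r * z) < 1" using assms that using mult_left_le[of "cmod z" r] by (simp add: norm_mult)
    then show ?thesis by auto
  qed
  let ?F = "\<lambda>z :: complex. (1 - (of_real r)\<^sup>2) / (1 - of_real r * z)"
  have "(\<integral>t. ?F (cis t) * cis t / (cis t - of_real r) \<partial>angle) = ?F (of_real r)"
    using assms ne by (intro Cauchy_integral_angle continuous_intros holomorphic_intros) auto
  also have "?F (of_real r) = 1" using ne[of "of_real r"] assms by (simp add: power2_eq_square)
  finally have one: "(\<integral>t. ?F (cis t) * cis t / (cis t - of_real r) \<partial>angle) = 1" .
  have "?F (cis t) * cis t / (cis t - of_real r) = of_real ((1 - r\<^sup>2) / (cmod (cis t - of_real r))\<^sup>2)" for t
  proof -
    have "cis t * cnj (cis t) = 1" using complex_norm_square[of "cis t"] by simp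
    then have "1 - of_real r * cis t = cis t * cnj (cis t - of_real r)" by (simp add: algebra_simps)
    then have "?F (cis t) * cis t / (cis t - of_real r) =
        (1 - (of_real r)\<^sup>2) * cis t / (cis t * (cnj (cis t - of_real r) * (cis t - of_real r)))"
      by (simp add: mult_ac)
    also have "\<dots> = (1 - (of_real r)\<^sup>2) / (cnj (cis t - of_real r) * (cis t - of_real r))"
      by simp
    also have "cnj (cis t - of_real r) * (cis t - of_real r) = (of_real (cmod (cis t - of_real r)))\<^sup>2"
      by (simp only: of_real_power[symmetric] complex_norm_square mult.commute)
    finally show ?thesis by simp
  qed
  then have "(\<integral>t. complex_of_real ((1 - r\<^sup>2) / (cmod (cis t - of_real r))\<^sup>2) \<partial>angle) = 1"
    using one by simp
  then show ?thesis unfolding integral_complex_of_real using of_real_eq_1_iff by blast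
qed

text \<open>The mean of \<open>F z * z / (1 - c * z)\<^sup>2\<close> vanishes, so it may be
  subtracted from Cauchy's formula for the derivative. The difference of the two kernels has the
  factor \<open>(1 - r\<^sup>2) * (1 - z\<^sup>2)\<close> over a fourth power of
  \<open>|z - c|\<close>. Near 1 the factor \<open>|1 - z|\<close> and the bound on \<open>F\<close>
  cancel two of these powers, leaving \<open>8 * e\<close> times the Poisson kernel; away from 1 the
  factor \<open>1 - r\<^sup>2\<close> is the whole gain.\<close>

lemma radial_derivative_small:
  assumes F: "continuous_on (cball 0 1) F" "F holomorphic_on ball 0 1"
    and K: "\<And>z. cmod z = 1 \<Longrightarrow> cmod (F z) \<le> K"
    and e: "0 \<le> e" "0 < d" "\<And>z. cmod z = 1 \<Longrightarrow> cmod (z - 1) < d \<Longrightarrow> cmod (F z) \<le> e * cmod (z - 1)"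
    and r: "0 \<le> r" "r < 1" "1 - r \<le> d / 2"
  shows "cmod (deriv F (of_real r)) \<le> 8 * e + 64 * K * (1 - r\<^sup>2) / d ^ 4"
proof -
  define c :: complex where "c = of_real r"
  have c: "cmod c < 1" "cnj c = c" using r by (auto simp: c_def)
  have ne: "1 - c * z \<noteq> 0" if "cmod z \<le> 1" for z :: complex
  proof -
    have "cmod (c * z) < 1" using r that using mult_left_le[of "cmod z" r] by (simp add: c_def norm_mult)
    then show ?thesis by auto
  qed
  have "K \<ge> 0" using order_trans[OF norm_ge_zero K[of 1]] by simp
  have r2: "1 - r\<^sup>2 \<ge> 0" using r by (simp add: power_le_one)
  define k where "k z = F z * z / (z - c)\<^sup>2 - F z * z / (1 - c * z)\<^sup>2" for z
  have cont: "continuous_on (sphere 0 1) (\<lambda>z. F z * z / (z - c)\<^sup>2)" "continuous_on (sphere 0 1) (\<lambda>z. F z * z / (1 - c * z)\<^sup>2)"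
    using c ne by (intro continuous_intros continuous_on_subset[OF F(1)]; auto)+
  have "(\<integral>t. (cis t * F (cis t) / (1 - c * cis t)\<^sup>2) * cis t / (cis t - 0) \<partial>angle) = 0 * F 0 / (1 - c * 0)\<^sup>2"
    using ne by (intro Cauchy_integral_angle[where F="\<lambda>z. z * F z / (1 - c * z)\<^sup>2"] continuous_intros holomorphic_intros F) auto
  then have "(\<integral>t. F (cis t) * cis t / (1 - c * cis t)\<^sup>2 \<partial>angle) = 0"
    by (simp add: mult_ac)
  then have eq: "deriv F c = (\<integral>t. k (cis t) \<partial>angle)"
    unfolding k_def using Cauchy_deriv_integral_angle[OF F c(1)] integrable_circle[OF cont(1)] integrable_circle[OF cont(2)]
    by (subst Bochner_Integration.integral_diff) auto
  have bound: "cmod (k z) \<le> 8 * e * ((1 - r\<^sup>2) / (cmod (z - c))\<^sup>2) + 64 * K * (1 - r\<^sup>2) / d ^ 4" if z: "cmod z = 1" for z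
  proof -
    define D where "D = cmod (z - c)"
    have "1 - r \<le> D" using norm_triangle_ineq2[of z c] z r by (simp add: D_def c_def)
    then have "D > 0" using r by simp
    have z1: "cmod (z - 1) \<le> D + (1 - r)"
    proof -
      have "z - 1 = (z - c) - of_real (1 - r)" by (simp add: c_def)
      then have "cmod (z - 1) \<le> cmod (z - c) + cmod (complex_of_real (1 - r))"
        using norm_triangle_ineq4[of "z - c" "complex_of_real (1 - r)"] by (simp only:)
      then show ?thesis using r by (simp add: D_def del: of_real_diff)
    qed
    have D2: "cmod (1 - c * z) = D" using cmod_one_minus_mult_sphere[OF z, of c] c by (simp add: D_def)
    have zc: "z - c \<noteq> 0" "1 - c * z \<noteq> 0" using \<open>D > 0\<close> ne[of z] z by (auto simp: D_def)
    have "k z = F z * z * (((1 - c * z)\<^sup>2 - (z - c)\<^sup>2) / ((z - c)\<^sup>2 * (1 - c * z)\<^sup>2))"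
    proof -
      have "u / X - u / Y = u * ((Y - X) / (X * Y))" if "X \<noteq> 0" "Y \<noteq> 0" for u X Y :: complex
        using that by (simp add: divide_simps right_diff_distrib)
      then show ?thesis unfolding k_def using zc by simp
    qed
    also have "(1 - c * z)\<^sup>2 - (z - c)\<^sup>2 = (1 - c\<^sup>2) * ((1 - z) * (1 + z))"
      by (simp add: power2_eq_square algebra_simps)
    finally have kz: "k z = F z * z * ((1 - c\<^sup>2) * ((1 - z) * (1 + z)) / ((z - c)\<^sup>2 * (1 - c * z)\<^sup>2))" .
    then have "cmod (k z) = cmod (F z) * (cmod (1 - c\<^sup>2) * (cmod (1 - z) * cmod (1 + z)) / D ^ 4)"
    proof -
      have D4: "D ^ 4 = D\<^sup>2 * D\<^sup>2" by (simp flip: power_add)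
      show ?thesis using z kz unfolding D4 by (simp add: norm_mult norm_divide norm_power D2 D_def[symmetric])
    qed
    moreover have "cmod (1 - c\<^sup>2) = 1 - r\<^sup>2"
    proof -
      have "1 - c\<^sup>2 = complex_of_real (1 - r\<^sup>2)" by (simp add: c_def)
      then show ?thesis using r2 norm_of_real[of "1 - r\<^sup>2", where ?'a = complex] by simp
    qed
    moreover have "cmod (1 + z) \<le> 2" using norm_triangle_ineq[of 1 z] z by simp
    then have nn: "(1 - r\<^sup>2) * (cmod (1 - z) * cmod (1 + z)) \<le> (1 - r\<^sup>2) * (cmod (z - 1) * 2)"
      using r2 unfolding norm_minus_commute[of 1 z] by (intro mult_left_mono) auto
    have "cmod (F z) * ((1 - r\<^sup>2) * (cmod (1 - z) * cmod (1 + z)) / D ^ 4)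
        \<le> cmod (F z) * ((1 - r\<^sup>2) * (cmod (z - 1) * 2) / D ^ 4)"
      by (rule mult_left_mono[OF divide_right_mono[OF nn]]) (use \<open>D > 0\<close> in auto)
    ultimately have k: "cmod (k z) \<le> cmod (F z) * ((1 - r\<^sup>2) * (cmod (z - 1) * 2) / D ^ 4)"
      by simp
    show ?thesis
    proof (cases "cmod (z - 1) < d")
      case True
      have "cmod (k z) \<le> (e * cmod (z - 1)) * ((1 - r\<^sup>2) * (cmod (z - 1) * 2) / D ^ 4)"
        by (rule order_trans[OF k mult_right_mono[OF e(3)[OF z True]]]) (use r2 \<open>D > 0\<close> in auto)
      also have "\<dots> = (e * (1 - r\<^sup>2) * 2 / D ^ 4) * (cmod (z - 1))\<^sup>2" by (simp add: power2_eq_square)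
      also have "\<dots> \<le> (e * (1 - r\<^sup>2) * 2 / D ^ 4) * (2 * D)\<^sup>2"
        using z1 \<open>1 - r \<le> D\<close> e r2 \<open>D > 0\<close> by (intro mult_left_mono power_mono) auto
      also have "\<dots> = 8 * e * ((1 - r\<^sup>2) / D\<^sup>2)"
      proof -
        have "e * s * 2 / (q * q) * (4 * q) = 8 * e * (s / q)" if "q > 0" for q s :: real
          using that by (simp add: field_simps)
        from this[of "D\<^sup>2" "1 - r\<^sup>2"] show ?thesis
          using \<open>D > 0\<close> by (simp add: power_mult_distrib flip: power_add)
      qed
      finally have "cmod (k z) \<le> 8 * e * ((1 - r\<^sup>2) / (cmod (z - c))\<^sup>2)" unfolding D_def .
      moreover have "0 \<le> 64 * K * (1 - r\<^sup>2) / d ^ 4"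
        using \<open>K \<ge> 0\<close> r2 \<open>0 < d\<close> by (intro divide_nonneg_nonneg mult_nonneg_nonneg) auto
      ultimately show ?thesis by linarith
    next
      case False
      then have dD: "d / 2 \<le> D" using z1 r by simp
      have "cmod (z - 1) \<le> 2" using norm_triangle_ineq4[of z 1] z by simp
      then have "cmod (k z) \<le> K * ((1 - r\<^sup>2) * (2 * 2) / D ^ 4)"
        by (intro order_trans[OF k] mult_mono K[OF z] divide_right_mono mult_left_mono)
           (use r2 \<open>D > 0\<close> \<open>K \<ge> 0\<close> in auto)
      also have "\<dots> \<le> K * ((1 - r\<^sup>2) * (2 * 2) / (d / 2) ^ 4)"
        using dD r2 \<open>D > 0\<close> \<open>K \<ge> 0\<close> \<open>0 < d\<close> by (intro mult_left_mono divide_left_mono power_mono mult_nonneg_nonneg) auto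
      also have "\<dots> = 64 * K * (1 - r\<^sup>2) / d ^ 4" using \<open>0 < d\<close> by (simp add: field_simps)
      finally have "cmod (k z) \<le> 64 * K * (1 - r\<^sup>2) / d ^ 4" .
      moreover have "0 \<le> 8 * e * ((1 - r\<^sup>2) / (cmod (z - c))\<^sup>2)"
        using \<open>0 \<le> e\<close> r2 by (intro mult_nonneg_nonneg divide_nonneg_nonneg) auto
      ultimately show ?thesis by linarith
    qed
  qed
  have contP: "continuous_on (sphere 0 1) (\<lambda>z. (1 - r\<^sup>2) / (cmod (z - c))\<^sup>2)"
    using c by (intro continuous_intros) auto
  interpret finite_measure angle by (rule finite_measure_angle)
  have ik: "integrable angle (\<lambda>t. k (cis t))"
    unfolding k_def using integrable_circle[OF cont(1)] integrable_circle[OF cont(2)] by (rule Bochner_Integration.integrable_diff)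
  have ib: "integrable angle (\<lambda>t. 8 * e * ((1 - r\<^sup>2) / (cmod (cis t - c))\<^sup>2) + 64 * K * (1 - r\<^sup>2) / d ^ 4)"
    using integrable_circle[OF contP] by (intro Bochner_Integration.integrable_add integrable_mult_right) auto
  have "cmod (deriv F c) \<le> (\<integral>t. cmod (k (cis t)) \<partial>angle)"
    unfolding eq by (rule integral_norm_bound)
  also have "\<dots> \<le> (\<integral>t. 8 * e * ((1 - r\<^sup>2) / (cmod (cis t - c))\<^sup>2) + 64 * K * (1 - r\<^sup>2) / d ^ 4 \<partial>angle)"
    by (intro Bochner_Integration.integral_mono integrable_norm ik ib bound) auto
  also have "\<dots> = 8 * e + 64 * K * (1 - r\<^sup>2) / d ^ 4"
  proof -
    have "(\<integral>t. 8 * e * ((1 - r\<^sup>2) / (cmod (cis t - c))\<^sup>2) + 64 * K * (1 - r\<^sup>2) / d ^ 4 \<partial>angle) =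
        (\<integral>t. 8 * e * ((1 - r\<^sup>2) / (cmod (cis t - c))\<^sup>2) \<partial>angle) + (\<integral>t. 64 * K * (1 - r\<^sup>2) / d ^ 4 \<partial>angle)"
      using integrable_circle[OF contP] by (intro Bochner_Integration.integral_add integrable_mult_right) auto
    also have "(\<integral>t. 8 * e * ((1 - r\<^sup>2) / (cmod (cis t - c))\<^sup>2) \<partial>angle) =
        8 * e * (\<integral>t. (1 - r\<^sup>2) / (cmod (cis t - c))\<^sup>2 \<partial>angle)"
      by (rule integral_mult_right_zero)
    finally show ?thesis unfolding c_def Poisson_integral_one[OF r(1,2)] by simp
  qed
  finally show ?thesis by (simp add: c_def)
qed

text \<open>Subtracting the affine function with value \<open>F 1\<close> and slope
  \<open>D / \<i>\<close> leaves a function that is \<open>o(|z - 1|)\<close> along the circle, to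
  which \<open>radial_derivative_small\<close> applies. The slope is the chain rule for
  \<open>cis\<close>, whose derivative at 0 is \<open>\<i>\<close>.\<close>

lemma deriv_has_radial_limit:
  assumes F: "continuous_on (cball 0 1) F" "F holomorphic_on ball 0 1"
    and D: "((\<lambda>t. F (cis t)) has_vector_derivative D) (at 0)"
  shows "((\<lambda>r. deriv F (of_real r)) \<longlongrightarrow> D / \<i>) (at_left 1)"
proof -
  define A where "A = D / \<i>"
  define G where "G z = F z - F 1 - A * (z - 1)" for z
  have G: "continuous_on (cball 0 1) G" "G holomorphic_on ball 0 1"
    unfolding G_def by (intro continuous_intros holomorphic_intros F)+
  have dG: "deriv G z = deriv F z - A" if "z \<in> ball 0 1" for z
  proof -
    have "(F has_field_derivative deriv F z) (at z)" using F(2) that holomorphic_derivI open_ball by blast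
    then have "(G has_field_derivative (deriv F z - A)) (at z)"
      unfolding G_def by (auto intro!: derivative_eq_intros)
    then show ?thesis by (rule DERIV_imp_deriv)
  qed
  have "((\<lambda>z. exp (\<i> * z)) has_field_derivative \<i>) (at (of_real 0))"
    by (auto intro!: derivative_eq_intros)
  then have dcis: "(cis has_vector_derivative \<i>) (at 0)"
    unfolding cis_conv_exp[abs_def] by (rule has_vector_derivative_real_field)
  have dGc: "((\<lambda>t. G (cis t)) has_vector_derivative 0) (at 0)"
  proof -
    have "((\<lambda>t. F (cis t) - F 1 - A * (cis t - 1)) has_vector_derivative (D - 0 - A * (\<i> - 0))) (at 0)"
      by (intro derivative_intros D dcis)
    moreover have "A * \<i> = D" unfolding A_def by (metis complex_i_not_zero nonzero_eq_divide_eq)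
    then have "D - 0 - A * (\<i> - 0) = 0" by simp
    ultimately show ?thesis unfolding G_def by (simp only:)
  qed
  have "compact (G ` cball 0 1)" using G(1) by (intro compact_continuous_image) auto
  then obtain K where K: "\<And>z. z \<in> cball 0 1 \<Longrightarrow> cmod (G z) \<le> K"
    using compact_imp_bounded by (force simp: bounded_iff)
  \<comment> \<open>Differentiability gives little-o in the angle, whereas the estimate asks for
    little-o in the chord; near 1 the angle is at most twice the chord.\<close>
  have local: "\<exists>d>0. \<forall>z. cmod z = 1 \<longrightarrow> cmod (z - 1) < d \<longrightarrow> cmod (G z) \<le> e * cmod (z - 1)" if "e > 0" for e
  proof -
    obtain d1 where d1: "d1 > 0" "\<And>t. \<bar>t\<bar> < d1 \<Longrightarrow> cmod (G (cis t)) \<le> (e / 2) * \<bar>t\<bar>"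
    proof -
      have "\<exists>d>0. \<forall>y. \<bar>y\<bar> < d \<longrightarrow> cmod (G (cis y)) \<le> e / 2 * \<bar>y\<bar>"
        using conjunct2[OF dGc[unfolded has_vector_derivative_def has_derivative_at_alt], THEN spec, of "e / 2"] \<open>e > 0\<close>
        by (simp add: G_def)
      then show ?thesis using that by blast
    qed
    obtain d2 where d2: "d2 > 0" "\<And>t. \<bar>t\<bar> < d2 \<Longrightarrow> cmod (cis t - 1 - t *\<^sub>R \<i>) \<le> (1 / 2) * \<bar>t\<bar>"
    proof -
      have "\<exists>d>0. \<forall>y. \<bar>y\<bar> < d \<longrightarrow> cmod (cis y - 1 - y *\<^sub>R \<i>) \<le> 1 / 2 * \<bar>y\<bar>"
        using conjunct2[OF dcis[unfolded has_vector_derivative_def has_derivative_at_alt], THEN spec, of "1 / 2"]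
        by simp
      then show ?thesis using that by blast
    qed
    have "isCont Arg 1" by (intro continuous_at_Arg) auto
    then obtain d where d: "d > 0" "\<And>z. cmod (z - 1) < d \<Longrightarrow> \<bar>Arg z\<bar> < min d1 d2"
      using d1(1) d2(1) unfolding continuous_at_eps_delta
      by (auto simp: dist_norm dest!: spec[of _ "min d1 d2"])
    have "cmod (G z) \<le> e * cmod (z - 1)" if z: "cmod z = 1" "cmod (z - 1) < d" for z
    proof -
      define t where "t = Arg z"
      have zt: "z = cis t" using z(1) Arg_eq[of z] norm_zero by (force simp: t_def cis_conv_exp)
      have t: "\<bar>t\<bar> < d1" "\<bar>t\<bar> < d2" using d(2)[OF z(2)] by (auto simp: t_def)
      have "\<bar>t\<bar> = cmod (t *\<^sub>R \<i>)" by simp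
      also have "\<dots> \<le> cmod (cis t - 1) + cmod (cis t - 1 - t *\<^sub>R \<i>)"
        using norm_triangle_ineq4[of "cis t - 1" "cis t - 1 - t *\<^sub>R \<i>"] by simp
      finally have "\<bar>t\<bar> \<le> 2 * cmod (z - 1)" using d2(2)[OF t(2)] zt by simp
      then have "(e / 2) * \<bar>t\<bar> \<le> (e / 2) * (2 * cmod (z - 1))" using \<open>e > 0\<close> by (intro mult_left_mono) auto
      then show ?thesis using d1(2)[OF t(1)] zt by simp
    qed
    then show ?thesis using d(1) by blast
  qed
  have "((\<lambda>r. deriv G (of_real r)) \<longlongrightarrow> 0) (at_left 1)"
  proof (rule tendstoI)
    fix e :: real assume "e > 0"
    obtain d where d: "d > 0" "\<And>z. cmod z = 1 \<Longrightarrow> cmod (z - 1) < d \<Longrightarrow> cmod (G z) \<le> (e / 16) * cmod (z - 1)"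
      using local[of "e / 16"] \<open>e > 0\<close> by auto
    have "((\<lambda>r. 8 * (e / 16) + 64 * K * (1 - r\<^sup>2) / d ^ 4) \<longlongrightarrow> 8 * (e / 16) + 64 * K * (1 - 1\<^sup>2) / d ^ 4) (at_left 1)"
      using d(1) by (intro tendsto_intros) auto
    then have "eventually (\<lambda>r. 8 * (e / 16) + 64 * K * (1 - r\<^sup>2) / d ^ 4 < e) (at_left 1)"
      by (rule order_tendstoD) (use \<open>e > 0\<close> in auto)
    moreover have "eventually (\<lambda>r :: real. r > max 0 (1 - d / 2)) (at_left 1)"
      using d(1) by (intro eventually_at_leftI[of "max 0 (1 - d / 2)"]) auto
    moreover have "eventually (\<lambda>r :: real. r < 1) (at_left 1)"
      by (simp add: eventually_at_filter)
    ultimately show "eventually (\<lambda>r. dist (deriv G (of_real r)) 0 < e) (at_left 1)"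
    proof eventually_elim
      case (elim r)
      have "cmod (deriv G (of_real r)) \<le> 8 * (e / 16) + 64 * K * (1 - r\<^sup>2) / d ^ 4"
        by (rule radial_derivative_small[OF G K _ d(1) d(2)]) (use elim \<open>e > 0\<close> in auto)
      then show ?case using elim by simp
    qed
  qed
  then have "((\<lambda>r. deriv G (of_real r) + A) \<longlongrightarrow> 0 + A) (at_left 1)"
    by (intro tendsto_intros)
  moreover have "eventually (\<lambda>r. deriv G (of_real r) + A = deriv F (of_real r)) (at_left 1)"
  proof -
    have "eventually (\<lambda>r :: real. r > 0 \<and> r < 1) (at_left 1)"
      by (intro eventually_at_leftI[of 0]) auto
    then show ?thesis by eventually_elim (simp add: dG)
  qed
  ultimately show ?thesis unfolding A_def by (simp add: tendsto_cong)
qed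

section \<open>Null sets on the circle and Fatou's theorem\<close>

lemma cmod_cis_diff_le: "cmod (cis x - cis y) \<le> \<bar>x - y\<bar>"
proof -
  have "cis x - cis y = cis y * (cis (x - y) - 1)" by (simp add: algebra_simps cis_mult)
  then have "cmod (cis x - cis y) = cmod (cis (x - y) - 1)" by (simp add: norm_mult)
  also have "\<dots> = 2 * \<bar>sin ((x - y) / 2)\<bar>" using dist_exp_i_1[of "x - y"] by (simp add: dist_norm cis_conv_exp)
  also have "\<dots> \<le> \<bar>x - y\<bar>" using abs_sin_x_le_abs_x[of "(x - y) / 2"] by simp
  finally show ?thesis .
qed

text \<open>Neither \<open>P\<close> nor the image of a null set under \<open>cis\<close> need be
  Borel, so a Borel null set containing the exceptional points has to be produced. Up to a null set
  the good angles are a countable union of compact sets; their images are compact, and the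
  complement of these images is the required set.\<close>

lemma AE_arclengthI:
  assumes "AE t in angle. P (cis t)"
  shows "AE \<zeta> in arclength. P \<zeta>"
proof -
  have "AE t in lborel. t \<in> {0..2 * pi} \<longrightarrow> P (cis t)"
    using assms unfolding angle_def by (subst (asm) AE_uniform_measure) auto
  then obtain N where N0: "\<And>t. t \<in> space lborel - N \<Longrightarrow> t \<in> {0..2 * pi} \<longrightarrow> P (cis t)"
    and N1: "N \<in> null_sets lborel"
    using AE_E3 by blast
  have N: "N \<in> null_sets lborel" "{0..2 * pi} \<inter> {t. \<not> P (cis t)} \<subseteq> N"
    using N1 N0 by (auto, metis)
  then have "{0..2 * pi} - N \<in> sets lebesgue" by (auto simp: null_sets_def)
  then obtain C T where C: "fsigma C" "T \<in> null_sets lebesgue" "C \<union> T = {0..2 * pi} - N"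
    by (rule lebesgue_set_almost_fsigma)
  obtain X :: "nat \<Rightarrow> real set" where X: "\<And>n. closed (X n)" "C = (\<Union>n. X n)"
    using C(1) by (auto elim!: fsigma.cases)
  have "compact (X n)" for n
  proof -
    have "X n \<subseteq> {0..2 * pi}" using X(2) C(3) by blast
    then have "X n = X n \<inter> {0..2 * pi}" by blast
    then show ?thesis using closed_Int_compact[OF X(1) compact_Icc] by metis
  qed
  then have "compact (cis ` X n)" for n by (intro compact_continuous_image continuous_intros)
  then have "cis ` C \<in> sets borel" unfolding X(2) image_UN by (intro sets.countable_UN) (auto intro: borel_compact)
  then have M: "- (cis ` C) \<in> sets borel" by simp
  have "emeasure arclength (- (cis ` C)) = emeasure angle (cis -` (- (cis ` C)))"
    unfolding arclength_eq using M by (subst emeasure_distr) auto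
  also have "\<dots> = 0"
  proof -
    have [measurable]: "cis -` (- (cis ` C)) \<in> sets borel" using measurable_sets[OF measurable_cis M] by simp
    have "{0..2 * pi} \<inter> cis -` (- (cis ` C)) \<subseteq> N \<union> T"
      using C(3) by auto
    moreover have "N \<union> T \<in> null_sets lebesgue" using N(1) C(2) by (auto intro: null_sets_completionI)
    ultimately have "{0..2 * pi} \<inter> cis -` (- (cis ` C)) \<in> null_sets lebesgue"
      by (rule null_sets_completion_subset)
    then have "emeasure lborel ({0..2 * pi} \<inter> cis -` (- (cis ` C))) = 0"
      by (simp add: null_sets_def)
    then show ?thesis unfolding angle_def by (subst emeasure_uniform_measure) auto
  qed
  finally have "- (cis ` C) \<in> null_sets arclength" using M by (auto simp: null_sets_def arclength_eq)
  then show ?thesis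
  proof (rule AE_I')
    show "{\<zeta> \<in> space arclength. \<not> P \<zeta>} \<subseteq> - (cis ` C)"
      using N(2) C(3) by auto
  qed
qed

text \<open>A primitive \<open>F\<close> of the bounded function \<open>f\<close> is Lipschitz, so
  it extends to the closed disc and is differentiable along the circle at almost every angle. After
  rotating such a point to 1, the radial limit of the derivative of \<open>F\<close> is the radial
  limit of \<open>f\<close>.\<close>

theorem Fatou_radial_limits:
  assumes f: "f holomorphic_on ball 0 1" "bounded (f ` ball 0 1)"
  shows "AE \<zeta> in arclength. \<exists>l. has_boundary_value f \<zeta> l"
proof -
  obtain M where M: "\<And>z. z \<in> ball 0 1 \<Longrightarrow> cmod (f z) \<le> M"
    using f(2) unfolding bounded_iff by blast
  obtain F0 where F0: "\<And>z. z \<in> ball 0 1 \<Longrightarrow> (F0 has_field_derivative f z) (at z within ball 0 1)"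
    using holomorphic_convex_primitive'[OF convex_ball open_ball f(1)] by blast
  have "M \<ge> 0" using order_trans[OF norm_ge_zero M[of 0]] by simp
  have "M-lipschitz_on (ball 0 1) F0"
  proof (rule lipschitz_onI)
    fix x y :: complex assume "x \<in> ball 0 1" "y \<in> ball 0 1"
    then show "dist (F0 x) (F0 y) \<le> M * dist x y"
      using field_differentiable_bound[OF convex_ball[of 0 1] F0 M] by (simp add: dist_norm)
  qed fact
  then obtain F where F: "M-lipschitz_on (closure (ball 0 1)) F" "\<And>z. z \<in> ball 0 1 \<Longrightarrow> F z = F0 z"
    using lipschitz_extend_closure by blast
  have lip: "M-lipschitz_on (cball 0 1) F" using F(1) by simp
  have contF: "continuous_on (cball 0 1) F" using lip by (rule lipschitz_on_continuous_on)
  have dF: "(F has_field_derivative f z) (at z)" if z: "z \<in> ball 0 1" for z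
  proof -
    have "(F0 has_field_derivative f z) (at z)" using F0[OF z] z by (simp add: at_within_open[OF z open_ball])
    then show ?thesis
      by (rule has_field_derivative_transform_within_open[OF _ open_ball z]) (simp add: F(2))
  qed
  have "cmod (F (cis x) - F (cis y)) \<le> M * \<bar>x - y\<bar>" for x y
  proof -
    have "cmod (F (cis x) - F (cis y)) \<le> M * cmod (cis x - cis y)"
      using lipschitz_onD[OF lip, of "cis x" "cis y"] by (simp add: dist_norm)
    also have "\<dots> \<le> M * \<bar>x - y\<bar>" using cmod_cis_diff_le \<open>M \<ge> 0\<close> by (intro mult_left_mono) auto
    finally show ?thesis .
  qed
  then have "AE t in lborel. \<exists>D. ((\<lambda>t. F (cis t)) has_vector_derivative D) (at t)"
    by (rule AE_lipschitz_differentiable)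
  then have "AE t in lborel. \<exists>l. has_boundary_value f (cis t) l"
  proof (rule AE_mp, intro AE_I2 impI, safe)
    fix t D assume D: "((\<lambda>t. F (cis t)) has_vector_derivative D) (at t)"
    define G where "G z = F (cis t * z)" for z
    have G: "continuous_on (cball 0 1) G"
      unfolding G_def by (intro continuous_on_compose2[OF contF] continuous_intros) (auto simp: norm_mult)
    have dG: "(G has_field_derivative cis t * f (cis t * z)) (at z)" if "z \<in> ball 0 1" for z
    proof -
      have "cis t * z \<in> ball 0 1" using that by (simp add: norm_mult)
      have "((\<lambda>z. F (cis t * z)) has_field_derivative f (cis t * z) * cis t) (at z)"
        by (rule DERIV_chain2[where f = F and g = "\<lambda>z. cis t * z"])
           (auto intro!: dF \<open>cis t * z \<in> ball 0 1\<close> derivative_eq_intros)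
      then show ?thesis unfolding G_def by (simp add: mult.commute)
    qed
    then have "G holomorphic_on ball 0 1"
      by (meson field_differentiable_at_within field_differentiable_def holomorphic_onI)
    moreover have "((\<lambda>s. G (cis s)) has_vector_derivative D) (at 0)"
    proof -
      have "((\<lambda>s. F (cis (t + s))) has_vector_derivative D) (at 0)"
      proof -
        have "((\<lambda>s. t + s) has_vector_derivative 1) (at 0)"
          by (auto intro!: derivative_eq_intros)
        from vector_diff_chain_at[OF this, of "\<lambda>t. F (cis t)" D] D show ?thesis by (simp add: o_def)
      qed
      then show ?thesis by (simp add: G_def cis_mult)
    qed
    ultimately have "((\<lambda>r. deriv G (of_real r)) \<longlongrightarrow> D / \<i>) (at_left 1)"
      using G by (intro deriv_has_radial_limit)
    moreover have "eventually (\<lambda>r. deriv G (of_real r) = cis t * f (of_real r * cis t)) (at_left 1)"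
    proof -
      have "eventually (\<lambda>r :: real. r > 0 \<and> r < 1) (at_left 1)"
        by (intro eventually_at_leftI[of 0]) auto
      then show ?thesis
      proof eventually_elim
        case (elim r)
        then show ?case using DERIV_imp_deriv[OF dG[of "of_real r"]] by (simp add: mult.commute)
      qed
    qed
    ultimately have "((\<lambda>r. cis t * f (of_real r * cis t)) \<longlongrightarrow> D / \<i>) (at_left 1)"
      by (simp add: tendsto_cong)
    then have "((\<lambda>r. cis (-t) * (cis t * f (of_real r * cis t))) \<longlongrightarrow> cis (-t) * (D / \<i>)) (at_left 1)"
      by (intro tendsto_intros)
    then show "\<exists>l. has_boundary_value f (cis t) l"
      unfolding has_boundary_value_def by (auto simp: mult.assoc[symmetric] cis_mult)
  qed
  then have "AE t in angle. \<exists>l. has_boundary_value f (cis t) l"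
    unfolding angle_def by (subst AE_uniform_measure) auto
  then show ?thesis by (rule AE_arclengthI)
qed

section \<open>Blaschke products\<close>

lemma cball_in_smaller_disc:
  fixes x :: complex
  assumes "x \<in> ball 0 1"
  obtains d R where "0 < d" "R < 1" "cball x d \<subseteq> cball 0 R" "cball x d \<subseteq> ball 0 1"
proof
  define R where "R = (1 + cmod x) / 2"
  show R: "R < 1" "0 < (1 - cmod x) / 2" using assms by (auto simp: R_def)
  show sub: "cball x ((1 - cmod x) / 2) \<subseteq> cball 0 R"
  proof
    fix y assume "y \<in> cball x ((1 - cmod x) / 2)"
    then have "cmod (y - x) \<le> (1 - cmod x) / 2" by (simp add: dist_norm norm_minus_commute)
    moreover have "cmod y \<le> cmod x + cmod (y - x)" by (rule norm_triangle_sub)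
    ultimately show "y \<in> cball 0 R" by (simp add: R_def field_simps)
  qed
  show "cball x ((1 - cmod x) / 2) \<subseteq> ball 0 1" using sub R(1) by force
qed

section \<open>Single Blaschke factors\<close>

lemma one_minus_cnj_mult_nonzero:
  assumes "cmod a < 1" "cmod z \<le> 1"
  shows "1 - cnj a * z \<noteq> 0"
proof -
  have "cmod (cnj a * z) \<le> cmod a" using assms by (simp add: norm_mult mult_left_le)
  then have "cmod (cnj a * z) < 1" using assms by linarith
  then show ?thesis by auto
qed

lemma cnj_mult_neq_1:
  "cmod a < 1 \<Longrightarrow> cmod z \<le> 1 \<Longrightarrow> cnj a * z \<noteq> 1"
  using one_minus_cnj_mult_nonzero by auto

lemma cmod_blaschke_factor:
  "cmod (blaschke_factor a z) = cmod (a - z) / cmod (1 - cnj a * z)"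
  by (auto simp: blaschke_factor_def norm_mult norm_divide)

lemma blaschke_identity:
  "(cmod (1 - cnj a * z))\<^sup>2 - (cmod (a - z))\<^sup>2 = (1 - (cmod a)\<^sup>2) * (1 - (cmod z)\<^sup>2)"
  by (simp only: cmod_power2) (simp add: power2_eq_square algebra_simps)

lemma one_minus_blaschke_factor_sq:
  assumes "cmod a < 1" "cmod z \<le> 1"
  shows "1 - (cmod (blaschke_factor a z))\<^sup>2 =
    (1 - (cmod a)\<^sup>2) * (1 - (cmod z)\<^sup>2) / (cmod (1 - cnj a * z))\<^sup>2"
proof -
  have "cmod (1 - cnj a * z) \<noteq> 0" using one_minus_cnj_mult_nonzero[OF assms] by simp
  then show ?thesis
    unfolding blaschke_identity[symmetric]
    by (simp add: cmod_blaschke_factor power_divide field_simps)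
qed

lemma cmod_blaschke_factor_le_1:
  assumes "cmod a < 1" "cmod z \<le> 1"
  shows "cmod (blaschke_factor a z) \<le> 1"
proof -
  have "0 \<le> (1 - (cmod a)\<^sup>2) * (1 - (cmod z)\<^sup>2) / (cmod (1 - cnj a * z))\<^sup>2"
    using assms by (intro divide_nonneg_nonneg mult_nonneg_nonneg) (auto simp: power_le_one)
  then have "(cmod (blaschke_factor a z))\<^sup>2 \<le> 1"
    using one_minus_blaschke_factor_sq[OF assms] by linarith
  then show ?thesis by (simp add: abs_square_le_1)
qed

lemma cmod_blaschke_factor_sphere:
  assumes "cmod a < 1" "cmod z = 1"
  shows "cmod (blaschke_factor a z) = 1"
proof -
  have "(cmod (blaschke_factor a z))\<^sup>2 = 1"
    using one_minus_blaschke_factor_sq[of a z] assms by simp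
  then show ?thesis using norm_ge_zero[of "blaschke_factor a z"] by (simp add: power2_eq_1_iff)
qed

text \<open>Over the denominator \<open>a * (1 - cnj a * z)\<close> the numerator of the difference
  is \<open>- (1 - |a|) * (a + |a| * z)\<close>, which exhibits the factor responsible for
  convergence. The zero at the origin is separate because of its normalising constant -1; there
  \<open>1 - |a| = 1\<close> and a crude bound is enough.\<close>

lemma blaschke_factor_minus_1_le:
  assumes a: "cmod a < 1" and z: "cmod z \<le> R" "R < 1"
  shows "cmod (blaschke_factor a z - 1) \<le> 2 / (1 - R) * (1 - cmod a)"
proof -
  have R: "0 \<le> R" using z norm_ge_zero order_trans by blast
  have den: "1 - R \<le> cmod (1 - cnj a * z)"
  proof -
    have "cmod (cnj a * z) \<le> R" using a z mult_mono[of "cmod a" 1 "cmod z" R] R by (simp add: norm_mult)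
    then show ?thesis using norm_triangle_ineq2[of 1 "cnj a * z"] by simp
  qed
  have ne: "1 - cnj a * z \<noteq> 0" using one_minus_cnj_mult_nonzero[OF a] z by simp
  show ?thesis
  proof (cases "a = 0")
    case True
    have "cmod (z - 1) \<le> 2" using norm_triangle_ineq4[of z 1] z by simp
    also have "2 \<le> 2 / (1 - R)" using R z by (simp add: field_simps)
    finally show ?thesis using True by (simp add: blaschke_factor_def)
  next
    case False
    have "a * cnj a = (of_real (cmod a))\<^sup>2" using complex_norm_square[of a] by simp
    then have "of_real (cmod a) * (a - z) - a * (1 - cnj a * z)
        = - (of_real (1 - cmod a) * (a + of_real (cmod a) * z))"
    proof -
      have "of_real (cmod a) * (a - z) - a * (1 - cnj a * z) =
          of_real (cmod a) * a - of_real (cmod a) * z - a + (a * cnj a) * z" by (simp add: algebra_simps)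
      also have "\<dots> = of_real (cmod a) * a - of_real (cmod a) * z - a + (of_real (cmod a))\<^sup>2 * z"
        by (simp only: \<open>a * cnj a = (of_real (cmod a))\<^sup>2\<close>)
      finally show ?thesis by (simp add: algebra_simps power2_eq_square)
    qed
    moreover have "blaschke_factor a z - 1 = (of_real (cmod a) * (a - z) - a * (1 - cnj a * z)) / (a * (1 - cnj a * z))"
      using False ne by (simp add: blaschke_factor_def field_simps)
    ultimately have "cmod (blaschke_factor a z - 1) = (1 - cmod a) * cmod (a + of_real (cmod a) * z) / (cmod a * cmod (1 - cnj a * z))"
      using a by (simp add: norm_mult norm_divide del: of_real_diff)
    also have "\<dots> \<le> (1 - cmod a) * (2 * cmod a) / (cmod a * cmod (1 - cnj a * z))"
    proof -
      have "cmod (a + of_real (cmod a) * z) \<le> cmod a + cmod a * cmod z"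
        using norm_triangle_ineq[of a "of_real (cmod a) * z"] by (simp add: norm_mult)
      also have "\<dots> \<le> 2 * cmod a" using z mult_left_le[of "cmod z" "cmod a"] by simp
      finally show ?thesis using a by (intro divide_right_mono mult_left_mono) auto
    qed
    also have "\<dots> = 2 * (1 - cmod a) / cmod (1 - cnj a * z)" using False by simp
    also have "\<dots> \<le> 2 * (1 - cmod a) / (1 - R)"
      using den a z by (intro divide_left_mono mult_pos_pos) auto
    finally show ?thesis by simp
  qed
qed

lemma holomorphic_blaschke_factor:
  "cmod a < 1 \<Longrightarrow> blaschke_factor a holomorphic_on ball 0 1"
  unfolding blaschke_factor_def[abs_def]
  by (intro holomorphic_intros) (auto simp: cnj_mult_neq_1)

lemma continuous_on_blaschke_factor:
  "cmod a < 1 \<Longrightarrow> continuous_on (cball 0 1) (blaschke_factor a)"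
  unfolding blaschke_factor_def[abs_def]
  by (intro continuous_intros) (auto simp: cnj_mult_neq_1)

text \<open>Partial products over an index set are written as infinite products with
  trivial factors, so that \<open>UNIV\<close>, \<open>{..<n}\<close>, \<open>{n..}\<close> and \<open>- {k}\<close> are treated uniformly.\<close>

definition blaschke_part :: "(nat \<Rightarrow> complex) \<Rightarrow> nat set \<Rightarrow> complex \<Rightarrow> complex" where
  "blaschke_part a J z = (\<Prod>j. if j \<in> J then blaschke_factor (a j) z else 1)"

lemma blaschke_part_UNIV: "blaschke_part a UNIV = blaschke_product a"
  by (auto simp: blaschke_part_def blaschke_product_def)

lemma blaschke_part_finite:
  "finite J \<Longrightarrow> blaschke_part a J z = (\<Prod>j\<in>J. blaschke_factor (a j) z)"
  unfolding blaschke_part_def by (subst prodinf_finite[of J]) auto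

section \<open>Products over arbitrary sets of indices\<close>

locale blaschke =
  fixes a :: "nat \<Rightarrow> complex"
  assumes seq: "blaschke_sequence a"
begin

abbreviation "P \<equiv> blaschke_part a"

lemma a_less_1: "cmod (a j) < 1"
  using seq by (auto simp: blaschke_sequence_def)

lemma one_minus_sq_pos: "0 < 1 - (cmod (a j))\<^sup>2"
  using a_less_1[of j] by (simp add: power_less_one_iff abs_square_less_1)

lemma one_minus_le_sq: "1 - cmod (a j) \<le> 1 - (cmod (a j))\<^sup>2"
  using a_less_1[of j] by (simp add: power2_eq_square mult_left_le)

lemma summable_a: "summable (\<lambda>j. 1 - cmod (a j))"
  using seq by (auto simp: blaschke_sequence_def)

lemma term_minus_1_le:
  assumes "cmod z \<le> R" "R < 1"
  shows "cmod ((if j \<in> J then blaschke_factor (a j) z else 1) - 1) \<le> 2 / (1 - R) * (1 - cmod (a j))"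
  using blaschke_factor_minus_1_le[OF a_less_1 assms, of j] assms a_less_1[of j]
  by (auto intro!: mult_nonneg_nonneg)

lemma convergent_P:
  assumes "cmod z < 1"
  shows "convergent_prod (\<lambda>j. if j \<in> J then blaschke_factor (a j) z else 1)"
proof -
  have "summable (\<lambda>j. cmod ((if j \<in> J then blaschke_factor (a j) z else 1) - 1))"
    by (rule summable_comparison_test'[OF summable_mult[OF summable_a, of "2 / (1 - cmod z)"]])
       (use term_minus_1_le[of z "cmod z"] assms in auto)
  then show ?thesis
    by (intro abs_convergent_prod_imp_convergent_prod summable_imp_abs_convergent_prod)
qed

lemma LIMSEQ_P:
  assumes "cmod z < 1"
  shows "(\<lambda>n. P (J \<inter> {..<n}) z) \<longlonglongrightarrow> P J z"
proof -
  have "P (J \<inter> {..<n}) z = (\<Prod>j<n. if j \<in> J then blaschke_factor (a j) z else 1)" for n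
    by (simp add: blaschke_part_finite Int_commute[of J] prod.inter_restrict)
  moreover have "(\<lambda>n. \<Prod>j<n. if j \<in> J then blaschke_factor (a j) z else 1) \<longlonglongrightarrow> P J z"
    using convergent_prod_LIMSEQ[OF convergent_P[OF assms]] unfolding blaschke_part_def
    by (subst filterlim_sequentially_Suc[symmetric]) (simp add: lessThan_Suc_atMost)
  ultimately show ?thesis by simp
qed

lemma P_Un:
  assumes "cmod z < 1" "I \<inter> J = {}"
  shows "P (I \<union> J) z = P I z * P J z"
  unfolding blaschke_part_def
  by (subst prodinf_mult[OF convergent_P convergent_P, OF assms(1) assms(1)])
     (use assms(2) in \<open>auto simp: fun_eq_iff intro!: arg_cong[of _ _ prodinf]\<close>)

lemma cmod_P_le_1:
  assumes "cmod z < 1"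
  shows "cmod (P J z) \<le> 1"
proof (rule LIMSEQ_le_const2[OF tendsto_norm[OF LIMSEQ_P[OF assms]]], intro exI allI impI)
  fix n show "cmod (P (J \<inter> {..<n}) z) \<le> 1"
    using assms by (auto simp: blaschke_part_finite prod_norm[symmetric] intro!: prod_le_1 cmod_blaschke_factor_le_1 a_less_1)
qed

lemma cmod_P_antimono:
  assumes "cmod z < 1" "I \<subseteq> J"
  shows "cmod (P J z) \<le> cmod (P I z)"
proof -
  have "P J z = P I z * P (J - I) z"
    using P_Un[OF assms(1), of I "J - I"] assms(2) by (simp add: Un_absorb1)
  then show ?thesis using cmod_P_le_1[OF assms(1), of "J - I"] by (simp add: norm_mult mult_left_le)
qed

lemma P_remove:
  assumes "cmod z < 1" "k \<in> J"
  shows "P J z = blaschke_factor (a k) z * P (J - {k}) z"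
proof -
  have "P J z = P ({k} \<union> (J - {k})) z" using assms(2) by (simp add: insert_absorb)
  also have "\<dots> = P {k} z * P (J - {k}) z" by (rule P_Un[OF assms(1)]) auto
  finally show ?thesis by (simp add: blaschke_part_finite)
qed

lemma uniform_limit_P:
  assumes "R < 1"
  shows "uniform_limit (cball 0 R) (\<lambda>n z. P (J \<inter> {..<n}) z) (P J) sequentially"
proof -
  define f where "f j z = (if j \<in> J then blaschke_factor (a j) z else 1)" for j z
  have fin: "P (J \<inter> {..<n}) z = (\<Prod>j<n. f j z)" for n z
    by (simp add: blaschke_part_finite Int_commute[of J] prod.inter_restrict f_def)
  have "uniformly_convergent_on (cball 0 R) (\<lambda>n z. \<Prod>j<n. f j z)"
  proof (rule uniformly_convergent_on_prod')
    show "continuous_on (cball 0 R) (f n)" for n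
      using assms unfolding f_def
      by (cases "n \<in> J") (auto intro!: continuous_on_subset[OF continuous_on_blaschke_factor[OF a_less_1[of n]]])
    show "uniformly_convergent_on (cball 0 R) (\<lambda>N x. \<Sum>n<N. norm (f n x - 1))"
      by (rule Weierstrass_m_test'[OF _ summable_mult[OF summable_a, of "2 / (1 - R)"]])
         (use term_minus_1_le assms in \<open>auto simp: f_def\<close>)
  qed auto
  then have "uniform_limit (cball 0 R) (\<lambda>n z. \<Prod>j<n. f j z) (\<lambda>z. lim (\<lambda>n. \<Prod>j<n. f j z)) sequentially"
    by (simp add: uniformly_convergent_uniform_limit_iff)
  moreover have "lim (\<lambda>n. \<Prod>j<n. f j z) = P J z" if "z \<in> cball 0 R" for z
    using LIMSEQ_P[of z J] that assms unfolding fin by (intro limI) auto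
  then have "uniform_limit (cball 0 R) (\<lambda>n z. \<Prod>j<n. f j z) (\<lambda>z. lim (\<lambda>n. \<Prod>j<n. f j z)) sequentially \<longleftrightarrow>
      uniform_limit (cball 0 R) (\<lambda>n z. \<Prod>j<n. f j z) (P J) sequentially"
    by (intro uniform_limit_cong') auto
  ultimately show ?thesis unfolding fin by blast
qed

lemma holomorphic_P: "P J holomorphic_on ball 0 1"
proof (rule holomorphic_uniform_sequence)
  fix n show "P (J \<inter> {..<n}) holomorphic_on ball 0 1"
    unfolding blaschke_part_finite[OF finite_Int[OF disjI2[OF finite_lessThan]], abs_def]
    by (intro holomorphic_intros holomorphic_blaschke_factor a_less_1)
next
  fix x :: complex assume x: "x \<in> ball 0 1"
  then obtain d R where "0 < d" "R < 1" "cball x d \<subseteq> cball 0 R" "cball x d \<subseteq> ball 0 1"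
    by (rule cball_in_smaller_disc)
  then show "\<exists>d>0. cball x d \<subseteq> ball 0 1 \<and> uniform_limit (cball x d) (\<lambda>n. P (J \<inter> {..<n})) (P J) sequentially"
    using uniform_limit_on_subset[OF uniform_limit_P[of R J]] by blast
qed auto

text \<open>As \<open>z\<close> may itself be a zero, the quotient is formed only from an index
  \<open>N\<close> on, after which all factors are within distance less than 1 of 1. From there the
  tail is \<open>P {N..} z\<close> divided by its own partial products.\<close>

lemma P_tail_tendsto_1:
  assumes z: "cmod z < 1"
  shows "(\<lambda>n. P {n..} z) \<longlonglongrightarrow> 1"
proof -
  obtain N where N: "P {N..} z \<noteq> 0"
  proof -
    have "summable (\<lambda>j. 2 / (1 - cmod z) * (1 - cmod (a j)))" by (intro summable_mult summable_a)
    then have "(\<lambda>j. 2 / (1 - cmod z) * (1 - cmod (a j))) \<longlonglongrightarrow> 0" by (rule summable_LIMSEQ_zero)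
    then have "eventually (\<lambda>j. 2 / (1 - cmod z) * (1 - cmod (a j)) < 1) sequentially"
      by (rule order_tendstoD) auto
    then obtain N where N: "\<And>j. j \<ge> N \<Longrightarrow> 2 / (1 - cmod z) * (1 - cmod (a j)) < 1"
      by (auto simp: eventually_sequentially)
    have "(if j \<in> {N..} then blaschke_factor (a j) z else 1) \<noteq> 0" for j
      using N[of j] blaschke_factor_minus_1_le[OF a_less_1 order_refl z, of j] by auto
    then show ?thesis using that prodinf_nonzero[OF convergent_P[OF z]] unfolding blaschke_part_def by blast
  qed
  have "(\<lambda>n. P ({N..} \<inter> {..<n}) z) \<longlonglongrightarrow> P {N..} z" using LIMSEQ_P[OF z] .
  then have "(\<lambda>n. P {N..} z / P ({N..} \<inter> {..<n}) z) \<longlonglongrightarrow> P {N..} z / P {N..} z"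
    using N by (intro tendsto_intros)
  moreover have "eventually (\<lambda>n. P {N..} z / P ({N..} \<inter> {..<n}) z = P {n..} z) sequentially"
    using eventually_ge_at_top[of N]
  proof eventually_elim
    case (elim n)
    have "{N..} = ({N..} \<inter> {..<n}) \<union> {n..}" using elim by auto
    then have "P {N..} z = P ({N..} \<inter> {..<n}) z * P {n..} z"
      using P_Un[OF z, of "{N..} \<inter> {..<n}" "{n..}"] by force
    then show ?case using N by auto
  qed
  ultimately show ?thesis using N by (simp add: tendsto_cong)
qed

lemma P_zero: "k \<in> J \<Longrightarrow> P J (a k) = 0"
  using P_remove[OF a_less_1, of k J k] by (simp add: blaschke_factor_def)

lemma P_nonzero:
  assumes "cmod z < 1" "\<And>j. j \<in> J \<Longrightarrow> z \<noteq> a j"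
  shows "P J z \<noteq> 0"
  unfolding blaschke_part_def
proof (rule prodinf_nonzero[OF convergent_P[OF assms(1)]])
  fix j show "(if j \<in> J then blaschke_factor (a j) z else 1) \<noteq> 0"
    using assms one_minus_cnj_mult_nonzero[OF a_less_1[of j], of z] by (auto simp: blaschke_factor_def)
qed

text \<open>The quotient \<open>P J z / (z - a k)\<close>, holomorphic across \<open>a k\<close>.\<close>

definition Q :: "nat set \<Rightarrow> nat \<Rightarrow> complex \<Rightarrow> complex" where
  "Q J k z = (if a k = 0 then 1 else - of_real (cmod (a k)) / a k) * P (J - {k}) z / (1 - cnj (a k) * z)"

lemma P_eq_Q: "cmod z < 1 \<Longrightarrow> k \<in> J \<Longrightarrow> P J z = (z - a k) * Q J k z"
  using P_remove[of z k J] one_minus_cnj_mult_nonzero[OF a_less_1[of k], of z]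
  by (auto simp: Q_def blaschke_factor_def field_simps)

lemma holomorphic_Q: "Q J k holomorphic_on ball 0 1"
  unfolding Q_def[abs_def]
  by (intro holomorphic_intros holomorphic_P) (auto simp: cnj_mult_neq_1 a_less_1)

lemma cmod_Q: "cmod (Q J k z) = cmod (P (J - {k}) z) / cmod (1 - cnj (a k) * z)"
  by (auto simp: Q_def norm_mult norm_divide)

lemma deriv_P:
  assumes "k \<in> J"
  shows "deriv (P J) (a k) = Q J k (a k)"
proof -
  have a: "a k \<in> ball 0 1" using a_less_1 by simp
  have "(Q J k has_field_derivative deriv (Q J k) (a k)) (at (a k))"
    using holomorphic_Q a holomorphic_derivI open_ball by blast
  then have "((\<lambda>z. (z - a k) * Q J k z) has_field_derivative Q J k (a k)) (at (a k))"
    by (auto intro!: derivative_eq_intros)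
  then have "(P J has_field_derivative Q J k (a k)) (at (a k))"
    by (rule has_field_derivative_transform_within_open[OF _ open_ball a]) (use P_eq_Q[OF _ assms] in auto)
  then show ?thesis by (rule DERIV_imp_deriv)
qed

text \<open>Converts the derivative in the interpolation condition into the modulus of the product
  of the remaining factors, the form in which separation is used.\<close>

lemma cmod_deriv_P:
  assumes "k \<in> J"
  shows "cmod (deriv (P J) (a k)) * (1 - (cmod (a k))\<^sup>2) = cmod (P (J - {k}) (a k))"
proof -
  have "1 - cnj (a k) * a k = of_real (1 - (cmod (a k))\<^sup>2)"
    using complex_norm_square[of "a k"] by (simp add: mult.commute)
  then have "cmod (1 - cnj (a k) * a k) = 1 - (cmod (a k))\<^sup>2"
    using one_minus_sq_pos[of k] by (simp del: of_real_diff)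
  then show ?thesis using one_minus_sq_pos[of k] by (simp add: deriv_P[OF assms] cmod_Q)
qed

lemma P_finite_continuous: "finite J \<Longrightarrow> continuous_on (cball 0 1) (P J)"
  by (subst continuous_on_cong[OF refl blaschke_part_finite], assumption)
     (intro continuous_intros continuous_on_blaschke_factor a_less_1)

lemma cmod_P_finite_sphere: "finite J \<Longrightarrow> cmod z = 1 \<Longrightarrow> cmod (P J z) = 1"
  by (simp add: blaschke_part_finite prod_norm[symmetric] cmod_blaschke_factor_sphere a_less_1)

text \<open>In a fixed smaller disc all but finitely many factors are uniformly close to 1 in
  modulus; infinitely many conditions on the factors thus reduce to finitely many there.\<close>

lemma factors_near_1:
  assumes "R < 1" "c < 1"
  shows "\<exists>K. \<forall>k\<ge>K. \<forall>z. cmod z \<le> R \<longrightarrow> c < cmod (blaschke_factor (a k) z)"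
proof -
  have "(\<lambda>j. 2 / (1 - R) * (1 - cmod (a j))) \<longlonglongrightarrow> 0"
    by (intro summable_LIMSEQ_zero summable_mult summable_a)
  then have "eventually (\<lambda>j. 2 / (1 - R) * (1 - cmod (a j)) < 1 - c) sequentially"
    by (rule order_tendstoD) (use assms in auto)
  then obtain K where K: "\<And>j. j \<ge> K \<Longrightarrow> 2 / (1 - R) * (1 - cmod (a j)) < 1 - c"
    by (auto simp: eventually_sequentially)
  have "c < cmod (blaschke_factor (a k) z)" if "k \<ge> K" "cmod z \<le> R" for k z
    using K[OF that(1)] blaschke_factor_minus_1_le[OF a_less_1 that(2) assms(1), of k]
      norm_triangle_ineq2[of 1 "1 - blaschke_factor (a k) z"]
    by (simp add: norm_minus_commute)
  then show ?thesis by blast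
qed

end

section \<open>Uniformly separated zeros\<close>

text \<open>Composition with the involution \<open>\<mu>\<close>, which exchanges \<open>a\<close>
  and 0, reduces the claim to the Schwarz lemma. Dividing the difference by 3 instead of 2 makes it
  strictly smaller than 1, as that lemma demands.\<close>

lemma Schwarz_Pick_weak:
  assumes F: "F holomorphic_on ball 0 1" "\<And>z. cmod z < 1 \<Longrightarrow> cmod (F z) \<le> 1"
    and a: "cmod a < 1" and z: "cmod z < 1"
  shows "cmod (F z - F a) \<le> 3 * cmod (blaschke_factor a z)"
proof -
  define \<mu> where "\<mu> u = (a - u) / (1 - cnj a * u)" for u
  have norm\<mu>: "cmod (\<mu> u) = cmod (blaschke_factor a u)" for u
    by (simp add: \<mu>_def cmod_blaschke_factor norm_divide)
  have \<mu>1: "cmod (\<mu> u) < 1" if "cmod u < 1" for u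
  proof -
    have "0 < (1 - (cmod a)\<^sup>2) * (1 - (cmod u)\<^sup>2) / (cmod (1 - cnj a * u))\<^sup>2"
      using a that one_minus_cnj_mult_nonzero[OF a, of u]
      by (intro divide_pos_pos mult_pos_pos) (auto simp: abs_square_less_1)
    then have "(cmod (blaschke_factor a u))\<^sup>2 < 1"
      using one_minus_blaschke_factor_sq[OF a, of u] that by simp
    then show ?thesis by (simp add: norm\<mu> abs_square_less_1)
  qed
  define G where "G u = (F (\<mu> u) - F a) / 3" for u
  have "\<mu> holomorphic_on ball 0 1"
    unfolding \<mu>_def[abs_def] by (intro holomorphic_intros) (auto simp: cnj_mult_neq_1 a)
  then have "(F \<circ> \<mu>) holomorphic_on ball 0 1"
    using \<mu>1 by (intro holomorphic_on_compose_gen[OF _ F(1)]) auto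
  then have "G holomorphic_on ball 0 1"
    unfolding G_def[abs_def] by (intro holomorphic_intros) (simp_all add: o_def)
  moreover have "G 0 = 0" by (simp add: G_def \<mu>_def)
  moreover have "cmod (G u) < 1" if "cmod u < 1" for u
    using norm_triangle_ineq4[of "F (\<mu> u)" "F a"] F(2)[OF \<mu>1[OF that]] F(2)[OF a]
    by (simp add: G_def norm_divide)
  ultimately have "cmod (G (\<mu> z)) \<le> cmod (\<mu> z)"
    by (rule Schwarz_Lemma(1)) (use \<mu>1 z in auto)
  moreover have "\<mu> (\<mu> z) = z"
  proof -
    have ne: "1 - cnj a * z \<noteq> 0" "1 - cnj a * a \<noteq> 0"
      using one_minus_cnj_mult_nonzero[OF a, of z] one_minus_cnj_mult_nonzero[OF a, of a] a z by auto
    have "a - \<mu> z = z * (1 - cnj a * a) / (1 - cnj a * z)"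
      "1 - cnj a * \<mu> z = (1 - cnj a * a) / (1 - cnj a * z)"
      using ne(1) by (simp_all add: \<mu>_def divide_simps) (simp_all add: algebra_simps)
    then show ?thesis using ne unfolding \<mu>_def[of "\<mu> z"] by simp
  qed
  ultimately show ?thesis by (simp add: G_def norm\<mu> norm_divide)
qed

lemma one_minus_sq_le_ln: "0 < x \<Longrightarrow> 1 - x\<^sup>2 \<le> - 2 * ln x" for x :: real
  using ln_le_minus_one[of "x\<^sup>2"] by (simp add: ln_realpow)

locale interpolating = blaschke +
  fixes \<delta> :: real
  assumes \<delta>: "0 < \<delta>" and separated: "\<delta> \<le> cmod (blaschke_part a (- {k}) (a k))"
begin

text \<open>By \<open>Schwarz_Pick_weak\<close> the product of the factors other than
  \<open>b k\<close> differs from its value at \<open>a k\<close> by at most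
  \<open>3 * \<eta> = \<delta> / 2\<close> where \<open>cmod (b k z) \<le> \<eta>\<close>, so it
  keeps modulus at least \<open>\<delta> / 2\<close> there. The product \<open>\<epsilon>\<close> is
  the resulting lower bound for \<open>|B|\<close> where
  \<open>cmod (b k z) = \<eta>\<close>.\<close>

definition "\<eta> = \<delta> / 6"
definition "\<epsilon> = \<eta> * (\<delta> / 2)"

abbreviation "b k \<equiv> blaschke_factor (a k)"

definition "\<Omega> = {z. cmod z < 1 \<and> (\<forall>k. \<eta> \<le> cmod (b k z))}"

lemma \<delta>_le_1: "\<delta> \<le> 1"
  using separated[of 0] cmod_P_le_1[OF a_less_1, of "- {0}" 0] by linarith

lemma \<eta>: "0 < \<eta>" "\<eta> \<le> 1 / 6" "\<eta> < \<delta> / 2"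
  using \<delta> \<delta>_le_1 by (auto simp: \<eta>_def)

lemma \<epsilon>: "0 < \<epsilon>" "\<epsilon> \<le> 1"
  using \<eta> \<delta> \<delta>_le_1 mult_mono[of \<eta> 1 "\<delta> / 2" 1] by (auto simp: \<epsilon>_def)

lemma inj_a: "a i = a j \<Longrightarrow> i = j"
proof (rule ccontr)
  assume "a i = a j" "i \<noteq> j"
  then have "P (- {j}) (a j) = 0" using P_zero[of i "- {j}"] by simp
  then show False using separated[of j] \<delta> by simp
qed

lemma near_zero:
  assumes z: "cmod z < 1" "cmod (b k z) \<le> \<eta>"
  shows "\<delta> / 2 \<le> cmod (P (- {k}) z)"
proof -
  have "cmod (P (- {k}) z - P (- {k}) (a k)) \<le> 3 * cmod (b k z)"
    by (intro Schwarz_Pick_weak holomorphic_P cmod_P_le_1 a_less_1 z)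
  also have "\<dots> \<le> \<delta> / 2" using z by (simp add: \<eta>_def)
  finally show ?thesis
    using separated[of k] norm_triangle_ineq2[of "P (- {k}) (a k)" "P (- {k}) z"]
    by (simp add: norm_minus_commute)
qed

text \<open>By \<open>near_zero\<close> every other factor has modulus at least
  \<open>\<delta> / 2\<close>, hence more than \<open>\<eta>\<close>: different discs stay
  apart.\<close>

lemma boundary_in_\<Omega>:
  assumes z: "cmod z < 1" "cmod (b k z) = \<eta>"
  shows "z \<in> \<Omega>"
proof -
  have "\<eta> \<le> cmod (b j z)" if "j \<noteq> k" for j
  proof -
    have "\<delta> / 2 \<le> cmod (P {j} z)"
      using near_zero[of z k] z cmod_P_antimono[OF z(1), of "{j}" "- {k}"] that by auto
    then show ?thesis using \<eta> by (simp add: blaschke_part_finite)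
  qed
  then show ?thesis using z unfolding \<Omega>_def by force
qed

text \<open>Two instances matter: finitely many discs with \<open>R = 1\<close>, where finite
  products are continuous up to the circle, and all discs with \<open>R < 1\<close>, where only
  finitely many of them can be met.\<close>

definition region :: "nat set \<Rightarrow> real \<Rightarrow> complex set" where
  "region K R = {z. cmod z \<le> R \<and> (\<forall>k\<in>K. \<eta> \<le> cmod (b k z))}"

lemma closed_region:
  assumes "R \<le> 1"
  shows "closed (region K R)"
proof -
  have "closed (cball 0 1 \<inter> (\<lambda>z. cmod (b k z)) -` {\<eta>..})" for k
    by (intro continuous_closed_preimage continuous_intros continuous_on_blaschke_factor a_less_1) auto
  then have "closed (cball 0 R \<inter> (\<Inter>k\<in>K. cball 0 1 \<inter> (\<lambda>z. cmod (b k z)) -` {\<eta>..}))"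
    by (intro closed_Int closed_INT) auto
  also have "cball 0 R \<inter> (\<Inter>k\<in>K. cball 0 1 \<inter> (\<lambda>z. cmod (b k z)) -` {\<eta>..}) = region K R"
    using assms by (auto simp: region_def)
  finally show ?thesis .
qed

text \<open>An infinite intersection of open conditions need not be open. The indices outside the
  finite set \<open>K'\<close> satisfy their condition on the whole disc of radius \<open>R\<close>,
  so only those in \<open>K'\<close> have to be intersected.\<close>

lemma interior_region:
  assumes R: "R \<le> 1" and K': "finite K'" "K' \<subseteq> K" "\<And>k w. k \<in> K - K' \<Longrightarrow> cmod w \<le> R \<Longrightarrow> \<eta> < cmod (b k w)"
    and z: "cmod z < R" "\<And>k. k \<in> K \<Longrightarrow> \<eta> < cmod (b k z)"
  shows "z \<in> interior (region K R)"
proof -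
  define U where "U = ball 0 R \<inter> (\<Inter>k\<in>K'. ball 0 1 \<inter> (\<lambda>z. cmod (b k z)) -` {\<eta><..})"
  have "open (ball 0 1 \<inter> (\<lambda>z. cmod (b k z)) -` {\<eta><..})" for k
    by (intro continuous_open_preimage continuous_intros continuous_on_subset[OF continuous_on_blaschke_factor] a_less_1) auto
  then have "open U" unfolding U_def using K'(1) by (intro open_Int open_INT) auto
  moreover have "U \<subseteq> region K R"
  proof
    fix w assume w: "w \<in> U"
    have "\<eta> \<le> cmod (b k w)" if "k \<in> K" for k
    proof (cases "k \<in> K'")
      case True
      then have "w \<in> ball 0 1 \<inter> (\<lambda>z. cmod (b k z)) -` {\<eta><..}"
        using w unfolding U_def by blast
      then show ?thesis by simp
    next
      case False
      then show ?thesis using w K'(3)[of k w] that by (auto simp: U_def)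
    qed
    then show "w \<in> region K R" using w by (auto simp: region_def U_def)
  qed
  moreover have "z \<in> U" using z R K'(2) by (auto simp: U_def)
  ultimately show ?thesis by (metis interior_maximal subsetD)
qed

lemma frontier_region:
  assumes R: "R \<le> 1" and K': "finite K'" "K' \<subseteq> K" "\<And>k w. k \<in> K - K' \<Longrightarrow> cmod w \<le> R \<Longrightarrow> \<eta> < cmod (b k w)"
    and z: "z \<in> frontier (region K R)"
  shows "z \<in> region K R" "cmod z = R \<or> (\<exists>k\<in>K. cmod (b k z) = \<eta>)"
proof -
  show zr: "z \<in> region K R"
    using frontier_subset_closed[OF closed_region[OF R]] z by blast
  show "cmod z = R \<or> (\<exists>k\<in>K. cmod (b k z) = \<eta>)"
  proof (rule ccontr)
    assume "\<not> ?thesis"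
    then have "cmod z < R" "\<And>k. k \<in> K \<Longrightarrow> \<eta> < cmod (b k z)"
      using zr unfolding region_def by force+
    then have "z \<in> interior (region K R)" using interior_region[OF R K'] by blast
    then show False using z by (simp add: frontier_def)
  qed
qed

lemma bounded_region: "bounded (region K R)"
  by (rule bounded_subset[OF bounded_cball[of 0 R]]) (auto simp: region_def)

text \<open>Maximum principle for \<open>1 / P {..<n}\<close>: the product has modulus 1 on the unit
  circle, and on the boundary of a disc it is \<open>\<eta>\<close> times a product of modulus at
  least \<open>\<delta> / 2\<close>. The bound is independent of \<open>n\<close> and so passes to
  \<open>B\<close>.\<close>

lemma P_finite_ge:
  assumes z: "cmod z < 1" "\<And>k. k < n \<Longrightarrow> \<eta> \<le> cmod (b k z)"
  shows "\<epsilon> \<le> cmod (P {..<n} z)"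
proof -
  let ?S = "region {..<n} 1"
  have ne: "P {..<n} w \<noteq> 0" if "w \<in> ?S" for w
  proof
    assume "P {..<n} w = 0"
    then obtain k where "k < n" "b k w = 0" by (auto simp: blaschke_part_finite)
    then show False using that \<eta>(1) by (force simp: region_def)
  qed
  have "cmod (1 / P {..<n} z) \<le> 1 / \<epsilon>"
  proof (rule maximum_modulus_frontier[of "\<lambda>z. 1 / P {..<n} z" ?S])
    have "?S \<subseteq> cball 0 1" by (auto simp: region_def)
    from interior_mono[OF this] have "interior ?S \<subseteq> ball 0 1" by simp
    then show "(\<lambda>z. 1 / P {..<n} z) holomorphic_on interior ?S"
      using ne interior_subset[of ?S] by (intro holomorphic_intros holomorphic_on_subset[OF holomorphic_P]) auto
    have "closure ?S = ?S" by (simp add: closed_region)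
    then show "continuous_on (closure ?S) (\<lambda>z. 1 / P {..<n} z)"
      using ne by (intro continuous_intros continuous_on_subset[OF P_finite_continuous]) (auto simp: region_def)
    show "bounded ?S" by (rule bounded_region)
    show "z \<in> ?S" using z by (auto simp: region_def)
    fix w assume w: "w \<in> frontier ?S"
    have wS: "w \<in> ?S" and or: "cmod w = 1 \<or> (\<exists>k\<in>{..<n}. cmod (b k w) = \<eta>)"
      using frontier_region[of 1 "{..<n}" "{..<n}" w] w by auto
    have "\<epsilon> \<le> cmod (P {..<n} w)"
    proof (cases "cmod w = 1")
      case True
      then show ?thesis using \<epsilon> by (simp add: cmod_P_finite_sphere)
    next
      case False
      then obtain k where k: "k < n" "cmod (b k w) = \<eta>" using or by auto
      have w1: "cmod w < 1" using False wS by (simp add: region_def)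
      have "cmod (P {..<n} w) = \<eta> * cmod (P ({..<n} - {k}) w)"
        using P_remove[OF w1, of k "{..<n}"] k by (simp add: norm_mult)
      moreover have "\<delta> / 2 \<le> cmod (P ({..<n} - {k}) w)"
        using near_zero[OF w1, of k] k cmod_P_antimono[OF w1, of "{..<n} - {k}" "- {k}"] by auto
      ultimately show ?thesis using \<eta>(1) by (simp add: \<epsilon>_def mult_left_mono)
    qed
    then show "cmod (1 / P {..<n} w) \<le> 1 / \<epsilon>"
      using \<epsilon>(1) by (simp add: norm_divide frac_le)
  qed
  then have "1 / cmod (P {..<n} z) \<le> 1 / \<epsilon>" by (simp add: norm_divide)
  moreover have "P {..<n} z \<noteq> 0" using ne[of z] z by (auto simp: region_def)
  ultimately show ?thesis using \<epsilon>(1) by (simp add: field_simps)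
qed

lemma B_ge: "z \<in> \<Omega> \<Longrightarrow> \<epsilon> \<le> cmod (P UNIV z)"
  by (rule LIMSEQ_le_const[OF tendsto_norm[OF LIMSEQ_P[of z UNIV]]])
     (auto simp: \<Omega>_def intro!: exI[of _ 0] P_finite_ge)

lemma \<Omega>_not_a: "z \<in> \<Omega> \<Longrightarrow> z \<notin> range a"
proof
  assume "z \<in> \<Omega>" "z \<in> range a"
  then obtain k where "z = a k" "\<eta> \<le> cmod (b k z)" by (auto simp: \<Omega>_def)
  then show False using \<eta>(1) by (simp add: blaschke_factor_def)
qed

lemma ln_B_bounds:
  assumes "z \<in> \<Omega>"
  shows "0 \<le> - ln (cmod (P UNIV z))" "- ln (cmod (P UNIV z)) \<le> - ln \<epsilon>"
proof -
  have "\<epsilon> \<le> cmod (P UNIV z)" "cmod (P UNIV z) \<le> 1"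
    using B_ge[OF assms] cmod_P_le_1[of z] assms by (auto simp: \<Omega>_def)
  moreover from this have "0 < cmod (P UNIV z)" using \<epsilon>(1) by linarith
  ultimately show "0 \<le> - ln (cmod (P UNIV z))" "- ln (cmod (P UNIV z)) \<le> - ln \<epsilon>"
    using \<epsilon>(1) by (auto simp: ln_mono simp del: zero_less_norm_iff)
qed

section \<open>Kernel sums dominated by the logarithm of the product\<close>

text \<open>Here \<open>1 - (cmod (b j z))\<^sup>2\<close> equals the Poisson-type kernel
  \<open>(1 - |a j|\<^sup>2) (1 - |z|\<^sup>2) / |1 - cnj (a j) z|\<^sup>2\<close> whose sum over \<open>j\<close> expresses the
  Carleson condition.\<close>

lemma kernel_nonneg: "cmod z < 1 \<Longrightarrow> 0 \<le> 1 - (cmod (b j z))\<^sup>2"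
  using cmod_blaschke_factor_le_1[OF a_less_1, of z j] by (simp add: power_le_one)

text \<open>The inequality \<open>1 - x\<^sup>2 \<le> - 2 * ln x\<close> for each factor turns the
  sum into the logarithm of a product; passing from \<open>F\<close> to \<open>J\<close> only lowers
  the modulus of that product.\<close>

lemma kernel_sum_finite_le:
  assumes "cmod z < 1" "P J z \<noteq> 0" "finite F" "F \<subseteq> J"
  shows "(\<Sum>j\<in>F. 1 - (cmod (b j z))\<^sup>2) \<le> - 2 * ln (cmod (P J z))"
proof -
  have le: "cmod (P J z) \<le> cmod (P F z)" using assms by (intro cmod_P_antimono)
  then have "P F z \<noteq> 0" using assms(2) by auto
  then have pos: "0 < cmod (b j z)" if "j \<in> F" for j
    using that assms(3) by (auto simp: blaschke_part_finite)
  have "(\<Sum>j\<in>F. 1 - (cmod (b j z))\<^sup>2) \<le> (\<Sum>j\<in>F. - 2 * ln (cmod (b j z)))"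
    using pos by (intro sum_mono one_minus_sq_le_ln)
  also have "\<dots> = - 2 * ln (\<Prod>j\<in>F. cmod (b j z))"
    using pos assms(3) by (subst ln_prod) (auto simp: sum_distrib_left)
  also have "(\<Prod>j\<in>F. cmod (b j z)) = cmod (P F z)"
    using assms(3) by (simp add: blaschke_part_finite prod_norm)
  also have "- 2 * ln (cmod (P F z)) \<le> - 2 * ln (cmod (P J z))"
    using le assms(2) by (simp add: ln_mono)
  finally show ?thesis .
qed

lemma kernel_sum_le:
  assumes "cmod z < 1" "P UNIV z \<noteq> 0"
  shows "summable (\<lambda>j. 1 - (cmod (b j z))\<^sup>2)"
    and "(\<Sum>j. 1 - (cmod (b j z))\<^sup>2) \<le> - 2 * ln (cmod (P UNIV z))"
proof -
  have le: "(\<Sum>j<n. 1 - (cmod (b j z))\<^sup>2) \<le> - 2 * ln (cmod (P UNIV z))" for n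
    using assms by (intro kernel_sum_finite_le) auto
  show s: "summable (\<lambda>j. 1 - (cmod (b j z))\<^sup>2)"
    by (rule summableI_nonneg_bounded[OF kernel_nonneg[OF assms(1)] le])
  show "(\<Sum>j. 1 - (cmod (b j z))\<^sup>2) \<le> - 2 * ln (cmod (P UNIV z))"
    by (rule suminf_le_const[OF s le])
qed

text \<open>As \<open>B\<close> vanishes at \<open>a k\<close>, the term \<open>j = k\<close>, which
  equals 1, is split off; the separation constant controls the logarithm of the remaining
  product.\<close>

lemma kernel_sum_at_zero_le:
  shows "summable (\<lambda>j. 1 - (cmod (b j (a k)))\<^sup>2)"
    and "(\<Sum>j. 1 - (cmod (b j (a k)))\<^sup>2) \<le> 1 - 2 * ln \<delta>"
proof -
  have ne: "P (- {k}) (a k) \<noteq> 0" using separated[of k] \<delta> by auto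
  have le: "(\<Sum>j<n. 1 - (cmod (b j (a k)))\<^sup>2) \<le> 1 - 2 * ln \<delta>" for n
  proof -
    have "(\<Sum>j<n. 1 - (cmod (b j (a k)))\<^sup>2) \<le> (\<Sum>j\<in>insert k ({..<n} - {k}). 1 - (cmod (b j (a k)))\<^sup>2)"
      using kernel_nonneg[OF a_less_1] by (intro sum_mono2) auto
    also have "\<dots> \<le> 1 + (\<Sum>j\<in>{..<n} - {k}. 1 - (cmod (b j (a k)))\<^sup>2)"
      by (subst sum.insert) auto
    also have "\<dots> \<le> 1 - 2 * ln (cmod (P (- {k}) (a k)))"
      using kernel_sum_finite_le[OF a_less_1 ne, of "{..<n} - {k}"] by auto
    also have "\<dots> \<le> 1 - 2 * ln \<delta>" using separated[of k] \<delta> by (simp add: ln_mono)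
    finally show ?thesis .
  qed
  show s: "summable (\<lambda>j. 1 - (cmod (b j (a k)))\<^sup>2)"
    by (rule summableI_nonneg_bounded[OF kernel_nonneg[OF a_less_1] le])
  show "(\<Sum>j. 1 - (cmod (b j (a k)))\<^sup>2) \<le> 1 - 2 * ln \<delta>"
    by (rule suminf_le_const[OF s le])
qed

section \<open>A maximum principle for imaginary parts\<close>

lemma P_finite_near_sphere:
  assumes "finite J" "e > 0"
  shows "\<exists>R<1. \<forall>z. R \<le> cmod z \<longrightarrow> cmod z \<le> 1 \<longrightarrow> exp (- e) \<le> cmod (P J z)"
proof -
  have "uniformly_continuous_on (cball 0 1) (P J)"
    by (intro compact_uniformly_continuous P_finite_continuous assms) auto
  then obtain d where d: "d > 0" "\<And>x y. x \<in> cball 0 1 \<Longrightarrow> y \<in> cball 0 1 \<Longrightarrow> dist y x < d \<Longrightarrow> dist (P J y) (P J x) < 1 - exp (- e)"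
    using assms(2) unfolding uniformly_continuous_on_def by (metis diff_gt_0_iff_gt exp_less_one_iff neg_less_0_iff_less)
  define R where "R = max (1 / 2) (1 - d / 2)"
  have "exp (- e) \<le> cmod (P J z)" if z: "R \<le> cmod z" "cmod z \<le> 1" for z
  proof -
    have "1 / 2 \<le> cmod z" using z by (simp add: R_def)
    then have z0: "cmod z > 0" by linarith
    define s where "s = sgn z"
    have s: "cmod s = 1" using z0 by (simp add: s_def norm_sgn)
    have "z = of_real (cmod z) * s" using z0 by (simp add: s_def sgn_eq)
    then have "s - z = of_real (1 - cmod z) * s" by (simp add: algebra_simps)
    then have "cmod (s - z) = 1 - cmod z" using z s by (simp add: norm_mult del: of_real_diff)
    then have "dist z s < d" using z d(1) by (simp add: dist_norm norm_minus_commute R_def)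
    then have "dist (P J z) (P J s) < 1 - exp (- e)" using d(2)[of s z] z s by auto
    then show ?thesis
      using cmod_P_finite_sphere[OF assms(1) s] norm_triangle_ineq2[of "P J s" "P J z"]
      by (simp add: dist_norm norm_minus_commute)
  qed
  moreover have "R < 1" using d(1) by (simp add: R_def)
  ultimately show ?thesis by blast
qed

text \<open>The assumption \<open>Im \<Phi> \<le> - K * ln |B|\<close> says that \<open>Im \<Phi>\<close> vanishes on the unit circle in
  a weak sense. Near the circle only the tail \<open>P {n..}\<close> of \<open>B\<close> can be far from modulus 1, and
  multiplying by a power of it turns this into an honest boundary estimate.\<close>

lemma Im_maximum_principle:
  assumes \<Phi>: "\<Phi> holomorphic_on (ball 0 1 - range a)"
    and small: "\<And>z. z \<in> \<Omega> \<Longrightarrow> Im (\<Phi> z) \<le> K * (- ln (cmod (P UNIV z)))"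
    and bd: "\<And>z k. cmod z < 1 \<Longrightarrow> cmod (b k z) = \<eta> \<Longrightarrow> Im (\<Phi> z) \<le> m" and m: "0 \<le> m"
    and z0: "z0 \<in> \<Omega>"
  shows "Im (\<Phi> z0) \<le> m"
proof -
  \<comment> \<open>An integer exponent keeps the power of \<open>P {n..}\<close> holomorphic across
    its zeros.\<close>
  obtain N :: nat where N: "K \<le> real N" using real_arch_simple by blast
  have step: "exp (Im (\<Phi> z0)) * cmod (P {n..} z0) ^ N \<le> exp (max m (real N * e))" if e: "e > 0" for e n
  proof -
    obtain R0 where R0: "R0 < 1" "\<And>z. R0 \<le> cmod z \<Longrightarrow> cmod z \<le> 1 \<Longrightarrow> exp (- e) \<le> cmod (P {..<n} z)"
      using P_finite_near_sphere[OF _ e, of "{..<n}"] by auto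
    define R where "R = max R0 ((1 + cmod z0) / 2)"
    have z01: "cmod z0 < 1" using z0 by (simp add: \<Omega>_def)
    have R: "R < 1" "R0 \<le> R" "cmod z0 < R" using R0(1) z01 by (auto simp: R_def less_max_iff_disj)
    let ?S = "region UNIV R"
    have S\<Omega>: "?S \<subseteq> \<Omega>" using R(1) by (auto simp: region_def \<Omega>_def)
    have S: "?S \<subseteq> ball 0 1 - range a"
    proof
      fix w assume "w \<in> ?S"
      then have "w \<in> \<Omega>" using S\<Omega> by blast
      then show "w \<in> ball 0 1 - range a" using \<Omega>_not_a[of w] by (simp add: \<Omega>_def)
    qed
    \<comment> \<open>On \<open>|w| = R\<close>, off the disc boundaries, the hypothesis gives
      \<open>exp (Im (\<Phi> w)) \<le> (1 / |B|) ^ N\<close>. Splitting \<open>B\<close> at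
      \<open>n\<close>, the power of the tail cancels and
      \<open>(1 / |P {..<n}|) ^ N \<le> exp (N * e)\<close> remains.\<close>
    define g where "g z = exp (- \<i> * \<Phi> z) * P {n..} z ^ N" for z
    have g: "g holomorphic_on (ball 0 1 - range a)"
      unfolding g_def by (intro holomorphic_intros \<Phi> holomorphic_on_subset[OF holomorphic_P]) auto
    have norm_g: "cmod (g z) = exp (Im (\<Phi> z)) * cmod (P {n..} z) ^ N" for z
      by (simp add: g_def norm_mult norm_power)
    have "cmod (g z0) \<le> exp (max m (real N * e))"
    proof (rule maximum_modulus_frontier[of g ?S])
      show "g holomorphic_on interior ?S"
        using S interior_subset by (intro holomorphic_on_subset[OF g]) blast
      have "closure ?S = ?S" using R by (simp add: closed_region)
      then show "continuous_on (closure ?S) g"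
        using S by (intro holomorphic_on_imp_continuous_on holomorphic_on_subset[OF g]) simp
      show "bounded ?S" by (rule bounded_region)
      show "z0 \<in> ?S" using z0 R by (auto simp: region_def \<Omega>_def)
      fix w assume w: "w \<in> frontier ?S"
      obtain K0 where K0: "\<And>k z. k \<ge> K0 \<Longrightarrow> cmod z \<le> R \<Longrightarrow> \<eta> < cmod (b k z)"
        using factors_near_1[OF R(1), of \<eta>] \<eta>(2) by auto
      have wS: "w \<in> ?S" and or: "cmod w = R \<or> (\<exists>k\<in>UNIV. cmod (b k w) = \<eta>)"
        using frontier_region[of R "{..<K0}" UNIV w] R K0 w by auto
      have w1: "cmod w < 1" using wS R by (simp add: region_def)
      show "cmod (g w) \<le> exp (max m (real N * e))"
      proof (cases "\<exists>k. cmod (b k w) = \<eta>")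
        case True
        then have "Im (\<Phi> w) \<le> m" using bd[OF w1] by blast
        moreover have "cmod (P {n..} w) ^ N \<le> 1" using cmod_P_le_1[OF w1] by (simp add: power_le_one)
        ultimately have "cmod (g w) \<le> exp m * 1" unfolding norm_g by (intro mult_mono) auto
        then show ?thesis by (simp add: order_trans)
      next
        case False
        then have "cmod w = R" using or by auto
        then have 1: "exp (- e) \<le> cmod (P {..<n} w)" using R0(2)[of w] R by simp
        have w\<Omega>: "w \<in> \<Omega>" using wS S\<Omega> by blast
        have Bpos: "0 < cmod (P UNIV w)" using B_ge[OF w\<Omega>] \<epsilon>(1) by linarith
        have "{..<n} \<union> {n..} = UNIV" by auto
        then have B: "P UNIV w = P {..<n} w * P {n..} w"
          using P_Un[OF w1, of "{..<n}" "{n..}"] by (simp add: disjoint_iff)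
        have "ln (cmod (P UNIV w)) \<le> 0" using cmod_P_le_1[OF w1] Bpos by simp
        then have "K * (- ln (cmod (P UNIV w))) \<le> real N * (- ln (cmod (P UNIV w)))"
          using N by (intro mult_right_mono) auto
        then have "exp (Im (\<Phi> w)) \<le> exp (real N * (- ln (cmod (P UNIV w))))"
          using small[OF w\<Omega>] by simp
        also have "\<dots> = (1 / cmod (P UNIV w)) ^ N"
          using Bpos by (simp add: exp_of_nat_mult exp_minus inverse_eq_divide power_one_over)
        finally have "cmod (g w) \<le> (1 / cmod (P UNIV w)) ^ N * cmod (P {n..} w) ^ N"
          unfolding norm_g by (intro mult_right_mono) auto
        also have "\<dots> = (1 / cmod (P {..<n} w)) ^ N"
        proof -
          have "P {n..} w \<noteq> 0" using Bpos by (auto simp: B)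
          then show ?thesis by (simp add: B norm_mult flip: power_mult_distrib)
        qed
        also have "\<dots> \<le> (1 / exp (- e)) ^ N"
          using 1 less_le_trans[OF exp_gt_zero 1]
          by (intro power_mono divide_left_mono mult_pos_pos) auto
        also have "\<dots> = exp (real N * e)" by (simp add: exp_of_nat_mult exp_minus inverse_eq_divide)
        also have "\<dots> \<le> exp (max m (real N * e))" by simp
        finally show ?thesis .
      qed
    qed
    then show ?thesis by (simp add: norm_g)
  qed
  \<comment> \<open>At the fixed point \<open>z0\<close> the tail tends to 1, so the auxiliary
    factor disappears; only afterwards is \<open>e\<close> chosen small.\<close>
  have "(\<lambda>n. exp (Im (\<Phi> z0)) * cmod (P {n..} z0) ^ N) \<longlonglongrightarrow> exp (Im (\<Phi> z0)) * cmod 1 ^ N"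
    using z0 by (intro tendsto_intros P_tail_tendsto_1) (simp add: \<Omega>_def)
  then have le: "exp (Im (\<Phi> z0)) \<le> exp (max m (real N * e))" if "e > 0" for e
    using step[OF that] by (intro LIMSEQ_le_const2[where X = "\<lambda>n. exp (Im (\<Phi> z0)) * cmod (P {n..} z0) ^ N"]) auto
  show ?thesis
  proof (rule ccontr)
    assume "\<not> ?thesis"
    then have *: "Im (\<Phi> z0) > m" by simp
    define e where "e = Im (\<Phi> z0) / (2 * (real N + 1))"
    have "e > 0" using * m by (simp add: e_def)
    moreover have "real N * e < Im (\<Phi> z0)"
    proof -
      have "real N * e = Im (\<Phi> z0) * (real N / (2 * (real N + 1)))" by (simp add: e_def)
      also have "\<dots> < Im (\<Phi> z0) * 1" using * m by (intro mult_strict_left_mono) auto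
      finally show ?thesis by simp
    qed
    ultimately show False using le[of e] * by simp
  qed
qed

end

section \<open>Reflection across the circle\<close>

context interpolating
begin

lemma abs_exp_neg_sq_le: "1 \<le> \<kappa> \<Longrightarrow> \<bar>t\<bar> * exp (- \<kappa> * t\<^sup>2) \<le> 1" for t \<kappa> :: real
proof -
  assume \<kappa>: "1 \<le> \<kappa>"
  have "\<bar>t\<bar> \<le> 1 + t\<^sup>2" using sum_power2_ge_zero[of "\<bar>t\<bar> - 1" 0] by (simp add: power2_eq_square algebra_simps)
  also have "\<dots> \<le> exp (t\<^sup>2)" by (rule exp_ge_add_one_self)
  also have "\<dots> \<le> exp (\<kappa> * t\<^sup>2)" using \<kappa> mult_right_mono[of 1 \<kappa> "t\<^sup>2"] by simp
  finally show ?thesis by (simp add: exp_minus field_simps)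
qed

text \<open>If \<open>Im p\<close> is small in the above sense then \<open>p\<close> takes real values wherever its real
  part exceeds its boundary size: otherwise a Gaussian centred near \<open>Re (p z0)\<close>, which is
  tiny on the boundary values of \<open>p\<close>, would violate the maximum principle.\<close>

lemma real_where_large:
  assumes p: "p holomorphic_on (ball 0 1 - range a)"
    and small: "\<And>z. z \<in> \<Omega> \<Longrightarrow> \<bar>Im (p z)\<bar> \<le> K * (- ln (cmod (P UNIV z)))"
    and bd: "\<And>z k. cmod z < 1 \<Longrightarrow> cmod (b k z) = \<eta> \<Longrightarrow> cmod (p z) \<le> M" and M: "0 \<le> M"
    and z0: "z0 \<in> \<Omega>" "Re (p z0) > 2 * M + 1"
  shows "Im (p z0) = 0"
proof (rule ccontr)
  define x0 y0 where "x0 = Re (p z0)" and "y0 = Im (p z0)"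
  assume "Im (p z0) \<noteq> 0"
  then have y0: "\<bar>y0\<bar> > 0" by (simp add: y0_def)
  have x0: "x0 > 2 * M + 1" using z0 by (simp add: x0_def)
  define c where "c = pi / (4 * \<bar>y0\<bar>)"
  have c: "c > 0" using y0 by (simp add: c_def)
  \<comment> \<open>The part \<open>1 + c\<close> keeps the shift \<open>c / \<kappa>\<close> of the
    centre below 1; the last summand keeps the shifted centre \<open>x1\<close> at or to the right
    of \<open>2 * M + 1\<close>.\<close>
  define \<kappa> where "\<kappa> = 1 + c + c / (x0 - (2 * M + 1))"
  have \<kappa>: "1 \<le> \<kappa>" "c < \<kappa>" "c \<le> \<kappa> * (x0 - (2 * M + 1))"
  proof -
    have D: "x0 - (2 * M + 1) > 0" using x0 by simp
    then have pos: "0 < c / (x0 - (2 * M + 1))" using c by (intro divide_pos_pos)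
    show "1 \<le> \<kappa>" "c < \<kappa>" using c pos by (auto simp: \<kappa>_def)
    have "\<kappa> * (x0 - (2 * M + 1)) = (1 + c) * (x0 - (2 * M + 1)) + c"
      using D unfolding \<kappa>_def distrib_right by simp
    moreover have "0 \<le> (1 + c) * (x0 - (2 * M + 1))" using D c by (intro mult_nonneg_nonneg) auto
    ultimately show "c \<le> \<kappa> * (x0 - (2 * M + 1))" by linarith
  qed
  \<comment> \<open>With this centre the phase \<open>- 2 * \<kappa> * (x0 - x1) * y0\<close> at
    \<open>z0\<close> is \<open>pi / 2\<close>, so the sine in \<open>Im (\<Phi> z0)\<close> attains
    the value 1.\<close>
  define x1 where "x1 = x0 + pi / (4 * \<kappa> * y0)"
  have dx: "\<bar>x1 - x0\<bar> = c / \<kappa>" using \<kappa> by (simp add: x1_def c_def abs_mult abs_divide)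
  also have "c / \<kappa> \<le> x0 - (2 * M + 1)" using \<kappa> by (simp add: field_simps)
  finally have x1: "x1 \<ge> 2 * M + 1" by linarith
  define K' where "K' = max K 0"
  have K': "0 \<le> K'" "K \<le> K'" by (auto simp: K'_def)
  define M0 where "M0 = K' * (- ln \<epsilon>)"
  have Im_le: "\<bar>Im (p z)\<bar> \<le> K' * (- ln (cmod (P UNIV z)))" "\<bar>Im (p z)\<bar> \<le> M0" if z: "z \<in> \<Omega>" for z
  proof -
    note l = ln_B_bounds[OF z]
    show 1: "\<bar>Im (p z)\<bar> \<le> K' * (- ln (cmod (P UNIV z)))"
      using small[OF z] mult_right_mono[OF K'(2) l(1)] by linarith
    show "\<bar>Im (p z)\<bar> \<le> M0"
      using 1 mult_left_mono[OF l(2) K'(1)] unfolding M0_def by linarith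
  qed
  define \<Phi> where "\<Phi> z = exp (- of_real \<kappa> * (p z - of_real x1)\<^sup>2)" for z
  have Im\<Phi>: "Im (\<Phi> z) = exp (- \<kappa> * (Re (p z) - x1)\<^sup>2) * exp (\<kappa> * (Im (p z))\<^sup>2)
      * sin (- 2 * \<kappa> * (Re (p z) - x1) * Im (p z))" for z
    by (simp add: \<Phi>_def Im_exp power2_eq_square algebra_simps flip: exp_add)
  have "Im (\<Phi> z0) \<le> exp (- \<kappa> * (2 * M + 1))"
  proof (rule Im_maximum_principle[of \<Phi> "exp (\<kappa> * M0\<^sup>2) * (2 * \<kappa>) * K'"])
    show "\<Phi> holomorphic_on (ball 0 1 - range a)"
      unfolding \<Phi>_def by (intro holomorphic_intros p)
    show "z0 \<in> \<Omega>" by fact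
    \<comment> \<open>The inequality \<open>|sin s| \<le> |s|\<close> brings out the factor
      \<open>|Im (p z)|\<close>, and the Gaussian absorbs the factor \<open>|t|\<close>, which is
      not known to be bounded.\<close>
    show "Im (\<Phi> z) \<le> exp (\<kappa> * M0\<^sup>2) * (2 * \<kappa>) * K' * (- ln (cmod (P UNIV z)))" if z: "z \<in> \<Omega>" for z
    proof -
      define t y where "t = Re (p z) - x1" and "y = Im (p z)"
      have "Im (\<Phi> z) \<le> exp (- \<kappa> * t\<^sup>2) * exp (\<kappa> * y\<^sup>2) * \<bar>sin (- 2 * \<kappa> * t * y)\<bar>"
        unfolding Im\<Phi> t_def y_def by (intro mult_left_mono) auto
      also have "\<dots> \<le> exp (- \<kappa> * t\<^sup>2) * exp (\<kappa> * M0\<^sup>2) * \<bar>- 2 * \<kappa> * t * y\<bar>"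
        using Im_le(2)[OF z] \<kappa> abs_sin_x_le_abs_x[of "- 2 * \<kappa> * t * y"]
        by (intro mult_mono mult_nonneg_nonneg) (auto simp: y_def abs_le_square_iff[symmetric])
      also have "\<dots> = exp (\<kappa> * M0\<^sup>2) * (2 * \<kappa>) * ((\<bar>t\<bar> * exp (- \<kappa> * t\<^sup>2)) * \<bar>y\<bar>)"
        using \<kappa> by (simp add: abs_mult)
      also have "\<dots> \<le> exp (\<kappa> * M0\<^sup>2) * (2 * \<kappa>) * (1 * (K' * (- ln (cmod (P UNIV z)))))"
        using Im_le(1)[OF z] \<kappa> abs_exp_neg_sq_le[of \<kappa> t]
        by (intro mult_left_mono mult_mono) (auto simp: y_def)
      finally show ?thesis by (simp add: mult_ac)
    qed
    show "Im (\<Phi> z) \<le> exp (- \<kappa> * (2 * M + 1))" if z: "cmod z < 1" "cmod (b k z) = \<eta>" for z k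
    proof -
      have x: "\<bar>Re (p z)\<bar> \<le> M" and y: "\<bar>Im (p z)\<bar> \<le> M"
        using bd[OF z] abs_Re_le_cmod[of "p z"] abs_Im_le_cmod[of "p z"] by linarith+
      \<comment> \<open>The centre is at distance at least \<open>M + 1\<close> from
        \<open>Re (p z)\<close> while \<open>|Im (p z)| \<le> M\<close>; the exponent is then at
        least \<open>\<kappa>\<close> times
        \<open>(M + 1)\<^sup>2 - M\<^sup>2 = 2 * M + 1\<close>.\<close>
      have "(M + 1)\<^sup>2 \<le> (x1 - Re (p z))\<^sup>2" using x x1 M by (intro power_mono) auto
      moreover have "(Im (p z))\<^sup>2 \<le> M\<^sup>2" using y M by (simp add: abs_le_square_iff[symmetric])
      ultimately have "2 * M + 1 \<le> (Re (p z) - x1)\<^sup>2 - (Im (p z))\<^sup>2"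
        by (simp add: power2_commute[of _ x1]) (simp add: power2_eq_square algebra_simps)
      then have le: "\<kappa> * (2 * M + 1) \<le> \<kappa> * ((Re (p z) - x1)\<^sup>2 - (Im (p z))\<^sup>2)"
        using \<kappa> by (intro mult_left_mono) auto
      have "Im (\<Phi> z) \<le> exp (- \<kappa> * (Re (p z) - x1)\<^sup>2) * exp (\<kappa> * (Im (p z))\<^sup>2) * 1"
        unfolding Im\<Phi> by (intro mult_left_mono) auto
      also have "\<dots> = exp (- (\<kappa> * ((Re (p z) - x1)\<^sup>2 - (Im (p z))\<^sup>2)))"
        by (simp add: algebra_simps flip: exp_add)
      also have "\<dots> \<le> exp (- \<kappa> * (2 * M + 1))" using le by simp
      finally show ?thesis .
    qed
  qed simp
  moreover have "Im (\<Phi> z0) \<ge> exp (- \<kappa> * (c / \<kappa>)\<^sup>2)"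
  proof -
    have "2 * \<kappa> * (x0 - x1) * y0 = - (pi / 2)" using y0 \<kappa> by (simp add: x1_def field_simps)
    then have s: "sin (2 * \<kappa> * (x0 - x1) * y0) = - 1" by simp
    have "Im (\<Phi> z0) = exp (- \<kappa> * (x0 - x1)\<^sup>2) * exp (\<kappa> * y0\<^sup>2)"
      using Im\<Phi>[of z0] s unfolding x0_def[symmetric] y0_def[symmetric] by simp
    also have "\<dots> \<ge> exp (- \<kappa> * (x0 - x1)\<^sup>2) * 1" using \<kappa> by (intro mult_left_mono) auto
    finally have "exp (- \<kappa> * (x0 - x1)\<^sup>2) \<le> Im (\<Phi> z0)" by simp
    moreover have "(x0 - x1)\<^sup>2 = (c / \<kappa>)\<^sup>2" using dx by (metis power2_abs power2_commute)
    ultimately show ?thesis by simp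
  qed
  ultimately have "exp (- \<kappa> * (c / \<kappa>)\<^sup>2) \<le> exp (- \<kappa> * (2 * M + 1))" by (rule order_trans[rotated])
  then have "\<kappa> * (2 * M + 1) \<le> \<kappa> * (c / \<kappa>)\<^sup>2" by simp
  then have "2 * M + 1 \<le> (c / \<kappa>)\<^sup>2" using \<kappa> by simp
  moreover have "(c / \<kappa>)\<^sup>2 < 1" using \<kappa> c by (simp add: abs_square_less_1)
  ultimately show False using M by linarith
qed

lemma closedin_\<Omega>: "closedin (top_of_set (ball 0 1)) \<Omega>"
proof -
  have "\<Omega> = ball 0 1 \<inter> region UNIV 1" by (auto simp: \<Omega>_def region_def)
  then show ?thesis using closed_region[of 1 UNIV] by (simp add: closedin_closed_Int)
qed

lemma interior_\<Omega>:
  assumes z: "cmod z < 1" "\<And>k. \<eta> < cmod (b k z)"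
  shows "\<exists>r>0. ball z r \<subseteq> \<Omega>"
proof -
  define R where "R = (1 + cmod z) / 2"
  have R: "R < 1" "cmod z < R" using z by (auto simp: R_def)
  obtain K0 where K0: "\<And>k z. k \<ge> K0 \<Longrightarrow> cmod z \<le> R \<Longrightarrow> \<eta> < cmod (b k z)"
    using factors_near_1[OF R(1), of \<eta>] \<eta>(2) by auto
  have "z \<in> interior (region UNIV R)"
    using interior_region[of R "{..<K0}" UNIV z] R K0 z by auto
  then obtain r where "r > 0" "ball z r \<subseteq> region UNIV R"
    by (meson mem_interior)
  moreover have "region UNIV R \<subseteq> \<Omega>" using R by (auto simp: region_def \<Omega>_def)
  ultimately show ?thesis by blast
qed

text \<open>The level set \<open>E\<close> of the value \<open>p z0\<close> is closed in the unit
  disc. It avoids the boundaries of the small discs, where \<open>|p| \<le> M\<close>, so its points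
  are interior to \<open>\<Omega>\<close>; nearby \<open>Re p\<close> is still large, hence
  \<open>p\<close> is real by \<open>real_where_large\<close> and locally constant by the open
  mapping theorem. By connectedness \<open>E\<close> is the whole disc, yet it misses
  \<open>a 0\<close>.\<close>

lemma Re_bounded:
  assumes p: "p holomorphic_on (ball 0 1 - range a)"
    and small: "\<And>z. z \<in> \<Omega> \<Longrightarrow> \<bar>Im (p z)\<bar> \<le> K * (- ln (cmod (P UNIV z)))"
    and bd: "\<And>z k. cmod z < 1 \<Longrightarrow> cmod (b k z) = \<eta> \<Longrightarrow> cmod (p z) \<le> M" and M: "0 \<le> M"
    and z0: "z0 \<in> \<Omega>"
  shows "Re (p z0) \<le> 2 * M + 1"
proof (rule ccontr)
  assume "\<not> ?thesis"
  then have large: "Re (p z0) > 2 * M + 1" by simp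
  have cont: "continuous_on \<Omega> p"
    using \<Omega>_not_a by (intro holomorphic_on_imp_continuous_on holomorphic_on_subset[OF p]) (auto simp: \<Omega>_def)
  define E where "E = \<Omega> \<inter> p -` {p z0}"
  have "closedin (top_of_set (ball 0 1)) E"
    unfolding E_def by (intro closedin_trans[OF continuous_closedin_preimage[OF cont] closedin_\<Omega>]) auto
  moreover have "open E"
    unfolding open_contains_ball
  proof
    fix z assume z: "z \<in> E"
    then have zp: "z \<in> \<Omega>" "p z = p z0" "cmod z < 1" by (auto simp: E_def \<Omega>_def)
    have "\<eta> < cmod (b k z)" for k
    proof (rule ccontr)
      assume "\<not> ?thesis"
      moreover have "\<eta> \<le> cmod (b k z)" using zp(1) by (simp add: \<Omega>_def)
      ultimately have "cmod (b k z) = \<eta>" by linarith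
      then have "cmod (p z) \<le> M" using bd zp by blast
      then show False using large zp complex_Re_le_cmod[of "p z"] M by simp
    qed
    then obtain r where r: "r > 0" "ball z r \<subseteq> \<Omega>" using interior_\<Omega> zp by blast
    have hol: "p holomorphic_on ball z r"
      using r(2) \<Omega>_not_a by (intro holomorphic_on_subset[OF p]) (auto simp: \<Omega>_def subset_iff)
    have "continuous_on (ball z r) (\<lambda>w. Re (p w))"
      by (intro continuous_intros holomorphic_on_imp_continuous_on hol)
    then have "open (ball z r \<inter> (\<lambda>w. Re (p w)) -` {2 * M + 1<..})"
      by (rule continuous_open_preimage) auto
    moreover have "z \<in> ball z r \<inter> (\<lambda>w. Re (p w)) -` {2 * M + 1<..}" using r large zp by simp
    ultimately obtain s where s: "s > 0" "ball z s \<subseteq> ball z r \<inter> (\<lambda>w. Re (p w)) -` {2 * M + 1<..}"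
      by (meson openE)
    have real: "Im (p w) = 0" if "w \<in> ball z s" for w
    proof -
      have "w \<in> \<Omega>" "Re (p w) > 2 * M + 1" using that s(2) r(2) by auto
      then show ?thesis using real_where_large[of p K M w] p small bd M by blast
    qed
    have "p constant_on ball z s"
    proof (rule ccontr)
      assume "\<not> p constant_on ball z s"
      then have "open (p ` ball z s)"
        using s hol by (intro open_mapping_thm[of p "ball z s"]) (auto intro: holomorphic_on_subset)
      moreover have "p z \<in> p ` ball z s" using s(1) by simp
      ultimately obtain t where t: "t > 0" "ball (p z) t \<subseteq> p ` ball z s" by (meson openE)
      have "p z + \<i> * of_real (t / 2) \<in> ball (p z) t" using t(1) by (simp add: dist_norm norm_mult)
      then obtain w where "w \<in> ball z s" "p w = p z + \<i> * of_real (t / 2)" using t(2) by force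
      then show False using real[of w] real[of z] s(1) t(1) by simp
    qed
    then have "p w = p z0" if "w \<in> ball z s" for w
      using that s(1) zp(2) unfolding constant_on_def by (metis centre_in_ball)
    then have "ball z s \<subseteq> E" using s(2) r(2) by (auto simp: E_def)
    then show "\<exists>r>0. ball z r \<subseteq> E" using s(1) by blast
  qed
  moreover have "E \<subseteq> ball 0 1" by (auto simp: E_def \<Omega>_def)
  ultimately have "E = {} \<or> E = ball 0 1"
    using connected_ball[of "0 :: complex" 1] unfolding connected_clopen by (metis open_subset)
  moreover have "z0 \<in> E" using z0 by (simp add: E_def)
  moreover have "a 0 \<in> ball 0 1" "a 0 \<notin> E"
    using a_less_1[of 0] \<Omega>_not_a[of "a 0"] by (auto simp: E_def)
  ultimately show False by blast
qed

lemma bounded_on_\<Omega>: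
  assumes p: "p holomorphic_on (ball 0 1 - range a)"
    and small: "\<And>z. z \<in> \<Omega> \<Longrightarrow> \<bar>Im (p z)\<bar> \<le> K * (- ln (cmod (P UNIV z)))"
    and bd: "\<And>z k. cmod z < 1 \<Longrightarrow> cmod (b k z) = \<eta> \<Longrightarrow> cmod (p z) \<le> M"
  shows "\<exists>C. \<forall>z\<in>\<Omega>. cmod (p z) \<le> C"
proof -
  define M' where "M' = max M 0"
  have bd': "\<And>z k. cmod z < 1 \<Longrightarrow> cmod (b k z) = \<eta> \<Longrightarrow> cmod (p z) \<le> M'"
    using bd by (force simp: M'_def)
  define K' where "K' = max K 0"
  have "cmod (p z) \<le> 2 * M' + 1 + K' * (- ln \<epsilon>)" if z: "z \<in> \<Omega>" for z
  proof -
    have "Re (p z) \<le> 2 * M' + 1"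
      using Re_bounded[of p K M' z] p small bd' z by (auto simp: M'_def)
    moreover have "Re (- p z) \<le> 2 * M' + 1"
    proof (rule Re_bounded[where p = "\<lambda>z. - p z", OF _ _ _ _ z])
      show "(\<lambda>z. - p z) holomorphic_on (ball 0 1 - range a)" by (intro holomorphic_intros p)
      show "\<bar>Im (- p z)\<bar> \<le> K * (- ln (cmod (P UNIV z)))" if "z \<in> \<Omega>" for z using small[OF that] by simp
      show "cmod (- p z) \<le> M'" if "cmod z < 1" "cmod (b k z) = \<eta>" for z k using bd'[OF that] by simp
    qed (simp add: M'_def)
    moreover have "\<bar>Im (p z)\<bar> \<le> K' * (- ln \<epsilon>)"
    proof -
      have "K * (- ln (cmod (P UNIV z))) \<le> K' * (- ln \<epsilon>)"
        using ln_B_bounds[OF z] by (intro mult_mono) (auto simp: K'_def)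
      then show ?thesis using small[OF z] by linarith
    qed
    ultimately show ?thesis using cmod_le[of "p z"] by simp
  qed
  then show ?thesis by blast
qed

end

section \<open>Sufficiency\<close>

lemma holomorphic_series:
  fixes f :: "nat \<Rightarrow> complex \<Rightarrow> complex"
  assumes hol: "\<And>j. f j holomorphic_on ball 0 1" and M: "summable M"
    and bound: "\<And>j z R. cmod z \<le> R \<Longrightarrow> R < 1 \<Longrightarrow> cmod (f j z) \<le> C R * M j"
  shows "(\<lambda>z. \<Sum>j. f j z) holomorphic_on ball 0 1"
proof (rule holomorphic_uniform_sequence)
  show "(\<lambda>z. \<Sum>j<n. f j z) holomorphic_on ball 0 1" for n
    by (intro holomorphic_intros hol)
next
  fix x :: complex assume x: "x \<in> ball 0 1"
  then obtain d R where dR: "0 < d" "R < 1" "cball x d \<subseteq> cball 0 R" "cball x d \<subseteq> ball 0 1"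
    by (rule cball_in_smaller_disc)
  have "cmod (f j y) \<le> C R * M j" if "y \<in> cball x d" for j y
    using subsetD[OF dR(3) that] by (intro bound dR(2)) simp
  then have "uniform_limit (cball x d) (\<lambda>n z. \<Sum>j<n. f j z) (\<lambda>z. \<Sum>j. f j z) sequentially"
    by (intro Weierstrass_m_test[where M = "\<lambda>j. C R * M j"] summable_mult M)
  then show "\<exists>d>0. cball x d \<subseteq> ball 0 1 \<and> uniform_limit (cball x d) (\<lambda>n z. \<Sum>j<n. f j z) (\<lambda>z. \<Sum>j. f j z) sequentially"
    using dR by blast
qed auto

lemma le_arith_mean_if_sq_le:
  fixes m p q :: real
  assumes "m\<^sup>2 \<le> p * q" "0 \<le> p" "0 \<le> q"
  shows "m \<le> (p + q) / 2"
proof (rule power2_le_imp_le)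
  have "p * q \<le> ((p + q) / 2)\<^sup>2"
    using sum_power2_ge_zero[of "p - q" 0] by (simp add: power2_eq_square field_simps)
  then show "m\<^sup>2 \<le> ((p + q) / 2)\<^sup>2" using assms(1) by linarith
qed (use assms in auto)

lemma radial_at_left: "eventually (\<lambda>r :: real. 0 < r \<and> r < 1) (at_left 1)"
  by (intro eventually_at_leftI[of 0]) auto

context interpolating
begin

abbreviation "A j \<equiv> 1 - (cmod (a j))\<^sup>2"

lemma summable_A: "summable A"
proof (rule summable_comparison_test'[OF summable_mult[OF summable_a, of 2]])
  show "norm (A j) \<le> 2 * (1 - cmod (a j))" if "j \<ge> 0" for j
  proof -
    have "A j = (1 + cmod (a j)) * (1 - cmod (a j))" by (simp add: power2_eq_square algebra_simps)
    also have "\<dots> \<le> 2 * (1 - cmod (a j))" using a_less_1[of j] by (intro mult_right_mono) auto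
    finally show ?thesis using one_minus_sq_pos[of j] by simp
  qed
qed

lemma deriv_B_lower: "\<delta> \<le> cmod (deriv (P UNIV) (a j)) * A j"
  using cmod_deriv_P[of j UNIV] separated[of j] by (simp add: Compl_eq_Diff_UNIV)

lemma deriv_B_nonzero: "deriv (P UNIV) (a j) \<noteq> 0"
  using deriv_B_lower[of j] \<delta> by auto

lemma divide_deriv_B_le: "cmod (x / deriv (P UNIV) (a j)) \<le> cmod x / \<delta> * A j"
proof -
  have "1 / cmod (deriv (P UNIV) (a j)) \<le> A j / \<delta>"
    using deriv_B_lower[of j] deriv_B_nonzero[of j] \<delta> by (simp add: field_simps)
  from mult_left_mono[OF this, of "cmod x"] show ?thesis by (simp add: norm_divide)
qed

lemma denominator_ge: "cmod z \<le> R \<Longrightarrow> R < 1 \<Longrightarrow> 1 - R \<le> cmod (1 - cnj (a j) * z)"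
proof -
  assume z: "cmod z \<le> R" "R < 1"
  then have "cmod (cnj (a j) * z) \<le> R"
    using a_less_1[of j] mult_right_mono[of "cmod (a j)" 1 "cmod z"] by (simp add: norm_mult)
  then show ?thesis using norm_triangle_ineq2[of 1 "cnj (a j) * z"] by simp
qed

lemma kernel_eq: "cmod z < 1 \<Longrightarrow> 1 - (cmod (b j z))\<^sup>2 = A j * (1 - (cmod z)\<^sup>2) / (cmod (1 - cnj (a j) * z))\<^sup>2"
  by (rule one_minus_blaschke_factor_sq[OF a_less_1]) simp

text \<open>A point outside \<open>\<Omega>\<close> lies in a closed set
  \<open>cmod (b k z) \<le> \<eta>\<close>, which stays inside the unit disc because
  \<open>b k\<close> is unimodular on the circle, and whose frontier lies in
  \<open>\<Omega>\<close>.\<close>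

lemma maximum_modulus_discs:
  assumes g: "g holomorphic_on ball 0 1" and C: "\<And>z. z \<in> \<Omega> \<Longrightarrow> cmod (g z) \<le> C" and z: "cmod z < 1"
  shows "cmod (g z) \<le> C"
proof (cases "z \<in> \<Omega>")
  case False
  then obtain k where k: "cmod (b k z) < \<eta>" using z by (auto simp: \<Omega>_def not_le)
  define S where "S = cball 0 1 \<inter> (\<lambda>z. cmod (b k z)) -` {..\<eta>}"
  have clS: "closed S" unfolding S_def
    by (intro continuous_closed_preimage continuous_intros continuous_on_blaschke_factor a_less_1) auto
  have S1: "S \<subseteq> ball 0 1"
  proof
    fix w assume w: "w \<in> S"
    have "cmod w \<noteq> 1" using w \<eta>(2) cmod_blaschke_factor_sphere[OF a_less_1, of w k] by (auto simp: S_def)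
    then show "w \<in> ball 0 1" using w by (simp add: S_def)
  qed
  show ?thesis
  proof (rule maximum_modulus_frontier[of g S])
    show "g holomorphic_on interior S" using S1 interior_subset by (intro holomorphic_on_subset[OF g]) blast
    show "continuous_on (closure S) g"
      using S1 clS by (intro holomorphic_on_imp_continuous_on holomorphic_on_subset[OF g]) simp
    show "bounded S" using S1 bounded_ball bounded_subset by blast
    show "z \<in> S" using z k by (simp add: S_def)
    fix w assume w: "w \<in> frontier S"
    then have wS: "w \<in> S" using frontier_subset_closed[OF clS] by blast
    have "cmod (b k w) = \<eta>"
    proof (rule ccontr)
      assume "cmod (b k w) \<noteq> \<eta>"
      then have "w \<in> ball 0 1 \<inter> (\<lambda>z. cmod (b k z)) -` {..<\<eta>}" using wS subsetD[OF S1 wS] by (auto simp: S_def)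
      moreover have "open (ball 0 1 \<inter> (\<lambda>z. cmod (b k z)) -` {..<\<eta>})"
        by (intro continuous_open_preimage continuous_intros continuous_on_subset[OF continuous_on_blaschke_factor] a_less_1) auto
      moreover have "ball 0 1 \<inter> (\<lambda>z. cmod (b k z)) -` {..<\<eta>} \<subseteq> S" by (auto simp: S_def)
      ultimately have "w \<in> interior S" by (meson interiorI)
      then show False using w by (simp add: frontier_def)
    qed
    then show "cmod (g w) \<le> C" using wS S1 by (intro C boundary_in_\<Omega>[of w k]) auto
  qed
qed (rule C)

end

section \<open>The interpolating series and its reflection\<close>

text \<open>\<open>h\<close> and \<open>F\<close> below are the two expansions of the interpolating function: on the circle
  \<open>F = B * cnj (z * h)\<close>, and \<open>F / B\<close> is the sum of \<open>\<gamma> j / (z - a j)\<close>, which also equals the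
  reflection of \<open>z * h\<close> across the circle.\<close>

locale interpolation_data = interpolating +
  fixes \<gamma> :: "nat \<Rightarrow> complex" and \<Gamma> T :: real
  assumes \<gamma>: "cmod (\<gamma> j) \<le> \<Gamma> * (1 - (cmod (a j))\<^sup>2)"
    and T: "cmod (\<Sum>j. \<gamma> j / (1 - a j * cnj (a k))) \<le> T"
begin

lemma \<Gamma>: "0 \<le> \<Gamma>"
  using order_trans[OF norm_ge_zero \<gamma>[of 0]] one_minus_sq_pos[of 0] by (simp add: zero_le_mult_iff)

lemma \<Gamma>A: "0 \<le> \<Gamma> * A j"
  using order_trans[OF norm_ge_zero \<gamma>[of j]] .

definition "h z = (\<Sum>j. cnj (\<gamma> j) / (1 - cnj (a j) * z))"
definition "F z = (\<Sum>j. \<gamma> j * Q UNIV j z)"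
definition "u z = F z / P UNIV z"

lemma h_term_le:
  assumes "cmod z \<le> R" "R < 1"
  shows "cmod (cnj (\<gamma> j) / (1 - cnj (a j) * z)) \<le> 1 / (1 - R) * (\<Gamma> * A j)"
proof -
  have "cmod (cnj (\<gamma> j) / (1 - cnj (a j) * z)) \<le> (\<Gamma> * A j) / (1 - R)"
    unfolding norm_divide using \<gamma>[of j] \<Gamma>A[of j] denominator_ge[OF assms, of j] assms by (intro frac_le) auto
  then show ?thesis by simp
qed

lemma F_term_le:
  assumes "cmod z \<le> R" "R < 1"
  shows "cmod (\<gamma> j * Q UNIV j z) \<le> 1 / (1 - R) * (\<Gamma> * A j)"
proof -
  have "cmod (Q UNIV j z) \<le> 1 / (1 - R)"
    unfolding cmod_Q using denominator_ge[OF assms, of j] assms cmod_P_le_1[of z] by (intro frac_le) auto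
  then have "cmod (\<gamma> j * Q UNIV j z) \<le> (\<Gamma> * A j) * (1 / (1 - R))"
    unfolding norm_mult using \<gamma>[of j] \<Gamma> one_minus_sq_pos[of j] by (intro mult_mono) auto
  then show ?thesis by simp
qed

lemma summable_h: "cmod z < 1 \<Longrightarrow> summable (\<lambda>j. cnj (\<gamma> j) / (1 - cnj (a j) * z))"
  by (rule summable_comparison_test'[OF summable_mult[OF summable_mult[OF summable_A, of \<Gamma>], of "1 / (1 - cmod z)"]])
     (rule h_term_le; simp)

text \<open>The series converges absolutely by comparison with \<open>A\<close>. At
  \<open>z = a k\<close> this identifies the sum bounded by \<open>T\<close> with
  \<open>cnj (h (a k))\<close>.\<close>

lemma cnj_h_sums:
  assumes "cmod z < 1"
  shows "(\<lambda>j. \<gamma> j / (1 - a j * cnj z)) sums cnj (h z)"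
  using bounded_linear.sums[OF bounded_linear_cnj summable_sums[OF summable_h[OF assms]]]
  by (simp add: h_def)

lemma summable_F: "cmod z < 1 \<Longrightarrow> summable (\<lambda>j. \<gamma> j * Q UNIV j z)"
  by (rule summable_comparison_test'[OF summable_mult[OF summable_mult[OF summable_A, of \<Gamma>], of "1 / (1 - cmod z)"]])
     (rule F_term_le; simp)

lemma holomorphic_h: "h holomorphic_on ball 0 1"
  unfolding h_def[abs_def]
proof (rule holomorphic_series[where M = "\<lambda>j. \<Gamma> * A j" and C = "\<lambda>R. 1 / (1 - R)"])
  show "(\<lambda>z. cnj (\<gamma> j) / (1 - cnj (a j) * z)) holomorphic_on ball 0 1" for j
    by (intro holomorphic_intros) (auto simp: cnj_mult_neq_1 a_less_1)
qed (use h_term_le summable_A in \<open>auto intro!: summable_mult\<close>)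

lemma holomorphic_F: "F holomorphic_on ball 0 1"
  unfolding F_def[abs_def]
  by (rule holomorphic_series[where M = "\<lambda>j. \<Gamma> * A j" and C = "\<lambda>R. 1 / (1 - R)"])
     (use F_term_le summable_A holomorphic_Q in \<open>auto intro!: summable_mult holomorphic_intros\<close>)

lemma F_at_zero: "F (a k) = \<gamma> k * deriv (P UNIV) (a k)"
proof -
  have "Q UNIV j (a k) = 0" if "j \<noteq> k" for j
    using P_zero[of k "UNIV - {j}"] that by (simp add: Q_def)
  then have "F (a k) = (\<Sum>j\<in>{k}. \<gamma> j * Q UNIV j (a k))"
    unfolding F_def by (intro suminf_finite) auto
  then show ?thesis by (simp add: deriv_P)
qed

text \<open>In \<open>\<Omega>\<close> the distance \<open>|z - a j|\<close> is at least
  \<open>\<eta> * |1 - cnj (a j) * z|\<close>, so each term of the difference is at most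
  \<open>\<Gamma> / \<eta>\<close> times \<open>1 - |b j z|\<^sup>2\<close>. The factor 2 comes from
  \<open>kernel_sum_le\<close>.\<close>

lemma u_minus_cnj_le:
  assumes z: "z \<in> \<Omega>"
  shows "cmod (u z - cnj (z * h z)) \<le> 2 * \<Gamma> / \<eta> * (- ln (cmod (P UNIV z)))"
proof -
  have z1: "cmod z < 1" using z by (simp add: \<Omega>_def)
  have Bne: "P UNIV z \<noteq> 0" using B_ge[OF z] \<epsilon>(1) by auto
  have zn: "z \<noteq> a j" for j using \<Omega>_not_a[OF z] by auto
  have dn: "1 - a j * cnj z \<noteq> 0" for j
    using one_minus_cnj_mult_nonzero[OF a_less_1[of j], of z] z1
    by (metis complex_cnj_cnj complex_cnj_diff complex_cnj_mult complex_cnj_one complex_cnj_zero_iff less_imp_le)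
  have "(\<lambda>j. \<gamma> j * Q UNIV j z / P UNIV z) sums u z"
    unfolding u_def F_def by (intro sums_divide summable_sums summable_F z1)
  moreover have "\<gamma> j * Q UNIV j z / P UNIV z = \<gamma> j / (z - a j)" for j
  proof -
    have e: "P UNIV z = (z - a j) * Q UNIV j z" using P_eq_Q[OF z1, of j UNIV] by simp
    then have "Q UNIV j z \<noteq> 0" using Bne by auto
    then show ?thesis by (simp add: e)
  qed
  ultimately have 1: "(\<lambda>j. \<gamma> j / (z - a j)) sums u z" by simp
  have 2: "(\<lambda>j. cnj z * \<gamma> j / (1 - a j * cnj z)) sums cnj (z * h z)"
    using sums_mult[OF cnj_h_sums[OF z1], of "cnj z"] by simp
  define t where "t j = \<gamma> j / (z - a j) - cnj z * \<gamma> j / (1 - a j * cnj z)" for j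
  have sums: "t sums (u z - cnj (z * h z))" unfolding t_def by (intro sums_diff 1 2)
  have le: "cmod (t j) \<le> \<Gamma> / \<eta> * (1 - (cmod (b j z))\<^sup>2)" for j
  proof -
    define d where "d = cmod (1 - cnj (a j) * z)"
    have d: "d > 0" using one_minus_cnj_mult_nonzero[OF a_less_1[of j], of z] z1 by (simp add: d_def)
    have d2: "cmod (1 - a j * cnj z) = d"
      unfolding d_def by (metis complex_cnj_cnj complex_cnj_diff complex_cnj_mult complex_cnj_one complex_mod_cnj)
    have zd: "\<eta> * d \<le> cmod (z - a j)"
    proof -
      have "\<eta> \<le> cmod (a j - z) / d" using z by (simp add: \<Omega>_def cmod_blaschke_factor d_def)
      then show ?thesis using d by (simp add: field_simps norm_minus_commute)
    qed
    have "t j = \<gamma> j * (1 - cnj z * z) / ((z - a j) * (1 - a j * cnj z))"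
      using zn[of j] dn[of j] by (simp add: t_def field_simps)
    moreover have "1 - cnj z * z = of_real (1 - (cmod z)\<^sup>2)"
      using complex_norm_square[of z] by (simp add: mult.commute)
    moreover have X: "0 \<le> 1 - (cmod z)\<^sup>2" using z1 by (simp add: power_le_one)
    ultimately have "cmod (t j) = cmod (\<gamma> j) * (1 - (cmod z)\<^sup>2) / (cmod (z - a j) * d)"
      by (simp add: norm_mult norm_divide d2 del: of_real_diff)
    also have "\<dots> \<le> \<Gamma> * A j * (1 - (cmod z)\<^sup>2) / (\<eta> * d * d)"
      using \<gamma>[of j] X zd d \<eta>(1) mult_nonneg_nonneg[OF \<Gamma>A[of j] X] by (intro frac_le mult_right_mono mult_mono) auto
    also have "\<dots> = \<Gamma> / \<eta> * (1 - (cmod (b j z))\<^sup>2)"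
      using kernel_eq[OF z1, of j] by (simp add: d_def power2_eq_square)
    finally show ?thesis .
  qed
  note ks = kernel_sum_le[OF z1 Bne]
  have "cmod (u z - cnj (z * h z)) = cmod (suminf t)" using sums by (simp add: sums_iff)
  also have "\<dots> \<le> (\<Sum>j. \<Gamma> / \<eta> * (1 - (cmod (b j z))\<^sup>2))"
    by (rule norm_suminf_le[OF le summable_mult[OF ks(1)]])
  also have "\<dots> = \<Gamma> / \<eta> * (\<Sum>j. 1 - (cmod (b j z))\<^sup>2)" by (rule suminf_mult[OF ks(1)])
  also have "\<dots> \<le> \<Gamma> / \<eta> * (- 2 * ln (cmod (P UNIV z)))"
    using ks(2) \<Gamma> \<eta>(1) by (intro mult_left_mono) auto
  also have "\<dots> = 2 * \<Gamma> / \<eta> * (- ln (cmod (P UNIV z)))" by simp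
  finally show ?thesis .
qed

text \<open>The terms of \<open>h z - h (a k)\<close> have the mixed denominators
  \<open>d * e\<close>. The inequality of arithmetic and geometric means separates them into the
  kernels at \<open>z\<close> and at \<open>a k\<close>, whose sums are both bounded, and
  \<open>T\<close> bounds \<open>h (a k)\<close>.\<close>

lemma h_boundary_bound: "\<exists>H. \<forall>z k. cmod z < 1 \<longrightarrow> cmod (b k z) = \<eta> \<longrightarrow> cmod (h z) \<le> H"
proof -
  have "cmod (h z) \<le> T + \<Gamma> / 2 * (- 2 * ln \<epsilon> + (1 - 2 * ln \<delta>))"
    if z1: "cmod z < 1" and bk: "cmod (b k z) = \<eta>" for z k
  proof -
    have z: "z \<in> \<Omega>" using boundary_in_\<Omega>[OF z1 bk] .
    have Bne: "P UNIV z \<noteq> 0" using B_ge[OF z] \<epsilon>(1) by auto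
    define X Y where "X = 1 - (cmod z)\<^sup>2" and "Y = A k"
    have XY: "0 \<le> X" "0 \<le> Y" using z1 one_minus_sq_pos[of k] by (auto simp: X_def Y_def power_le_one)
    \<comment> \<open>Because \<open>\<eta> \<le> 1 / 6\<close> gives
      \<open>\<eta>\<^sup>2 \<le> 1 - \<eta>\<^sup>2\<close>, the distance is at most the geometric
      mean of \<open>X\<close> and \<open>Y\<close>; this is what separates the mixed terms
      below.\<close>
    have dist: "(cmod (z - a k))\<^sup>2 \<le> X * Y"
    proof -
      define d where "d = cmod (1 - cnj (a k) * z)"
      have d: "d > 0" using one_minus_cnj_mult_nonzero[OF a_less_1[of k], of z] z1 by (simp add: d_def)
      have "cmod (z - a k) = \<eta> * d"
      proof -
        have "cmod (a k - z) / d = \<eta>" using bk by (simp only: cmod_blaschke_factor d_def)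
        then show ?thesis using d by (simp add: field_simps norm_minus_commute)
      qed
      then have 1: "(cmod (z - a k))\<^sup>2 = \<eta>\<^sup>2 * d\<^sup>2" by (simp add: power_mult_distrib)
      have "1 - \<eta>\<^sup>2 = X * Y / d\<^sup>2" using kernel_eq[OF z1, of k] bk by (simp add: X_def Y_def d_def)
      then have 2: "X * Y = (1 - \<eta>\<^sup>2) * d\<^sup>2" using d by (simp add: field_simps)
      have "\<eta>\<^sup>2 \<le> (1 / 6)\<^sup>2" using \<eta> by (intro power_mono) auto
      then have "\<eta>\<^sup>2 \<le> 1 - \<eta>\<^sup>2" by (simp add: power2_eq_square)
      then show ?thesis unfolding 1 2 by (intro mult_right_mono) auto
    qed
    define t where "t j = cnj (\<gamma> j) / (1 - cnj (a j) * z) - cnj (\<gamma> j) / (1 - cnj (a j) * a k)" for j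
    have sums: "t sums (h z - h (a k))"
      unfolding t_def h_def by (intro sums_diff summable_sums summable_h z1 a_less_1)
    have le: "cmod (t j) \<le> \<Gamma> / 2 * ((1 - (cmod (b j z))\<^sup>2) + (1 - (cmod (b j (a k)))\<^sup>2))" for j
    proof -
      define d e where "d = cmod (1 - cnj (a j) * z)" and "e = cmod (1 - cnj (a j) * a k)"
      have ne: "1 - cnj (a j) * z \<noteq> 0" "1 - cnj (a j) * a k \<noteq> 0"
        using one_minus_cnj_mult_nonzero[OF a_less_1[of j]] z1 a_less_1[of k] by auto
      then have de: "d > 0" "e > 0" by (auto simp: d_def e_def)
      have m: "cmod (z - a k) / (d * e) \<le> (X / d\<^sup>2 + Y / e\<^sup>2) / 2"
      proof (rule le_arith_mean_if_sq_le)
        show "(cmod (z - a k) / (d * e))\<^sup>2 \<le> X / d\<^sup>2 * (Y / e\<^sup>2)"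
          using dist de by (simp add: power_divide power_mult_distrib divide_right_mono)
      qed (use XY de in auto)
      have "t j = cnj (\<gamma> j) * cnj (a j) * (z - a k) / ((1 - cnj (a j) * z) * (1 - cnj (a j) * a k))"
        using ne by (simp add: t_def divide_simps) (simp add: algebra_simps)
      then have "cmod (t j) = cmod (\<gamma> j) * cmod (a j) * (cmod (z - a k) / (d * e))"
        by (simp add: norm_mult norm_divide d_def e_def)
      also have "\<dots> \<le> (\<Gamma> * A j) * 1 * ((X / d\<^sup>2 + Y / e\<^sup>2) / 2)"
        using \<gamma>[of j] a_less_1[of j] m \<Gamma> one_minus_sq_pos[of j] de
        by (intro mult_mono mult_nonneg_nonneg) auto
      also have "\<dots> = \<Gamma> / 2 * (A j * X / d\<^sup>2 + A j * Y / e\<^sup>2)" by (simp add: field_simps)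
      finally show ?thesis
        unfolding kernel_eq[OF z1] kernel_eq[OF a_less_1] X_def Y_def d_def e_def .
    qed
    note ks = kernel_sum_le[OF z1 Bne] and ka = kernel_sum_at_zero_le[of k]
    have "cmod (h z - h (a k)) = cmod (suminf t)" using sums by (simp add: sums_iff)
    also have "\<dots> \<le> (\<Sum>j. \<Gamma> / 2 * ((1 - (cmod (b j z))\<^sup>2) + (1 - (cmod (b j (a k)))\<^sup>2)))"
      by (rule norm_suminf_le[OF le summable_mult[OF summable_add[OF ks(1) ka(1)]]])
    also have "\<dots> = \<Gamma> / 2 * ((\<Sum>j. 1 - (cmod (b j z))\<^sup>2) + (\<Sum>j. 1 - (cmod (b j (a k)))\<^sup>2))"
      using suminf_mult[OF summable_add[OF ks(1) ka(1)], of "\<Gamma> / 2"] suminf_add[OF ks(1) ka(1)] by simp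
    also have "\<dots> \<le> \<Gamma> / 2 * (- 2 * ln \<epsilon> + (1 - 2 * ln \<delta>))"
      using ln_B_bounds(2)[OF z] ks(2) ka(2) \<Gamma> by (intro mult_left_mono add_mono) auto
    finally have "cmod (h z - h (a k)) \<le> \<Gamma> / 2 * (- 2 * ln \<epsilon> + (1 - 2 * ln \<delta>))" .
    moreover have "cmod (h (a k)) \<le> T"
      using T[of k] unfolding sums_unique[OF cnj_h_sums[OF a_less_1[of k]], symmetric] complex_mod_cnj .
    ultimately show ?thesis using norm_triangle_sub[of "h z" "h (a k)"] by linarith
  qed
  then show ?thesis by blast
qed

lemma bounded_u_h: "\<exists>C. \<forall>z\<in>\<Omega>. cmod (u z) \<le> C \<and> cmod (z * h z) \<le> C"
proof -
  define K where "K = 2 * \<Gamma> / \<eta>"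
  have K: "0 \<le> K" using \<Gamma> \<eta>(1) by (simp add: K_def)
  obtain H where H: "\<And>z k. cmod z < 1 \<Longrightarrow> cmod (b k z) = \<eta> \<Longrightarrow> cmod (h z) \<le> H"
    using h_boundary_bound by blast
  define M where "M = H + (H + K * (- ln \<epsilon>))"
  have uv: "cmod (u z) + cmod (z * h z) \<le> M" if z: "cmod z < 1" "cmod (b k z) = \<eta>" for z k
  proof -
    have z\<Omega>: "z \<in> \<Omega>" using boundary_in_\<Omega>[OF z] .
    have v: "cmod (z * h z) \<le> H"
      using mult_mono[of "cmod z" 1 "cmod (h z)" H] H[OF z] z by (simp add: norm_mult)
    have "K * (- ln (cmod (P UNIV z))) \<le> K * (- ln \<epsilon>)"
      using K by (intro mult_left_mono ln_B_bounds(2)[OF z\<Omega>]) auto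
    then have "cmod (u z - cnj (z * h z)) \<le> K * (- ln \<epsilon>)"
      using u_minus_cnj_le[OF z\<Omega>] unfolding K_def by linarith
    then have "cmod (u z) \<le> H + K * (- ln \<epsilon>)"
      using norm_triangle_sub[of "u z" "cnj (z * h z)"] v unfolding complex_mod_cnj by linarith
    then show ?thesis using v unfolding M_def by linarith
  qed
  \<comment> \<open>With \<open>v = z * h z\<close>, \<open>Im (u + v) = Im (u - cnj v)\<close> and
    \<open>Im (\<i> * (u - v)) = Re (u - cnj v)\<close>, so both combinations inherit the
    logarithmic bound; together they determine \<open>u\<close> and \<open>v\<close>.\<close>
  define p q where "p z = u z + z * h z" and "q z = \<i> * (u z - z * h z)" for z
  have nz: "P UNIV z \<noteq> 0" if "z \<in> ball 0 1 - range a" for z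
    using that by (intro P_nonzero) auto
  have "u holomorphic_on (ball 0 1 - range a)"
    unfolding u_def[abs_def]
    by (intro holomorphic_intros holomorphic_on_subset[OF holomorphic_F] holomorphic_on_subset[OF holomorphic_P])
       (use nz in auto)
  moreover have "h holomorphic_on (ball 0 1 - range a)"
    by (intro holomorphic_on_subset[OF holomorphic_h]) auto
  ultimately have hol: "p holomorphic_on (ball 0 1 - range a)" "q holomorphic_on (ball 0 1 - range a)"
    unfolding p_def[abs_def] q_def[abs_def] by (auto intro!: holomorphic_intros)
  have "\<exists>C. \<forall>z\<in>\<Omega>. cmod (p z) \<le> C"
  proof (rule bounded_on_\<Omega>[where K = K and M = M, OF hol(1)])
    show "\<bar>Im (p z)\<bar> \<le> K * (- ln (cmod (P UNIV z)))" if "z \<in> \<Omega>" for z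
    proof -
      have "Im (p z) = Im (u z - cnj (z * h z))" by (simp add: p_def)
      then show ?thesis
        using u_minus_cnj_le[OF that] abs_Im_le_cmod[of "u z - cnj (z * h z)"] unfolding K_def by linarith
    qed
    show "cmod (p z) \<le> M" if "cmod z < 1" "cmod (b k z) = \<eta>" for z k
      using uv[OF that] norm_triangle_ineq[of "u z" "z * h z"] unfolding p_def by linarith
  qed
  then obtain C1 where C1: "\<And>z. z \<in> \<Omega> \<Longrightarrow> cmod (p z) \<le> C1" by blast
  have "\<exists>C. \<forall>z\<in>\<Omega>. cmod (q z) \<le> C"
  proof (rule bounded_on_\<Omega>[where K = K and M = M, OF hol(2)])
    show "\<bar>Im (q z)\<bar> \<le> K * (- ln (cmod (P UNIV z)))" if "z \<in> \<Omega>" for z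
    proof -
      have "Im (q z) = Re (u z - cnj (z * h z))" by (simp add: q_def)
      then show ?thesis
        using u_minus_cnj_le[OF that] abs_Re_le_cmod[of "u z - cnj (z * h z)"] unfolding K_def by linarith
    qed
    show "cmod (q z) \<le> M" if "cmod z < 1" "cmod (b k z) = \<eta>" for z k
      using uv[OF that] norm_triangle_ineq4[of "u z" "z * h z"] unfolding q_def by (simp add: norm_mult)
  qed
  then obtain C2 where C2: "\<And>z. z \<in> \<Omega> \<Longrightarrow> cmod (q z) \<le> C2" by blast
  have "cmod (u z) \<le> C1 + C2 \<and> cmod (z * h z) \<le> C1 + C2" if "z \<in> \<Omega>" for z
  proof -
    have "u z = (p z - \<i> * q z) / 2" "z * h z = (p z + \<i> * q z) / 2"
      by (simp_all add: p_def q_def algebra_simps)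
    then have "cmod (u z) \<le> (cmod (p z) + cmod (q z)) / 2" "cmod (z * h z) \<le> (cmod (p z) + cmod (q z)) / 2"
      using norm_triangle_ineq4[of "p z" "\<i> * q z"] norm_triangle_ineq[of "p z" "\<i> * q z"]
      by (simp_all only: norm_divide norm_mult) (simp_all add: norm_mult)
    moreover have "(cmod (p z) + cmod (q z)) / 2 \<le> C1 + C2"
    proof -
      have half: "s / 2 \<le> s" if "0 \<le> s" for s :: real using that by simp
      show ?thesis
        by (rule order_trans[OF half add_mono[OF C1[OF that] C2[OF that]]]) (intro add_nonneg_nonneg norm_ge_zero)
    qed
    ultimately show ?thesis by (auto intro: order_trans)
  qed
  then show ?thesis by blast
qed

lemma F_in_Hinf: "F \<in> Hinf"
proof -
  obtain C where C: "\<And>z. z \<in> \<Omega> \<Longrightarrow> cmod (u z) \<le> C" using bounded_u_h by blast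
  have "cmod (F z) \<le> C" if z: "z \<in> \<Omega>" for z
  proof -
    have z1: "cmod z < 1" using z by (simp add: \<Omega>_def)
    have "P UNIV z \<noteq> 0" using B_ge[OF z] \<epsilon>(1) by auto
    then have "F z = P UNIV z * u z" by (simp add: u_def)
    then have "cmod (F z) \<le> 1 * C"
      unfolding norm_mult \<open>F z = _\<close> by (intro mult_mono C[OF z] cmod_P_le_1[OF z1]) auto
    then show ?thesis by simp
  qed
  then have "cmod (F z) \<le> C" if "cmod z < 1" for z
    using maximum_modulus_discs[OF holomorphic_F _ that] by blast
  then have "bounded (F ` ball 0 1)" unfolding bounded_iff by (intro exI[of _ C]) auto
  then show ?thesis using holomorphic_F by (simp add: Hinf_def)
qed

lemma zh_in_Hinf0: "(\<lambda>z. z * h z) \<in> Hinf0"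
proof -
  have hol: "(\<lambda>z. z * h z) holomorphic_on ball 0 1" by (intro holomorphic_intros holomorphic_h)
  obtain C where C: "\<And>z. z \<in> \<Omega> \<Longrightarrow> cmod (z * h z) \<le> C" using bounded_u_h by blast
  have "cmod (z * h z) \<le> C" if "cmod z < 1" for z
    using maximum_modulus_discs[OF hol _ that] C by blast
  then have "bounded ((\<lambda>z. z * h z) ` ball 0 1)" unfolding bounded_iff by (intro exI[of _ C]) auto
  then show ?thesis using hol by (simp add: Hinf0_def Hinf_def)
qed

text \<open>Once \<open>|B| > \<eta>\<close> along the radius, each single factor also exceeds
  \<open>\<eta>\<close>, so the radius ends inside \<open>\<Omega>\<close>. There \<open>F\<close>
  differs from \<open>B * cnj (z * h z)\<close> by at most a multiple of \<open>- ln |B|\<close>,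
  which tends to 0 as \<open>|B|\<close> tends to 1.\<close>

lemma F_boundary_value:
  assumes \<zeta>: "cmod \<zeta> = 1" and B: "has_boundary_value (P UNIV) \<zeta> \<beta>" "cmod \<beta> = 1"
    and v: "has_boundary_value (\<lambda>z. z * h z) \<zeta> v"
  shows "has_boundary_value F \<zeta> (\<beta> * cnj v)"
proof -
  define K where "K = 2 * \<Gamma> / \<eta>"
  have lim: "((\<lambda>r. P UNIV (of_real r * \<zeta>)) \<longlongrightarrow> \<beta>) (at_left 1)"
    using B(1) by (simp add: has_boundary_value_def)
  then have nlim: "((\<lambda>r. cmod (P UNIV (of_real r * \<zeta>))) \<longlongrightarrow> 1) (at_left 1)"
    using tendsto_norm[OF lim] B(2) by simp
  have "((\<lambda>r. K * (- ln (cmod (P UNIV (of_real r * \<zeta>))))) \<longlongrightarrow> K * (- ln 1)) (at_left 1)"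
    by (intro tendsto_intros nlim) auto
  then have small: "((\<lambda>r. K * (- ln (cmod (P UNIV (of_real r * \<zeta>))))) \<longlongrightarrow> 0) (at_left 1)" by simp
  have ev: "eventually (\<lambda>r. \<eta> < cmod (P UNIV (of_real r * \<zeta>))) (at_left 1)"
    using order_tendstoD(1)[OF nlim, of \<eta>] \<eta>(2) by simp
  have "((\<lambda>r. F (of_real r * \<zeta>) - P UNIV (of_real r * \<zeta>) * cnj (of_real r * \<zeta> * h (of_real r * \<zeta>))) \<longlongrightarrow> 0) (at_left 1)"
  proof (rule Lim_null_comparison[OF _ small])
    show "eventually (\<lambda>r. norm (F (of_real r * \<zeta>) - P UNIV (of_real r * \<zeta>) * cnj (of_real r * \<zeta> * h (of_real r * \<zeta>)))
        \<le> K * (- ln (cmod (P UNIV (of_real r * \<zeta>))))) (at_left 1)"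
      using ev radial_at_left
    proof eventually_elim
      case (elim r)
      define z where "z = of_real r * \<zeta>"
      have z1: "cmod z < 1" using elim \<zeta> by (simp add: z_def norm_mult)
      have "\<eta> \<le> cmod (b k z)" for k
        using cmod_P_antimono[OF z1, of "{k}" UNIV] elim by (simp add: blaschke_part_finite z_def)
      then have z: "z \<in> \<Omega>" using z1 by (simp add: \<Omega>_def)
      have "P UNIV z \<noteq> 0" using B_ge[OF z] \<epsilon>(1) by auto
      then have "F z - P UNIV z * cnj (z * h z) = P UNIV z * (u z - cnj (z * h z))"
        by (simp add: u_def algebra_simps)
      then have "cmod (F z - P UNIV z * cnj (z * h z)) \<le> 1 * cmod (u z - cnj (z * h z))"
        unfolding norm_mult \<open>_ = P UNIV z * (u z - cnj (z * h z))\<close>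
        by (intro mult_right_mono cmod_P_le_1[OF z1]) auto
      then show ?case using u_minus_cnj_le[OF z] unfolding K_def z_def by linarith
    qed
  qed
  moreover have "((\<lambda>r. P UNIV (of_real r * \<zeta>) * cnj (of_real r * \<zeta> * h (of_real r * \<zeta>))) \<longlongrightarrow> \<beta> * cnj v) (at_left 1)"
    using v unfolding has_boundary_value_def by (intro tendsto_intros lim)
  ultimately have "((\<lambda>r. F (of_real r * \<zeta>)) \<longlongrightarrow> 0 + \<beta> * cnj v) (at_left 1)"
    using tendsto_add by fastforce
  then show ?thesis by (simp add: has_boundary_value_def)
qed

end

section \<open>Boundary functions\<close>

lemma AE_arclength_imp_angle: "AE \<zeta> in arclength. P \<zeta> \<Longrightarrow> AE t in angle. P (cis t)"
  unfolding arclength_eq by (rule AE_distrD) (auto simp: measurable_cong_sets[OF sets_angle refl])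

text \<open>A fixed sequence of radii makes boundary functions measurable, as limits of sequences,
  and allows dominated convergence. The shift by 2 keeps every radius positive.\<close>

definition radius :: "nat \<Rightarrow> real" where
  "radius n = 1 - 1 / (real n + 2)"

lemma radius: "0 < radius n" "radius n < 1"
  by (auto simp: radius_def field_simps)

lemma abs_radius [simp]: "\<bar>radius n\<bar> = radius n"
  using radius(1)[of n] by simp

lemma filterlim_radius: "filterlim radius (at_left 1) sequentially"
proof -
  have "(\<lambda>n. 1 - 1 / real (n + 2)) \<longlonglongrightarrow> 1 - 0"
    by (intro tendsto_diff tendsto_const LIMSEQ_ignore_initial_segment[OF lim_1_over_n])
  then have "radius \<longlonglongrightarrow> 1" by (simp add: radius_def[abs_def] add.commute)
  then show ?thesis
    unfolding filterlim_at using radius(2) by (auto simp: less_imp_neq)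
qed

text \<open>Meaningful only at angles where the radial limit exists.\<close>

definition bv :: "(complex \<Rightarrow> complex) \<Rightarrow> real \<Rightarrow> complex" where
  "bv f t = lim (\<lambda>n. f (of_real (radius n) * cis t))"

lemma LIMSEQ_radius: "has_boundary_value f \<zeta> l \<Longrightarrow> (\<lambda>n. f (of_real (radius n) * \<zeta>)) \<longlonglongrightarrow> l"
  unfolding has_boundary_value_def using filterlim_compose[OF _ filterlim_radius] by blast

lemma bv_eqI: "has_boundary_value f (cis t) l \<Longrightarrow> bv f t = l"
  unfolding bv_def by (intro limI LIMSEQ_radius)

lemma has_boundary_value_continuous:
  assumes "continuous_on (cball 0 1) f" "cmod \<zeta> = 1"
  shows "has_boundary_value f \<zeta> (f \<zeta>)"
proof -
  have "((\<lambda>r. of_real r * \<zeta>) \<longlongrightarrow> of_real 1 * \<zeta>) (at_left 1)" by (intro tendsto_intros)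
  moreover have "eventually (\<lambda>r. of_real r * \<zeta> \<in> cball 0 1) (at_left 1)"
    using radial_at_left by eventually_elim (use assms(2) in \<open>simp add: norm_mult\<close>)
  ultimately show ?thesis
    unfolding has_boundary_value_def using assms
    by (intro continuous_on_tendsto_compose[OF assms(1)]) auto
qed

lemma scaled_holomorphic:
  assumes f: "f holomorphic_on ball 0 1" and r: "0 < r" "r < 1"
  shows "continuous_on (cball 0 1) (\<lambda>z. f (of_real r * z))" "(\<lambda>z. f (of_real r * z)) holomorphic_on ball 0 1"
proof -
  have lt: "cmod (of_real r * z) < 1" if "cmod z \<le> 1" for z :: complex
  proof -
    have "r * cmod z \<le> r" using that r by (intro mult_left_le) auto
    then have "r * cmod z < 1" using r(2) by linarith
    then show ?thesis using r by (simp add: norm_mult)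
  qed
  show "continuous_on (cball 0 1) (\<lambda>z. f (of_real r * z))"
    using lt by (intro continuous_on_compose2[OF holomorphic_on_imp_continuous_on[OF f]] continuous_intros) auto
  show "(\<lambda>z. f (of_real r * z)) holomorphic_on ball 0 1"
    using lt by (intro holomorphic_on_compose_gen[OF _ f, unfolded o_def] holomorphic_intros) auto
qed

section \<open>Integrals of boundary functions\<close>

locale bounded_holomorphic =
  fixes f :: "complex \<Rightarrow> complex" and M :: real
  assumes hol: "f holomorphic_on ball 0 1" and bdd: "\<And>z. cmod z < 1 \<Longrightarrow> cmod (f z) \<le> M"
begin

lemma continuous_circle: "continuous_on (sphere 0 1) (\<lambda>\<zeta>. f (of_real (radius n) * \<zeta>))"
  by (intro continuous_on_compose2[OF holomorphic_on_imp_continuous_on[OF hol]] continuous_intros)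
     (use radius in \<open>auto simp: norm_mult\<close>)

lemma measurable_bv [measurable]: "bv f \<in> borel_measurable borel"
  unfolding bv_def[abs_def]
  by (intro borel_measurable_lim_metric measurable_circle[OF continuous_circle])

lemma AE_bv: "AE t in angle. has_boundary_value f (cis t) (bv f t)"
proof -
  have "bounded (f ` ball 0 1)" using bdd unfolding bounded_iff by (intro exI[of _ M]) auto
  from AE_arclength_imp_angle[OF Fatou_radial_limits[OF hol this]]
  show ?thesis by (rule AE_mp) (auto intro!: AE_I2 simp: bv_eqI)
qed

lemma AE_bv_le: "AE t in angle. cmod (bv f t) \<le> M"
  using AE_bv
proof eventually_elim
  case (elim t)
  from tendsto_norm[OF LIMSEQ_radius[OF elim]] show ?case
    by (rule LIMSEQ_le_const2) (use radius bdd in \<open>auto simp: norm_mult intro!: exI[of _ 0]\<close>)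
qed

text \<open>Dominated convergence along the radii. This transfers Cauchy formulas, which are stated
  under continuity up to the circle, from the dilates of \<open>f\<close> to its boundary
  function.\<close>

lemma integrable_bv_mult:
  assumes g: "continuous_on (sphere 0 1) g"
  shows "integrable angle (\<lambda>t. bv f t * g (cis t))"
    and "(\<lambda>n. \<integral>t. f (of_real (radius n) * cis t) * g (cis t) \<partial>angle) \<longlonglongrightarrow> (\<integral>t. bv f t * g (cis t) \<partial>angle)"
proof -
  have [measurable]: "(\<lambda>t. g (cis t)) \<in> borel_measurable borel" "(\<lambda>t. f (of_real (radius n) * cis t)) \<in> borel_measurable borel" for n
    by (intro measurable_circle g continuous_circle)+
  have w: "integrable angle (\<lambda>t. M * cmod (g (cis t)))"
    by (intro integrable_mult_right integrable_norm integrable_circle g)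
  have lim: "AE t in angle. (\<lambda>n. f (of_real (radius n) * cis t) * g (cis t)) \<longlonglongrightarrow> bv f t * g (cis t)"
    using AE_bv by eventually_elim (intro tendsto_intros LIMSEQ_radius)
  have dom: "AE t in angle. cmod (f (of_real (radius n) * cis t) * g (cis t)) \<le> M * cmod (g (cis t))" for n
    using radius[of n] by (intro AE_I2) (auto simp: norm_mult intro!: mult_right_mono bdd)
  show "integrable angle (\<lambda>t. bv f t * g (cis t))"
    by (rule integrable_dominated_convergence[OF _ _ w lim dom]) measurable
  show "(\<lambda>n. \<integral>t. f (of_real (radius n) * cis t) * g (cis t) \<partial>angle) \<longlonglongrightarrow> (\<integral>t. bv f t * g (cis t) \<partial>angle)"
    by (rule integral_dominated_convergence[OF _ _ w lim dom]) measurable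
qed

lemma integral_bv: "integrable angle (bv f)" "(\<integral>t. bv f t \<partial>angle) = f 0"
proof -
  have g: "continuous_on (sphere 0 1) (\<lambda>\<zeta>. 1 :: complex)" by auto
  show "integrable angle (bv f)" using integrable_bv_mult(1)[OF g] by simp
  have "(\<integral>t. f (of_real (radius n) * cis t) * 1 \<partial>angle) = f 0" for n
  proof -
    have "(\<integral>t. f (of_real (radius n) * cis t) * cis t / (cis t - 0) \<partial>angle) = f (of_real (radius n) * 0)"
      by (rule Cauchy_integral_angle) (auto intro!: scaled_holomorphic hol radius)
    then show ?thesis by simp
  qed
  then show "(\<integral>t. bv f t \<partial>angle) = f 0" using integrable_bv_mult(2)[OF g] by (simp add: LIMSEQ_const_iff)
qed

end

section \<open>Boundary values of Blaschke products and of their tails\<close>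

context blaschke
begin

lemma bounded_holomorphic_P: "bounded_holomorphic (P J) 1"
  by unfold_locales (auto intro: holomorphic_P cmod_P_le_1)

lemma P_split: "cmod z < 1 \<Longrightarrow> P UNIV z = P {..<n} z * P {n..} z"
proof -
  have "{..<n} \<union> {n..} = UNIV" by auto
  then show "cmod z < 1 \<Longrightarrow> P UNIV z = P {..<n} z * P {n..} z"
    using P_Un[of z "{..<n}" "{n..}"] by (simp add: disjoint_iff)
qed

lemma bv_P_split: "AE t in angle. bv (P UNIV) t = P {..<n} (cis t) * bv (P {n..}) t"
  using bounded_holomorphic.AE_bv[OF bounded_holomorphic_P[of "{n..}"]]
proof eventually_elim
  case (elim t)
  from has_boundary_value_continuous[OF P_finite_continuous, of "{..<n}" "cis t"] elim
  have "((\<lambda>r. P {..<n} (of_real r * cis t) * P {n..} (of_real r * cis t)) \<longlongrightarrow> P {..<n} (cis t) * bv (P {n..}) t) (at_left 1)"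
    unfolding has_boundary_value_def by (intro tendsto_intros) auto
  moreover have "eventually (\<lambda>r. P {..<n} (of_real r * cis t) * P {n..} (of_real r * cis t) = P UNIV (of_real r * cis t)) (at_left 1)"
    using radial_at_left by eventually_elim (subst P_split[of _ n], auto simp: norm_mult)
  ultimately have "has_boundary_value (P UNIV) (cis t) (P {..<n} (cis t) * bv (P {n..}) t)"
    unfolding has_boundary_value_def by (simp add: tendsto_cong)
  then show ?case by (rule bv_eqI)
qed

text \<open>\<open>|x - 1|\<^sup>2 \<le> 2 - 2 Re x\<close> for \<open>|x| \<le> 1\<close>, and the mean of \<open>Re (P {n..})\<close> over the circle is its
  value at 0, which tends to 1.\<close>

lemma tail_L1: "(\<lambda>n. \<integral>t. cmod (bv (P {n..}) t - 1) \<partial>angle) \<longlonglongrightarrow> 0"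
proof (rule LIMSEQ_I)
  interpret finite_measure angle by (rule finite_measure_angle)
  fix e :: real assume e: "e > 0"
  have "(\<lambda>n. (2 - 2 * Re (P {n..} 0)) / (2 * e)) \<longlonglongrightarrow> (2 - 2 * Re 1) / (2 * e)"
    using e by (intro tendsto_intros P_tail_tendsto_1) auto
  then have "eventually (\<lambda>n. (2 - 2 * Re (P {n..} 0)) / (2 * e) < e / 2) sequentially"
    by (rule order_tendstoD) (use e in auto)
  then obtain N where N: "\<And>n. n \<ge> N \<Longrightarrow> (2 - 2 * Re (P {n..} 0)) / (2 * e) < e / 2"
    by (auto simp: eventually_sequentially)
  have "norm ((\<integral>t. cmod (bv (P {n..}) t - 1) \<partial>angle) - 0) < e" if "n \<ge> N" for n
  proof -
    interpret R: bounded_holomorphic "P {n..}" 1 by (rule bounded_holomorphic_P)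
    have i1: "integrable angle (\<lambda>t. cmod (bv (P {n..}) t - 1))"
      using R.integral_bv(1) by auto
    have i2: "integrable angle (\<lambda>t. e / 2 + (2 - 2 * Re (bv (P {n..}) t)) / (2 * e))"
      using R.integral_bv(1) by auto
    have "(\<integral>t. cmod (bv (P {n..}) t - 1) \<partial>angle) \<le> (\<integral>t. e / 2 + (2 - 2 * Re (bv (P {n..}) t)) / (2 * e) \<partial>angle)"
    proof (rule integral_mono_AE[OF i1 i2])
      show "AE t in angle. cmod (bv (P {n..}) t - 1) \<le> e / 2 + (2 - 2 * Re (bv (P {n..}) t)) / (2 * e)"
        using R.AE_bv_le
      proof eventually_elim
        case (elim t)
        define x where "x = bv (P {n..}) t"
        have "(cmod (x - 1))\<^sup>2 = (cmod x)\<^sup>2 + 1 - 2 * Re x"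
          by (simp only: cmod_power2) (simp add: power2_eq_square algebra_simps)
        also have "\<dots> \<le> 2 - 2 * Re x" using elim by (simp add: x_def power_le_one)
        \<comment> \<open>Written as a product with the factor \<open>e\<close>, the bound is ready
          for the inequality of arithmetic and geometric means. This replaces the square root by an
          expression linear in \<open>Re x\<close>, whose integral is known.\<close>
        finally have sq: "(cmod (x - 1))\<^sup>2 \<le> e * ((2 - 2 * Re x) / e)" using e by simp
        have "0 \<le> (2 - 2 * Re x) / e"
          using elim complex_Re_le_cmod[of x] e by (intro divide_nonneg_pos) (auto simp: x_def)
        then have "cmod (x - 1) \<le> (e + (2 - 2 * Re x) / e) / 2"
          using le_arith_mean_if_sq_le[OF sq] e by simp
        then show ?case by (simp add: x_def[symmetric] add_divide_distrib mult.commute)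
      qed
    qed
    also have "\<dots> = e / 2 + (2 - 2 * Re (\<integral>t. bv (P {n..}) t \<partial>angle)) / (2 * e)"
      using R.integral_bv(1) by simp
    also have "\<dots> < e" using N[OF that] unfolding R.integral_bv(2) by linarith
    finally show ?thesis by simp
  qed
  then show "\<exists>N. \<forall>n\<ge>N. norm ((\<integral>t. cmod (bv (P {n..}) t - 1) \<partial>angle) - 0) < e" by blast
qed

text \<open>Finite products are unimodular on the circle, so \<open>1 - |B|\<close> equals
  \<open>1 - |P {n..}|\<close> there and is at most \<open>|P {n..} - 1|\<close>, for every
  \<open>n\<close>. By \<open>tail_L1\<close> its integral vanishes.\<close>

lemma AE_norm_bv_B: "AE t in angle. cmod (bv (P UNIV) t) = 1"
proof -
  interpret finite_measure angle by (rule finite_measure_angle)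
  interpret B: bounded_holomorphic "P UNIV" 1 by (rule bounded_holomorphic_P)
  have i: "integrable angle (\<lambda>t. 1 - cmod (bv (P UNIV) t))" using B.integral_bv(1) by auto
  have nonneg: "AE t in angle. 0 \<le> 1 - cmod (bv (P UNIV) t)" using B.AE_bv_le by eventually_elim simp
  have "(\<integral>t. 1 - cmod (bv (P UNIV) t) \<partial>angle) \<le> (\<integral>t. cmod (bv (P {n..}) t - 1) \<partial>angle)" for n
  proof (rule integral_mono_AE[OF i])
    show "integrable angle (\<lambda>t. cmod (bv (P {n..}) t - 1))"
      using bounded_holomorphic.integral_bv(1)[OF bounded_holomorphic_P] by auto
    show "AE t in angle. 1 - cmod (bv (P UNIV) t) \<le> cmod (bv (P {n..}) t - 1)"
      using bv_P_split[of n]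
    proof eventually_elim
      case (elim t)
      have "cmod (P {..<n} (cis t)) = 1" by (rule cmod_P_finite_sphere) auto
      then show ?case
        using norm_triangle_ineq2[of 1 "bv (P {n..}) t"] by (simp add: elim norm_mult norm_minus_commute)
    qed
  qed
  then have "(\<integral>t. 1 - cmod (bv (P UNIV) t) \<partial>angle) \<le> 0"
    by (intro LIMSEQ_le_const[OF tail_L1]) auto
  moreover have "0 \<le> (\<integral>t. 1 - cmod (bv (P UNIV) t) \<partial>angle)" by (rule integral_nonneg_AE[OF nonneg])
  ultimately have "AE t in angle. 1 - cmod (bv (P UNIV) t) = 0"
    using integral_nonneg_eq_0_iff_AE[OF i nonneg] by simp
  then show ?thesis by eventually_elim simp
qed

end

section \<open>Necessity\<close>

context interpolating
begin

text \<open>One more factor changes all coefficients, so the induction leaves them unspecified and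
  \<open>inverse_P_finite\<close> identifies them afterwards. Distinctness of the zeros permits
  splitting a product of two simple fractions.\<close>

lemma inverse_P_finite_partial_fractions:
  "\<exists>K \<kappa>. \<forall>z. cmod z \<le> 1 \<longrightarrow> z \<notin> a ` {..<n} \<longrightarrow> 1 / P {..<n} z = K + (\<Sum>j<n. \<kappa> j / (z - a j))"
proof (induction n)
  case 0
  show ?case by (intro exI[of _ 1]) (simp add: blaschke_part_finite)
next
  case (Suc n)
  then obtain K \<kappa> where IH: "\<And>z. cmod z \<le> 1 \<Longrightarrow> z \<notin> a ` {..<n} \<Longrightarrow> 1 / P {..<n} z = K + (\<Sum>j<n. \<kappa> j / (z - a j))"
    by blast
  define s where "s = (if a n = 0 then -1 else of_real (cmod (a n)) / a n)"
  define p q where "p = cnj (a n) / s" and "q = - (1 - cnj (a n) * a n) / s"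
  have s: "s \<noteq> 0" by (simp add: s_def)
  have factor: "1 / b n z = p + q / (z - a n)" if "cmod z \<le> 1" "z \<noteq> a n" for z
    using that s one_minus_cnj_mult_nonzero[OF a_less_1[of n], of z]
    by (simp add: blaschke_factor_def s_def[symmetric] p_def q_def divide_simps) (simp add: algebra_simps)
  have split: "(\<kappa> j / (z - a j)) * (p + q / (z - a n)) =
      (\<kappa> j * (p + q / (a j - a n))) / (z - a j) - (\<kappa> j * q / (a j - a n)) / (z - a n)"
    if "j < n" "z \<notin> a ` {..<Suc n}" for z j
  proof -
    have "a j \<noteq> a n" "z \<noteq> a j" "z \<noteq> a n" using that inj_a[of j n] by auto
    then show ?thesis by (simp add: divide_simps) (simp add: algebra_simps)
  qed
  define \<kappa>' where "\<kappa>' j = (if j < n then \<kappa> j * (p + q / (a j - a n)) else K * q - (\<Sum>j<n. \<kappa> j * q / (a j - a n)))" for j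
  have "1 / P {..<Suc n} z = K * p + (\<Sum>j<Suc n. \<kappa>' j / (z - a j))"
    if z: "cmod z \<le> 1" "z \<notin> a ` {..<Suc n}" for z
  proof -
    have "1 / P {..<Suc n} z = 1 / P {..<n} z * (1 / b n z)" by (simp add: blaschke_part_finite mult.commute)
    also have "\<dots> = (K + (\<Sum>j<n. \<kappa> j / (z - a j))) * (p + q / (z - a n))"
    proof -
      have "z \<notin> a ` {..<n}" "z \<noteq> a n" using z(2) by (auto simp: lessThan_Suc)
      then show ?thesis using IH[of z] factor[of z] z(1) by simp
    qed
    also have "\<dots> = K * p + K * q / (z - a n) + (\<Sum>j<n. (\<kappa> j / (z - a j)) * (p + q / (z - a n)))"
      unfolding sum_distrib_right[symmetric] by (simp add: algebra_simps)
    also have "(\<Sum>j<n. (\<kappa> j / (z - a j)) * (p + q / (z - a n))) =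
        (\<Sum>j<n. \<kappa>' j / (z - a j)) - (\<Sum>j<n. \<kappa> j * q / (a j - a n)) / (z - a n)"
    proof -
      have "(\<Sum>j<n. (\<kappa> j / (z - a j)) * (p + q / (z - a n))) =
          (\<Sum>j<n. \<kappa>' j / (z - a j) - (\<kappa> j * q / (a j - a n)) / (z - a n))"
        by (intro sum.cong refl, subst split[OF _ z(2)]) (auto simp: \<kappa>'_def)
      then show ?thesis by (simp only: sum_subtractf sum_divide_distrib)
    qed
    also have "K * p + K * q / (z - a n) + \<dots> = K * p + (\<Sum>j<Suc n. \<kappa>' j / (z - a j))"
      by (simp add: \<kappa>'_def diff_divide_distrib)
    finally show ?thesis .
  qed
  then show ?case by blast
qed

lemma deriv_P_finite_nonzero: "j < n \<Longrightarrow> deriv (P {..<n}) (a j) \<noteq> 0"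
proof -
  assume j: "j < n"
  have "\<delta> \<le> cmod (P ({..<n} - {j}) (a j))"
    using separated[of j] cmod_P_antimono[OF a_less_1, of "{..<n} - {j}" "- {j}" j] by auto
  then show ?thesis using cmod_deriv_P[of j "{..<n}"] j \<delta> by auto
qed

text \<open>Evaluating \<open>1 = K * P {..<n} + (\<Sum>j<n. \<kappa> j * Q {..<n} j)\<close> at \<open>a i\<close> identifies \<open>\<kappa> i\<close>.\<close>

lemma inverse_P_finite:
  "\<exists>K. \<forall>z. cmod z \<le> 1 \<longrightarrow> z \<notin> a ` {..<n} \<longrightarrow>
    1 / P {..<n} z = K + (\<Sum>j<n. 1 / deriv (P {..<n}) (a j) / (z - a j))"
proof -
  obtain K \<kappa> where K: "\<And>z. cmod z \<le> 1 \<Longrightarrow> z \<notin> a ` {..<n} \<Longrightarrow> 1 / P {..<n} z = K + (\<Sum>j<n. \<kappa> j / (z - a j))"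
    using inverse_P_finite_partial_fractions by blast
  define D where "D z = K * P {..<n} z + (\<Sum>j<n. \<kappa> j * Q {..<n} j z) - 1" for z
  have D0: "D z = 0" if "cmod z < 1" "z \<notin> a ` {..<n}" for z
  proof -
    have ne: "P {..<n} z \<noteq> 0" using that by (intro P_nonzero) auto
    have "\<kappa> j * Q {..<n} j z = P {..<n} z * (\<kappa> j / (z - a j))" if j: "j < n" for j
    proof -
      have "z \<noteq> a j" using j \<open>z \<notin> a ` {..<n}\<close> by blast
      then show ?thesis using P_eq_Q[OF \<open>cmod z < 1\<close>, of j "{..<n}"] j by simp
    qed
    then have "D z = P {..<n} z * (K + (\<Sum>j<n. \<kappa> j / (z - a j))) - 1"
      by (simp add: D_def sum_distrib_left algebra_simps)
    also have "\<dots> = 0" using K[of z] that ne by (simp flip: K)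
    finally show ?thesis .
  qed
  have holD: "D holomorphic_on ball 0 1"
    unfolding D_def[abs_def] by (intro holomorphic_intros holomorphic_P holomorphic_Q)
  have "\<kappa> i = 1 / deriv (P {..<n}) (a i)" if i: "i < n" for i
  proof -
    have "isCont D (a i)"
      using holD a_less_1[of i] by (intro continuous_on_interior[OF holomorphic_on_imp_continuous_on]) auto
    then have "(D \<longlongrightarrow> D (a i)) (at (a i))" by (simp add: isCont_def)
    moreover have "eventually (\<lambda>z. D z = 0) (at (a i))"
    proof -
      have "open (ball 0 1 - (a ` {..<n} - {a i}))" by (intro open_Diff finite_imp_closed) auto
      then show ?thesis
        unfolding eventually_at_topological
        by (intro exI[of _ "ball 0 1 - (a ` {..<n} - {a i})"]) (auto intro!: D0 simp: a_less_1)
    qed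
    then have "(D \<longlongrightarrow> 0) (at (a i))" by (simp add: tendsto_eventually)
    ultimately have "D (a i) = 0" using tendsto_unique[OF at_neq_bot] by blast
    moreover have "(\<Sum>j<n. \<kappa> j * Q {..<n} j (a i)) = (\<Sum>j\<in>{i}. \<kappa> j * Q {..<n} j (a i))"
    proof (rule sum.mono_neutral_right)
      show "\<forall>j\<in>{..<n} - {i}. \<kappa> j * Q {..<n} j (a i) = 0"
        using i by (auto simp: Q_def intro!: P_zero)
    qed (use i in auto)
    ultimately have "\<kappa> i * deriv (P {..<n}) (a i) = 1"
      using P_zero[of i "{..<n}"] i by (simp add: D_def deriv_P)
    then show ?thesis using deriv_P_finite_nonzero[OF i] by (simp add: field_simps)
  qed
  then have "(\<Sum>j<n. \<kappa> j / (z - a j)) = (\<Sum>j<n. 1 / deriv (P {..<n}) (a j) / (z - a j))" for z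
    by (intro sum.cong) auto
  then show ?thesis using K by metis
qed

text \<open>Partial fractions reduce the residue computation to Cauchy's formula at each pole; the
  constant term contributes the mean of \<open>G z * z\<close>, which is 0.\<close>

lemma integral_divide_P_finite:
  assumes G: "continuous_on (cball 0 1) G" "G holomorphic_on ball 0 1"
  shows "(\<integral>t. G (cis t) * cis t / P {..<n} (cis t) \<partial>angle) = (\<Sum>j<n. G (a j) / deriv (P {..<n}) (a j))"
proof -
  obtain K where K: "\<And>z. cmod z \<le> 1 \<Longrightarrow> z \<notin> a ` {..<n} \<Longrightarrow>
      1 / P {..<n} z = K + (\<Sum>j<n. 1 / deriv (P {..<n}) (a j) / (z - a j))"
    using inverse_P_finite[of n] by blast
  have ne: "cis t \<noteq> a j" for t j using a_less_1[of j] by (metis less_irrefl norm_cis)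
  have c0: "continuous_on (sphere 0 1) (\<lambda>z. K * (G z * z))"
    by (intro continuous_intros continuous_on_subset[OF G(1)]) auto
  have cj: "continuous_on (sphere 0 1) (\<lambda>z. G z * z / (z - a j) * (1 / deriv (P {..<n}) (a j)))" for j
    by (intro continuous_intros continuous_on_subset[OF G(1)]) (use a_less_1[of j] in auto)
  have "(\<integral>t. (cis t * G (cis t)) * cis t / (cis t - 0) \<partial>angle) = 0 * G 0"
    by (rule Cauchy_integral_angle) (auto intro!: continuous_intros holomorphic_intros G)
  then have z0: "(\<integral>t. G (cis t) * cis t \<partial>angle) = 0" by (simp add: mult.commute)
  have "G (cis t) * cis t / P {..<n} (cis t) =
      K * (G (cis t) * cis t) + (\<Sum>j<n. G (cis t) * cis t / (cis t - a j) * (1 / deriv (P {..<n}) (a j)))" for t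
  proof -
    have "1 / P {..<n} (cis t) = K + (\<Sum>j<n. 1 / deriv (P {..<n}) (a j) / (cis t - a j))"
      using ne by (intro K) auto
    then have "G (cis t) * cis t * (1 / P {..<n} (cis t)) =
        G (cis t) * cis t * (K + (\<Sum>j<n. 1 / deriv (P {..<n}) (a j) / (cis t - a j)))" by simp
    then show ?thesis by (simp add: distrib_left sum_distrib_left mult_ac)
  qed
  then have "(\<integral>t. G (cis t) * cis t / P {..<n} (cis t) \<partial>angle) =
      (\<integral>t. K * (G (cis t) * cis t) \<partial>angle) +
      (\<integral>t. (\<Sum>j<n. G (cis t) * cis t / (cis t - a j) * (1 / deriv (P {..<n}) (a j))) \<partial>angle)"
    using integrable_circle[OF c0] integrable_circle[OF cj]
    by (simp only:) (intro Bochner_Integration.integral_add Bochner_Integration.integrable_sum, auto)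
  also have "(\<integral>t. (\<Sum>j<n. G (cis t) * cis t / (cis t - a j) * (1 / deriv (P {..<n}) (a j))) \<partial>angle) =
      (\<Sum>j<n. \<integral>t. G (cis t) * cis t / (cis t - a j) * (1 / deriv (P {..<n}) (a j)) \<partial>angle)"
    by (intro Bochner_Integration.integral_sum integrable_circle[OF cj])
  also have "\<dots> = (\<Sum>j<n. G (a j) * (1 / deriv (P {..<n}) (a j)))"
    by (intro sum.cong refl) (simp only: integral_mult_left_zero Cauchy_integral_angle[OF G a_less_1])
  finally show ?thesis using z0 by simp
qed

lemma deriv_B_split: "j < n \<Longrightarrow> deriv (P UNIV) (a j) = deriv (P {..<n}) (a j) * P {n..} (a j)"
proof -
  assume j: "j < n"
  have "UNIV - {j} = ({..<n} - {j}) \<union> {n..}" using j by auto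
  then have "P (UNIV - {j}) (a j) = P ({..<n} - {j}) (a j) * P {n..} (a j)"
    using P_Un[OF a_less_1, of "{..<n} - {j}" "{n..}" j] by (simp add: disjoint_iff)
  then show ?thesis using j by (simp add: deriv_P Q_def)
qed

end

lemma cnj_cis_eq: "cnj (cis t) = 1 / cis t"
  by (simp add: cis_cnj cis_inverse[symmetric] inverse_eq_divide)

section \<open>Passage from finite products to B\<close>

locale model_space_element = interpolating +
  f: bounded_holomorphic f Mf + g: bounded_holomorphic g Mg for f g :: "complex \<Rightarrow> complex" and Mf Mg +
  fixes h :: "complex \<Rightarrow> complex"
  assumes h: "h holomorphic_on ball 0 1" "\<And>z. cmod z < 1 \<Longrightarrow> g z = z * h z"
    and boundary: "AE t in angle. bv f t = bv (blaschke_part a UNIV) t * cnj (bv g t)"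
begin

text \<open>The Szego kernel at \<open>a k\<close>, multiplied by the factor \<open>\<zeta>\<close>
  from \<open>d\<zeta> = \<i> * \<zeta> dt\<close>. On the circle its conjugate is the Cauchy kernel
  \<open>1 / (\<zeta> - a k)\<close>.\<close>

definition "szego k \<zeta> = \<zeta> / (1 - cnj (a k) * \<zeta>)"

lemma continuous_szego: "continuous_on (sphere 0 1) (szego k)"
  unfolding szego_def[abs_def] by (intro continuous_intros) (auto simp: cnj_mult_neq_1 a_less_1)

text \<open>For the dilates of \<open>f\<close>, which are continuous up to the circle, this is
  \<open>integral_divide_P_finite\<close>; both sides converge as the radii tend to 1.\<close>

lemma partial_sum_eq:
  "(\<integral>t. bv f t * (szego k (cis t) / P {..<n} (cis t)) \<partial>angle) =
    (\<Sum>j<n. f (a j) / (1 - cnj (a k) * a j) / deriv (P {..<n}) (a j))"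
proof (rule LIMSEQ_unique)
  have ne: "P {..<n} z \<noteq> 0" if "z \<in> sphere 0 1" for z
    using that cmod_P_finite_sphere[of "{..<n}" z] by auto
  have "continuous_on (sphere 0 1) (\<lambda>z. szego k z / P {..<n} z)"
    using ne by (intro continuous_intros continuous_szego continuous_on_subset[OF P_finite_continuous]) auto
  from f.integrable_bv_mult(2)[OF this]
  show "(\<lambda>m. \<integral>t. f (of_real (radius m) * cis t) * (szego k (cis t) / P {..<n} (cis t)) \<partial>angle)
      \<longlonglongrightarrow> (\<integral>t. bv f t * (szego k (cis t) / P {..<n} (cis t)) \<partial>angle)" .
  have eq: "(\<integral>t. f (of_real (radius m) * cis t) * (szego k (cis t) / P {..<n} (cis t)) \<partial>angle) =
      (\<Sum>j<n. f (of_real (radius m) * a j) / (1 - cnj (a k) * a j) / deriv (P {..<n}) (a j))" for m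
  proof -
    let ?G = "\<lambda>z. f (of_real (radius m) * z) / (1 - cnj (a k) * z)"
    have "(\<integral>t. ?G (cis t) * cis t / P {..<n} (cis t) \<partial>angle) = (\<Sum>j<n. ?G (a j) / deriv (P {..<n}) (a j))"
      by (rule integral_divide_P_finite;
          intro continuous_intros holomorphic_intros scaled_holomorphic f.hol radius)
         (auto simp: cnj_mult_neq_1 a_less_1)
    then show ?thesis by (simp add: szego_def)
  qed
  have lim: "(\<lambda>m. f (of_real (radius m) * a j)) \<longlonglongrightarrow> f (a j)" for j
  proof (rule isCont_tendsto_compose[of "a j" f])
    have "(\<lambda>m. of_real (radius m) * a j) \<longlonglongrightarrow> of_real 1 * a j"
      using filterlim_radius by (intro tendsto_intros) (simp add: filterlim_at)
    then show "(\<lambda>m. of_real (radius m) * a j) \<longlonglongrightarrow> a j" by simp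
    show "isCont f (a j)"
      using a_less_1[of j] by (intro continuous_on_interior[OF holomorphic_on_imp_continuous_on[OF f.hol]]) auto
  qed
  show "(\<lambda>m. \<integral>t. f (of_real (radius m) * cis t) * (szego k (cis t) / P {..<n} (cis t)) \<partial>angle)
      \<longlonglongrightarrow> (\<Sum>j<n. f (a j) / (1 - cnj (a k) * a j) / deriv (P {..<n}) (a j))"
    unfolding eq by (intro tendsto_sum tendsto_divide tendsto_const lim)
      (auto simp: cnj_mult_neq_1 a_less_1 less_imp_le deriv_P_finite_nonzero)
qed

lemma continuous_cnj_szego: "continuous_on (sphere 0 1) (\<lambda>\<zeta>. cnj (szego k \<zeta>))"
  by (intro continuous_intros continuous_szego)

text \<open>Up to conjugation this is Cauchy's formula for \<open>h\<close> at \<open>a k\<close>,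
  used for dilates: the factor \<open>z\<close> in \<open>g = z * h\<close> supplies the
  \<open>cis t\<close> of that formula.\<close>

lemma integral_cnj_g: "(\<integral>t. cnj (bv g t) * szego k (cis t) \<partial>angle) = cnj (h (a k))"
proof -
  have "(\<integral>t. bv g t * cnj (szego k (cis t)) \<partial>angle) = h (a k)"
  proof (rule LIMSEQ_unique)
    show "(\<lambda>m. \<integral>t. g (of_real (radius m) * cis t) * cnj (szego k (cis t)) \<partial>angle)
        \<longlonglongrightarrow> (\<integral>t. bv g t * cnj (szego k (cis t)) \<partial>angle)"
      using g.integrable_bv_mult(2)[OF continuous_cnj_szego] .
    have eq: "(\<integral>t. g (of_real (radius m) * cis t) * cnj (szego k (cis t)) \<partial>angle)
        = of_real (radius m) * h (of_real (radius m) * a k)" for m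
    proof -
      let ?G = "\<lambda>z. of_real (radius m) * h (of_real (radius m) * z)"
      have "g (of_real (radius m) * cis t) * cnj (szego k (cis t)) = ?G (cis t) * cis t / (cis t - a k)" for t
      proof -
        have ne: "cis t \<noteq> a k" using a_less_1[of k] by (metis less_irrefl norm_cis)
        have "cnj (szego k (cis t)) = 1 / (cis t - a k)"
          unfolding szego_def complex_cnj_divide complex_cnj_diff complex_cnj_mult cnj_cis_eq
          using ne by (simp add: divide_simps)
        moreover have "g (of_real (radius m) * cis t) = of_real (radius m) * cis t * h (of_real (radius m) * cis t)"
          using radius[of m] by (intro h(2)) (simp add: norm_mult)
        ultimately show ?thesis by (simp add: mult_ac)
      qed
      then have "(\<integral>t. g (of_real (radius m) * cis t) * cnj (szego k (cis t)) \<partial>angle) =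
          (\<integral>t. ?G (cis t) * cis t / (cis t - a k) \<partial>angle)" by simp
      also have "\<dots> = ?G (a k)"
        by (rule Cauchy_integral_angle) (intro continuous_intros holomorphic_intros scaled_holomorphic h radius a_less_1)+
      finally show ?thesis .
    qed
    have rad: "(\<lambda>m. of_real (radius m) :: complex) \<longlonglongrightarrow> of_real 1"
      using filterlim_radius by (intro tendsto_intros) (simp add: filterlim_at)
    have "isCont h (a k)"
      using a_less_1[of k] by (intro continuous_on_interior[OF holomorphic_on_imp_continuous_on[OF h(1)]]) auto
    moreover have "(\<lambda>m. of_real (radius m) * a k) \<longlonglongrightarrow> a k" using tendsto_mult[OF rad tendsto_const[of "a k"]] by simp
    ultimately have "(\<lambda>m. h (of_real (radius m) * a k)) \<longlonglongrightarrow> h (a k)" by (rule isCont_tendsto_compose)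
    from tendsto_mult[OF rad this]
    show "(\<lambda>m. \<integral>t. g (of_real (radius m) * cis t) * cnj (szego k (cis t)) \<partial>angle) \<longlonglongrightarrow> h (a k)"
      unfolding eq by simp
  qed
  moreover have "(\<integral>t. cnj (bv g t * cnj (szego k (cis t))) \<partial>angle) = cnj (\<integral>t. bv g t * cnj (szego k (cis t)) \<partial>angle)"
    by (rule Bochner_Integration.integral_cnj)
  ultimately show ?thesis by simp
qed

text \<open>On the circle \<open>f / P {..<n} = P {n..} * cnj g\<close>, so the error is the mean of
  \<open>(P {n..} - 1) * cnj g * szego k\<close>. Convergence of the tail in L1 suffices, since the
  other two factors are bounded.\<close>

lemma partial_sums_tendsto:
  "(\<lambda>n. \<Sum>j<n. f (a j) / (1 - cnj (a k) * a j) / deriv (P {..<n}) (a j)) \<longlonglongrightarrow> cnj (h (a k))"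
proof -
  interpret finite_measure angle by (rule finite_measure_angle)
  have gm: "integrable angle (\<lambda>t. cnj (bv g t) * szego k (cis t))"
    using integrable_cnj[OF g.integrable_bv_mult(1)[OF continuous_cnj_szego[of k]]] by simp
  have "bounded (szego k ` sphere 0 1)"
    by (intro compact_imp_bounded compact_continuous_image continuous_szego) simp
  then obtain C where "\<forall>x\<in>szego k ` sphere 0 1. cmod x \<le> C" unfolding bounded_iff by blast
  then have C: "cmod (szego k \<zeta>) \<le> C" if "\<zeta> \<in> sphere 0 1" for \<zeta> using that by blast
  have Mg0: "0 \<le> Mg" using order_trans[OF norm_ge_zero g.bdd[of 0]] by simp
  define S where "S n = (\<Sum>j<n. f (a j) / (1 - cnj (a k) * a j) / deriv (P {..<n}) (a j))" for n
  have "norm (S n - cnj (h (a k))) \<le> (Mg * C) * (\<integral>t. cmod (bv (P {n..}) t - 1) \<partial>angle)" for n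
  proof -
    interpret R: bounded_holomorphic "P {n..}" 1 by (rule bounded_holomorphic_P)
    have ne: "P {..<n} (cis t) \<noteq> 0" for t
      using cmod_P_finite_sphere[of "{..<n}" "cis t"] by auto
    have contP: "continuous_on (sphere 0 1) (\<lambda>z. szego k z / P {..<n} z)"
      using cmod_P_finite_sphere[of "{..<n}"]
      by (intro continuous_intros continuous_szego continuous_on_subset[OF P_finite_continuous]) force+
    have i1: "integrable angle (\<lambda>t. bv f t * (szego k (cis t) / P {..<n} (cis t)))"
      by (rule f.integrable_bv_mult(1)[OF contP])
    have i3: "integrable angle (\<lambda>t. (Mg * C) * cmod (bv (P {n..}) t - 1))"
      using R.integral_bv(1) by auto
    have i2: "integrable angle (\<lambda>t. bv f t * (szego k (cis t) / P {..<n} (cis t)) - cnj (bv g t) * szego k (cis t))"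
      by (rule Bochner_Integration.integrable_diff[OF i1 gm])
    have le: "AE t in angle. norm (bv f t * (szego k (cis t) / P {..<n} (cis t)) - cnj (bv g t) * szego k (cis t))
        \<le> (Mg * C) * cmod (bv (P {n..}) t - 1)"
      using boundary bv_P_split[of n] g.AE_bv_le
    proof eventually_elim
      case (elim t)
      define s where "s = szego k (cis t)"
      have "P {..<n} (cis t) * bv (P {n..}) t * cnj (bv g t) * (s / P {..<n} (cis t)) = bv (P {n..}) t * cnj (bv g t) * s"
        using ne[of t] by simp
      then have "bv f t * (s / P {..<n} (cis t)) - cnj (bv g t) * s = cnj (bv g t) * s * (bv (P {n..}) t - 1)"
        unfolding elim(1,2) by (simp add: algebra_simps)
      moreover have "cmod (cnj (bv g t) * s) \<le> Mg * C"
        unfolding norm_mult complex_mod_cnj s_def by (intro mult_mono elim(3) C Mg0) auto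
      then have "cmod (cnj (bv g t) * s) * cmod (bv (P {n..}) t - 1) \<le> Mg * C * cmod (bv (P {n..}) t - 1)"
        by (rule mult_right_mono) simp
      ultimately show ?case by (simp only: s_def norm_mult)
    qed
    have eq: "S n - cnj (h (a k)) = (\<integral>t. bv f t * (szego k (cis t) / P {..<n} (cis t)) - cnj (bv g t) * szego k (cis t) \<partial>angle)"
      unfolding S_def partial_sum_eq[symmetric] integral_cnj_g[symmetric] using i1 gm by simp
    have "norm (S n - cnj (h (a k))) \<le> (\<integral>t. norm (bv f t * (szego k (cis t) / P {..<n} (cis t)) - cnj (bv g t) * szego k (cis t)) \<partial>angle)"
      unfolding eq by (rule integral_norm_bound)
    also have "\<dots> \<le> (\<integral>t. (Mg * C) * cmod (bv (P {n..}) t - 1) \<partial>angle)"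
      by (rule integral_mono_AE[OF integrable_norm[OF i2] i3 le])
    also have "\<dots> = (Mg * C) * (\<integral>t. cmod (bv (P {n..}) t - 1) \<partial>angle)" by simp
    finally show ?thesis .
  qed
  moreover have "(\<lambda>n. (Mg * C) * (\<integral>t. cmod (bv (P {n..}) t - 1) \<partial>angle)) \<longlonglongrightarrow> (Mg * C) * 0"
    by (intro tendsto_intros tail_L1)
  ultimately have "(\<lambda>n. S n - cnj (h (a k))) \<longlonglongrightarrow> 0"
    by (intro Lim_null_comparison[of "\<lambda>n. S n - cnj (h (a k))" "\<lambda>n. (Mg * C) * (\<integral>t. cmod (bv (P {n..}) t - 1) \<partial>angle)"]) auto
  then show ?thesis unfolding S_def[symmetric] by (simp add: LIM_zero_iff)
qed

text \<open>The finite sums contain the derivatives of \<open>P {..<n}\<close>, not those of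
  \<open>B\<close>. By \<open>deriv_B_split\<close> their terms are those of the infinite series
  times the tail \<open>P {n..} (a j)\<close>, which tends to 1 and is bounded by 1, and Tannery's
  theorem exchanges limit and sum.\<close>

lemma infinite_sum_eq:
  "(\<Sum>j. f (a j) / (deriv (P UNIV) (a j) * (1 - a j * cnj (a k)))) = cnj (h (a k))"
proof -
  define \<alpha> where "\<alpha> j = f (a j) / (deriv (P UNIV) (a j) * (1 - a j * cnj (a k)))" for j
  define R where "R j n = (if j < n then \<alpha> j * P {n..} (a j) else 0)" for j n
  define B where "B = Mf / \<delta> / (1 - cmod (a k))"
  have Mf0: "0 \<le> Mf" using order_trans[OF norm_ge_zero f.bdd[of 0]] by simp
  have \<alpha>: "cmod (\<alpha> j) \<le> B * A j" for j
  proof -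
    have "cmod (f (a j) / deriv (P UNIV) (a j)) \<le> cmod (f (a j)) / \<delta> * A j" by (rule divide_deriv_B_le)
    also have "\<dots> \<le> Mf / \<delta> * A j"
      using f.bdd[OF a_less_1] \<delta> one_minus_sq_pos[of j] by (intro mult_right_mono divide_right_mono) auto
    finally have 1: "cmod (f (a j) / deriv (P UNIV) (a j)) \<le> Mf / \<delta> * A j" .
    have 2: "1 - cmod (a k) \<le> cmod (1 - a j * cnj (a k))"
      using denominator_ge[of "cnj (a k)" "cmod (a k)" j] a_less_1[of k]
        complex_mod_cnj[of "1 - a j * cnj (a k)"] denominator_ge[of "a k" "cmod (a k)" j] by simp
    have "cmod (\<alpha> j) = cmod (f (a j) / deriv (P UNIV) (a j)) / cmod (1 - a j * cnj (a k))"
      by (simp add: \<alpha>_def norm_divide norm_mult)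
    also have "\<dots> \<le> (Mf / \<delta> * A j) / (1 - cmod (a k))"
      using 1 2 a_less_1[of k] Mf0 \<delta> one_minus_sq_pos[of j] by (intro frac_le mult_nonneg_nonneg) auto
    finally show ?thesis by (simp add: B_def)
  qed
  have "(\<lambda>n. \<Sum>j. R j n) \<longlonglongrightarrow> suminf \<alpha>"
  proof (rule tannerys_theorem[THEN conjunct2, THEN conjunct2])
    show "(\<lambda>n. R j n) \<longlonglongrightarrow> \<alpha> j" for j
    proof -
      have "(\<lambda>n. \<alpha> j * P {n..} (a j)) \<longlonglongrightarrow> \<alpha> j * 1"
        by (intro tendsto_intros P_tail_tendsto_1 a_less_1)
      moreover have "eventually (\<lambda>n. \<alpha> j * P {n..} (a j) = R j n) sequentially"
        using eventually_gt_at_top[of j] by eventually_elim (simp add: R_def)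
      ultimately show ?thesis by (simp add: tendsto_cong)
    qed
    show "\<forall>\<^sub>F (j, n) in sequentially \<times>\<^sub>F sequentially. norm (R j n) \<le> B * A j"
    proof (intro always_eventually allI, clarify)
      fix j n
      have "norm (R j n) \<le> cmod (\<alpha> j)"
        using cmod_P_le_1[OF a_less_1, of "{n..}" j] by (auto simp: R_def norm_mult mult_left_le)
      then show "norm (R j n) \<le> B * A j" using \<alpha>[of j] by linarith
    qed
    show "summable (\<lambda>j. B * A j)" by (intro summable_mult summable_A)
  qed auto
  moreover have "(\<Sum>j. R j n) = (\<Sum>j<n. f (a j) / (1 - cnj (a k) * a j) / deriv (P {..<n}) (a j))" for n
  proof -
    have "(\<Sum>j. R j n) = (\<Sum>j<n. R j n)" by (rule suminf_finite) (auto simp: R_def)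
    also have "\<dots> = (\<Sum>j<n. f (a j) / (1 - cnj (a k) * a j) / deriv (P {..<n}) (a j))"
    proof (rule sum.cong)
      fix j assume "j \<in> {..<n}"
      then have j: "j < n" by simp
      have "P {n..} (a j) \<noteq> 0" using deriv_B_nonzero[of j] deriv_B_split[OF j] by auto
      then show "R j n = f (a j) / (1 - cnj (a k) * a j) / deriv (P {..<n}) (a j)"
        using j by (simp add: R_def \<alpha>_def deriv_B_split[OF j] mult_ac)
    qed simp
    finally show ?thesis .
  qed
  ultimately have "(\<lambda>n. \<Sum>j<n. f (a j) / (1 - cnj (a k) * a j) / deriv (P {..<n}) (a j)) \<longlonglongrightarrow> suminf \<alpha>" by simp
  then show ?thesis using LIMSEQ_unique[OF _ partial_sums_tendsto[of k]] by (simp add: \<alpha>_def[abs_def])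
qed

end

section \<open>The two implications\<close>

lemma HinfE:
  assumes "f \<in> Hinf"
  obtains M where "f holomorphic_on ball 0 1" "\<And>z. cmod z < 1 \<Longrightarrow> cmod (f z) \<le> M"
proof -
  have "bounded (f ` ball 0 1)" using assms by (simp add: Hinf_def)
  then obtain M where M: "\<forall>x\<in>f ` ball 0 1. cmod x \<le> M" unfolding bounded_iff by blast
  show thesis by (rule that[of M]) (use assms M in \<open>auto simp: Hinf_def\<close>)
qed

text \<open>The infimum itself serves as \<open>\<delta>\<close>, because
  \<open>1 - |a k| \<le> 1 - |a k|\<^sup>2\<close> and \<open>cmod_deriv_P\<close> turns the larger
  weight into the separation product.\<close>

lemma interpolating_blaschke_locale:
  assumes "interpolating_blaschke a"
  shows "\<exists>\<delta>. interpolating a \<delta>"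
proof -
  interpret blaschke a using assms by unfold_locales (simp add: interpolating_blaschke_def)
  define \<delta> where "\<delta> = (INF j. cmod (deriv (blaschke_product a) (a j)) * (1 - cmod (a j)))"
  have "\<delta> \<le> cmod (P (- {k}) (a k))" for k
  proof -
    have "\<delta> \<le> cmod (deriv (blaschke_product a) (a k)) * (1 - cmod (a k))"
      unfolding \<delta>_def using a_less_1
      by (intro cINF_lower bdd_belowI2[of _ 0] mult_nonneg_nonneg) (auto intro: less_imp_le)
    also have "\<dots> \<le> cmod (deriv (blaschke_product a) (a k)) * (1 - (cmod (a k))\<^sup>2)"
      by (intro mult_left_mono one_minus_le_sq) auto
    also have "\<dots> = cmod (P (- {k}) (a k))"
      using cmod_deriv_P[of k UNIV] by (simp add: blaschke_part_UNIV Compl_eq_Diff_UNIV)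
    finally show ?thesis .
  qed
  moreover have "0 < \<delta>" using assms by (simp add: interpolating_blaschke_def \<delta>_def)
  ultimately have "interpolating a \<delta>" by unfold_locales auto
  then show ?thesis by blast
qed

context interpolating
begin

lemma sum_bounded_if_trace:
  assumes f: "f \<in> Kinf (blaschke_product a)" and w: "\<And>j. f (a j) = w j"
  shows "bdd_above (range (\<lambda>k. cmod (\<Sum>j. w j / (deriv (blaschke_product a) (a j) * (1 - a j * cnj (a k))))))"
proof -
  obtain g where g: "g \<in> Hinf0" and AE: "AE \<zeta> in arclength. \<exists>u b v.
      has_boundary_value f \<zeta> u \<and> has_boundary_value (P UNIV) \<zeta> b \<and> has_boundary_value g \<zeta> v \<and> u = b * cnj v"
    and fH: "f \<in> Hinf"
    using f unfolding Kinf_def blaschke_part_UNIV by blast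
  obtain Mf where Mf: "f holomorphic_on ball 0 1" "\<And>z. cmod z < 1 \<Longrightarrow> cmod (f z) \<le> Mf"
    using HinfE[OF fH] by blast
  have "g \<in> Hinf" "g 0 = 0" using g by (auto simp: Hinf0_def)
  then obtain Mg where Mg: "g holomorphic_on ball 0 1" "\<And>z. cmod z < 1 \<Longrightarrow> cmod (g z) \<le> Mg" "g 0 = 0"
    using HinfE[of g] by blast
  obtain h where h: "h holomorphic_on ball 0 1" "\<And>z. cmod z < 1 \<Longrightarrow> g z = z * h z"
    using Schwarz3[OF Mg(1,3)] by metis
  have bd: "AE t in angle. bv f t = bv (P UNIV) t * cnj (bv g t)"
    using AE_arclength_imp_angle[OF AE]
    by eventually_elim (auto dest!: bv_eqI)
  interpret model_space_element a \<delta> f g Mf Mg h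
    by unfold_locales (use Mf Mg h bd in auto)
  \<comment> \<open>Where \<open>|z| > 1 / 2\<close>, \<open>h = g / z\<close> is at most
    \<open>2 * Mg\<close>; near 0 the division gives no bound, and compactness of the smaller disc
    is used instead.\<close>
  have "cball (0 :: complex) (1 / 2) \<subseteq> ball 0 1" by auto
  then have "bounded (h ` cball 0 (1 / 2))"
    by (intro compact_imp_bounded compact_continuous_image compact_cball holomorphic_on_imp_continuous_on holomorphic_on_subset[OF h(1)])
  then obtain C where "\<forall>x\<in>h ` cball 0 (1 / 2). cmod x \<le> C" unfolding bounded_iff by blast
  then have C: "cmod (h z) \<le> C" if "z \<in> cball 0 (1 / 2)" for z using that by blast
  have hb: "cmod (h z) \<le> max C (2 * Mg)" if z: "cmod z < 1" for z
  proof (cases "cmod z \<le> 1 / 2")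
    case True
    then show ?thesis using C[of z] by simp
  next
    case False
    have "1 / 2 * cmod (h z) \<le> cmod z * cmod (h z)" using False by (intro mult_right_mono) auto
    also have "\<dots> = cmod (g z)" using h(2)[OF z] by (simp add: norm_mult)
    also have "\<dots> \<le> Mg" using Mg(2)[OF z] .
    finally show ?thesis by simp
  qed
  show ?thesis
  proof (rule bdd_aboveI2)
    fix k
    have "(\<Sum>j. w j / (deriv (blaschke_product a) (a j) * (1 - a j * cnj (a k)))) = cnj (h (a k))"
      using infinite_sum_eq[of k] by (simp add: w blaschke_part_UNIV)
    then show "cmod (\<Sum>j. w j / (deriv (blaschke_product a) (a j) * (1 - a j * cnj (a k)))) \<le> max C (2 * Mg)"
      using hb[OF a_less_1[of k]] by simp
  qed
qed

lemma trace_if_sum_bounded: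
  assumes w: "bounded (range w)"
    and bdd: "bdd_above (range (\<lambda>k. cmod (\<Sum>j. w j / (deriv (blaschke_product a) (a j) * (1 - a j * cnj (a k))))))"
  shows "w \<in> trace_on (Kinf (blaschke_product a)) a"
proof -
  obtain W where W: "\<And>j. cmod (w j) \<le> W" using w unfolding bounded_iff by auto
  obtain T where T: "\<And>k. cmod (\<Sum>j. w j / (deriv (P UNIV) (a j) * (1 - a j * cnj (a k)))) \<le> T"
    using bdd unfolding bdd_above_def blaschke_part_UNIV by auto
  \<comment> \<open>Boundedness of \<open>w\<close> and the lower bound \<open>\<delta>\<close> for
    \<open>|B' (a j)| * A j\<close> give the size demanded by \<open>interpolation_data\<close>,
    with \<open>\<Gamma> = W / \<delta>\<close>.\<close>
  define \<gamma> where "\<gamma> j = w j / deriv (P UNIV) (a j)" for j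
  have W\<gamma>: "cmod (\<gamma> j) \<le> W / \<delta> * A j" for j
  proof -
    have "cmod (\<gamma> j) \<le> cmod (w j) / \<delta> * A j" unfolding \<gamma>_def by (rule divide_deriv_B_le)
    also have "\<dots> \<le> W / \<delta> * A j"
      using W[of j] \<delta> one_minus_sq_pos[of j] by (intro mult_right_mono divide_right_mono) auto
    finally show ?thesis .
  qed
  have "w j / (deriv (P UNIV) (a j) * (1 - a j * cnj (a k))) = \<gamma> j / (1 - a j * cnj (a k))" for j k
    by (simp add: \<gamma>_def)
  then interpret interpolation_data a \<delta> \<gamma> "W / \<delta>" T
    by unfold_locales (use W\<gamma> T in auto)
  have "F (a k) = w k" for k using deriv_B_nonzero[of k] by (simp add: F_at_zero \<gamma>_def)
  moreover have "F \<in> Kinf (P UNIV)"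
    unfolding Kinf_def
  proof (intro CollectI conjI bexI[OF _ zh_in_Hinf0] F_in_Hinf)
    interpret B: bounded_holomorphic "P UNIV" 1 by (rule bounded_holomorphic_P)
    have vH: "(\<lambda>z. z * h z) holomorphic_on ball 0 1" "bounded ((\<lambda>z. z * h z) ` ball 0 1)"
      using zh_in_Hinf0 by (auto simp: Hinf0_def Hinf_def)
    \<comment> \<open>Fatou's theorem supplies the radial limits of \<open>B\<close> and of
      \<open>z * h z\<close>; that of \<open>F\<close> then follows with the required value wherever
      \<open>|B| = 1\<close>.\<close>
    have "AE t in angle. \<exists>u b v. has_boundary_value F (cis t) u \<and> has_boundary_value (P UNIV) (cis t) b \<and>
        has_boundary_value (\<lambda>z. z * h z) (cis t) v \<and> u = b * cnj v"
      using AE_arclength_imp_angle[OF Fatou_radial_limits[OF vH]] B.AE_bv AE_norm_bv_B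
    proof eventually_elim
      case (elim t)
      then obtain v where "has_boundary_value (\<lambda>z. z * h z) (cis t) v" by blast
      then show ?case using F_boundary_value[OF norm_cis elim(2,3)] elim(2) by blast
    qed
    then show "AE \<zeta> in arclength. \<exists>u b v. has_boundary_value F \<zeta> u \<and> has_boundary_value (P UNIV) \<zeta> b \<and>
        has_boundary_value (\<lambda>z. z * h z) \<zeta> v \<and> u = b * cnj v"
      by (rule AE_arclengthI)
  qed
  ultimately show ?thesis unfolding trace_on_def blaschke_part_UNIV by blast
qed

end

theorem theorem1p1:
  fixes a w :: "nat \<Rightarrow> complex"
  assumes "interpolating_blaschke a"
    and "bounded (range w)"
  shows "w \<in> trace_on (Kinf (blaschke_product a)) a \<longleftrightarrow>
    bdd_above (range (\<lambda>k.
      cmod (\<Sum>j. w j / (deriv (blaschke_product a) (a j) * (1 - a j * cnj (a k))))))"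
proof -
  obtain \<delta> where "interpolating a \<delta>" using interpolating_blaschke_locale[OF assms(1)] by blast
  then interpret interpolating a \<delta> .
  show ?thesis
  proof
    assume "w \<in> trace_on (Kinf (blaschke_product a)) a"
    then obtain f where "f \<in> Kinf (blaschke_product a)" "\<And>j. f (a j) = w j"
      unfolding trace_on_def by blast
    then show "bdd_above (range (\<lambda>k.
        cmod (\<Sum>j. w j / (deriv (blaschke_product a) (a j) * (1 - a j * cnj (a k))))))"
      by (rule sum_bounded_if_trace)
  qed (rule trace_if_sum_bounded[OF assms(2)])
qed

end
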